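(* Let $X$, $\lambda$, $R\in\mathbb C(X)$ and $\mathcal K=\mathbb C(X)$ with derivation $'=\frac{d}{d\lambda}$ be as in the context, and let $\mathcal G\subset \mathrm{Aut}(X)$ be the Kummer $\mathcal D$-groupoid, i.e. the $\mathcal D$-groupoid defined by the differential equation $$S_\lambda(\varphi)+R(\varphi)\,(\varphi')^2=R(\lambda).$$ If the Riccati equation $$u'+u^2+\tfrac12 R(\lambda)=0$$ has no solution $u$ algebraic over $\mathcal K$, then $\mathcal G$ has no proper sub-$\mathcal D$-groupoid of order greater than $0$; that is, there is no $\mathcal D$-groupoid $\mathcal H\subsetneq\mathcal G$ of order greater than $0$.
   Context: Setting. $R(\lambda)\in\mathbb C(\lambda)^{\mathrm{alg}}$ is an algebraic function. $X$ is a smooth irreducible affine complex algebraic curve, obtained from a suitable ramified covering $\lambda$ of $\overline{\mathbb C}=\mathbb{CP}^1$ on which $R$ becomes a rational function, by removing the zeros and poles of $d\lambda$ and the poles of $R$. Thus the vector field $\frac{d}{d\lambda}$ has neither zeros nor poles on $X$, and $R$ is a regular function on $X$. $\mathcal K=\mathbb C(X)$ is a differential field with derivation $\frac{d}{d\lambda}$. Schwarzian derivative. $S_\lambda(\varphi)=\left(\frac{\varphi''}{\varphi'}\right)'-\frac12\left(\frac{\varphi''}{\varphi'}\right)^2=\frac{\varphi'''}{\varphi'}-\frac32\left(\frac{\varphi''}{\varphi'}\right)^2$, with $'=\frac{d}{d\lambda}$. Jets. $\mathrm{Aut}_k(X)$ is the algebraic groupoid over $X$ of $k$-jets of local biholomorphisms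 between open subsets of $X$, with source and target maps to $X$ and with composition and inversion of jets. $\mathrm{Aut}_0(X)=X\times X$, and for $k\ge1$, $\mathrm{Aut}_k(X)\simeq X\times X\times\mathbb C^*\times\mathbb C^{k-1}$ with coordinates (source $\lambda$, target $\varphi$, $\varphi',\varphi'',\dots,\varphi^{(k)}$), where $\varphi^{(i)}$ is the $i$-th derivative with respect to $\lambda$ of the map read in the coordinate $\lambda$ on source and target. $R(\lambda)$ and $R(\varphi)$ denote the pullbacks of $R$ by the source and target maps. $\mathrm{Aut}(X)=\varprojlim_k\mathrm{Aut}_k(X)$ has ring of regular functions $\mathcal O_{\mathrm{Aut}(X)}=\bigcup_k\mathcal O_{\mathrm{Aut}_k(X)}$. This is a differential ring with the total derivative $\frac{d}{d\lambda}=\frac{\partial}{\partial\lambda}+\varphi'\frac{\partial}{\partial\varphi}+\varphi''\frac{\partial}{\partial\varphi'}+\cdots$. Closed sets. A Zariski closed subset $Z\subset\mathrm{Aut}(X)$ is given by a radical ideal $\mathcal E\subset\mathcal O_{\mathrm{Aut}(X)}$; its truncation $Z_k\subset \mathrm{Aut}_k(X)$ is the zero set of $\mathcal E\cap\mathcal O_{\mathrm{Aut}_k(X)}$. A $\mathcal D$-ideal is an ideal stable under $\frac{d}{d\lambda}$. $Z$ is Kolchin closed if its radical ideal is a $\mathcal D$-ideal. Groupoids. A strict algebraic subgroupoid of $\mathrm{Aut}_k(X)$ is a Zariski closed subset which is also a smooth subgroupoid (over the base $X$, containing all identities). A rational subgroupoid $\mathcal G_k\subset\mathrm{Aut}_k(X)$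 is a Zariski closed subset such that, for some non-empty open $U\subset X$, the restriction $\mathcal G_k|_U$ (jets with source and target in $U$) is dense in $\mathcal G_k$ and is a strict algebraic subgroupoid of $\mathrm{Aut}_k(U)$. A $\mathcal D$-groupoid on $X$ is a Kolchin closed set $\mathcal G=\{\mathcal G_k\}_{k\in\mathbb N}\subset\mathrm{Aut}(X)$ such that every truncation $\mathcal G_k$ is a rational subgroupoid. Its order is the smallest $k\geq 0$ such that $\mathcal G_k\subsetneq\mathrm{Aut}_k(X)$. A sub-$\mathcal D$-groupoid of $\mathcal G$ is a $\mathcal D$-groupoid contained in $\mathcal G$. Kummer groupoid. It is the Kolchin closed subset of $\mathrm{Aut}(X)$ defined by the radical $\mathcal D$-ideal generated by $S_\lambda(\varphi)-R(\lambda)+R(\varphi)(\varphi')^2$, where $S_\lambda(\varphi)=\frac{\varphi'''}{\varphi'}-\frac32\left(\frac{\varphi''}{\varphi'}\right)^2\in\mathcal O_{\mathrm{Aut}_3(X)}$. It is a $\mathcal D$-groupoid of order $3$. *)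

theory Defs
  imports
    "HOL-Analysis.Analysis"
    "HOL-Computational_Algebra.Formal_Power_Series"
    "HOL-Library.Extended_Nat"
    "HOL-Algebra.Algebraic_Closure"
begin

no_notation var (\<open>X\<index>\<close>)

section \<open>Algebraic functions on affine spaces\<close>

text \<open>
  A point of an affine space with coordinates indexed by a type is a function from that type
  to the complex numbers, and regular functions are honest functions of points; over the
  infinite field of complex numbers a polynomial is determined by its values.
\<close>

text \<open>The complex algebra of functions generated by \<open>G\<close>.\<close>
inductive_set alg :: "('p \<Rightarrow> complex) set \<Rightarrow> ('p \<Rightarrow> complex) set"
  for G :: "('p \<Rightarrow> complex) set" where
  gen: "f \<in> G \<Longrightarrow> f \<in> alg G"
| const: "(\<lambda>p. c) \<in> alg G"
| add: "f \<in> alg G \<Longrightarrow> g \<in> alg G \<Longrightarrow> (\<lambda>p. f p + g p) \<in> alg G"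
| mult: "f \<in> alg G \<Longrightarrow> g \<in> alg G \<Longrightarrow> (\<lambda>p. f p * g p) \<in> alg G"

definition polys :: "(('i \<Rightarrow> complex) \<Rightarrow> complex) set" where
  "polys = alg (range (\<lambda>i p. p i))"

text \<open>The ring of restrictions to \<open>S\<close> of the functions in \<open>A\<close>.\<close>
definition fun_ring :: "('p \<Rightarrow> complex) set \<Rightarrow> 'p set \<Rightarrow> ('p \<Rightarrow> complex) ring" where
  "fun_ring A S =
    \<lparr>carrier = (\<lambda>f. restrict f S) ` A,
     mult = (\<lambda>f g. \<lambda>p\<in>S. f p * g p), one = (\<lambda>p\<in>S. 1),
     zero = (\<lambda>p\<in>S. 0), add = (\<lambda>f g. \<lambda>p\<in>S. f p + g p)\<rparr>"

text \<open>The derivative of \<open>f\<close> at \<open>p\<close> along the vector \<open>v\<close>.\<close>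
definition dir_deriv ::
  "(('i \<Rightarrow> complex) \<Rightarrow> complex) \<Rightarrow> ('i \<Rightarrow> complex) \<Rightarrow> ('i \<Rightarrow> complex) \<Rightarrow> complex" where
  "dir_deriv f p v = deriv (\<lambda>t. f (\<lambda>i. p i + t * v i)) 0"

text \<open>
  The Jacobian criterion: near \<open>p\<close>, for the Zariski topology, the subset \<open>Z\<close> of the affine
  variety \<open>M\<close> (which will be open in an affine space) is cut out by \<open>r\<close> functions from \<open>A\<close>
  whose differentials are linearly independent at \<open>p\<close>.
\<close>
definition smooth_at ::
  "(('i \<Rightarrow> complex) \<Rightarrow> complex) set \<Rightarrow> ('i \<Rightarrow> complex) set \<Rightarrow> ('i \<Rightarrow> complex) set \<Rightarrow> nat
    \<Rightarrow> ('i \<Rightarrow> complex) \<Rightarrow> bool" where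
  "smooth_at A M Z r p \<longleftrightarrow>
    (\<exists>F :: nat \<Rightarrow> ('i \<Rightarrow> complex) \<Rightarrow> complex.
      (\<forall>i<r. F i \<in> A \<and> (\<forall>q\<in>Z. F i q = 0)) \<and>
      (\<exists>g\<in>A. g p \<noteq> 0 \<and> (\<forall>q\<in>M. g q \<noteq> 0 \<longrightarrow> (\<forall>i<r. F i q = 0) \<longrightarrow> q \<in> Z)) \<and>
      (\<forall>c. (\<forall>v. (\<Sum>i<r. c i * dir_deriv (F i) p v) = 0) \<longrightarrow> (\<forall>i<r. c i = 0)))"


section \<open>Affine curves\<close>

definition zariski_closed :: "('n \<Rightarrow> complex) set \<Rightarrow> bool" where
  "zariski_closed Y \<longleftrightarrow> (\<exists>S\<subseteq>polys. Y = {x. \<forall>f\<in>S. f x = 0})"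

definition zariski_open_in :: "('n \<Rightarrow> complex) set \<Rightarrow> ('n \<Rightarrow> complex) set \<Rightarrow> bool" where
  "zariski_open_in X U \<longleftrightarrow> (\<exists>Y. zariski_closed Y \<and> U = X - Y)"

definition zariski_irreducible :: "('n \<Rightarrow> complex) set \<Rightarrow> bool" where
  "zariski_irreducible X \<longleftrightarrow> X \<noteq> {} \<and>
    (\<forall>Y1 Y2. zariski_closed Y1 \<longrightarrow> zariski_closed Y2 \<longrightarrow> X \<subseteq> Y1 \<union> Y2 \<longrightarrow> X \<subseteq> Y1 \<or> X \<subseteq> Y2)"

text \<open>Smooth of dimension one, that is, of codimension \<open>CARD('n) - 1\<close> in the affine space.\<close>
definition smooth_irreducible_affine_curve :: "('n::finite \<Rightarrow> complex) set \<Rightarrow> bool" where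
  "smooth_irreducible_affine_curve X \<longleftrightarrow>
    zariski_closed X \<and> zariski_irreducible X \<and>
    (\<forall>x\<in>X. smooth_at polys UNIV X (CARD('n) - 1) x)"

definition coord_ring :: "('n \<Rightarrow> complex) set \<Rightarrow> (('n \<Rightarrow> complex) \<Rightarrow> complex) ring" where
  "coord_ring X = fun_ring polys X"

definition tangent_space :: "('n \<Rightarrow> complex) set \<Rightarrow> ('n \<Rightarrow> complex) \<Rightarrow> ('n \<Rightarrow> complex) set" where
  "tangent_space X x = {v. \<forall>f\<in>polys. (\<forall>y\<in>X. f y = 0) \<longrightarrow> dir_deriv f x v = 0}"

text \<open>
  In what follows \<open>lam\<close> is a polynomial function on the ambient space whose restriction to the
  curve is the function \<open>\<lambda>\<close>. The next condition says that \<open>d\<lambda>\<close> has no zeros on \<open>X\<close>.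
\<close>
definition nonvanishing_differential ::
  "('n \<Rightarrow> complex) set \<Rightarrow> (('n \<Rightarrow> complex) \<Rightarrow> complex) \<Rightarrow> bool" where
  "nonvanishing_differential X lam \<longleftrightarrow> (\<forall>x\<in>X. \<exists>v\<in>tangent_space X x. dir_deriv lam x v \<noteq> 0)"

text \<open>
  The vector field \<open>d/d\<lambda>\<close> on \<open>X\<close>. Tangent spaces of the curve are one-dimensional, so if
  \<open>d\<lambda>\<close> has no zeros, there is exactly one tangent vector at each point on which \<open>d\<lambda>\<close> is 1.
\<close>
definition lam_field ::
  "('n \<Rightarrow> complex) set \<Rightarrow> (('n \<Rightarrow> complex) \<Rightarrow> complex) \<Rightarrow> ('n \<Rightarrow> complex) \<Rightarrow> 'n \<Rightarrow> complex" where
  "lam_field X lam x = (THE v. v \<in> tangent_space X x \<and> dir_deriv lam x v = 1)"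

definition lam_deriv ::
  "('n \<Rightarrow> complex) set \<Rightarrow> (('n \<Rightarrow> complex) \<Rightarrow> complex) \<Rightarrow> (('n \<Rightarrow> complex) \<Rightarrow> complex)
    \<Rightarrow> ('n \<Rightarrow> complex) \<Rightarrow> complex" where
  "lam_deriv X lam f x = dir_deriv f x (lam_field X lam x)"


section \<open>The differential field of rational functions and its algebraic closure\<close>

definition derivation :: "('l, 'm) ring_scheme \<Rightarrow> ('l \<Rightarrow> 'l) \<Rightarrow> bool" where
  "derivation L \<delta> \<longleftrightarrow> \<delta> \<in> carrier L \<rightarrow> carrier L \<and>
    (\<forall>a\<in>carrier L. \<forall>b\<in>carrier L.
      \<delta> (a \<oplus>\<^bsub>L\<^esub> b) = \<delta> a \<oplus>\<^bsub>L\<^esub> \<delta> b \<and>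
      \<delta> (a \<otimes>\<^bsub>L\<^esub> b) = \<delta> a \<otimes>\<^bsub>L\<^esub> b \<oplus>\<^bsub>L\<^esub> a \<otimes>\<^bsub>L\<^esub> \<delta> b)"

text \<open>The fractions, inside \<open>L\<close>, of the regular functions on \<open>X\<close> (embedded into \<open>L\<close> by \<open>e\<close>).\<close>
definition function_field ::
  "('n \<Rightarrow> complex) set \<Rightarrow> ('l, 'm) ring_scheme \<Rightarrow> ((('n \<Rightarrow> complex) \<Rightarrow> complex) \<Rightarrow> 'l) \<Rightarrow> 'l set" where
  "function_field X L e =
    {e f \<otimes>\<^bsub>L\<^esub> inv\<^bsub>L\<^esub> (e g) | f g.
      f \<in> carrier (coord_ring X) \<and> g \<in> carrier (coord_ring X) \<and> g \<noteq> \<zero>\<^bsub>coord_ring X\<^esub>}"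

text \<open>
  \<open>L\<close> is an algebraic closure of the field of rational functions on \<open>X\<close>, and \<open>\<delta>\<close> is the
  (unique) derivation of \<open>L\<close> that extends \<open>d/d\<lambda>\<close>. Thus the elements of \<open>L\<close> are exactly the
  elements algebraic over the function field.
\<close>
definition function_field_closure ::
  "('n \<Rightarrow> complex) set \<Rightarrow> (('n \<Rightarrow> complex) \<Rightarrow> complex)
    \<Rightarrow> ('l, 'm) ring_scheme \<Rightarrow> ((('n \<Rightarrow> complex) \<Rightarrow> complex) \<Rightarrow> 'l) \<Rightarrow> ('l \<Rightarrow> 'l) \<Rightarrow> bool" where
  "function_field_closure X lam L e \<delta> \<longleftrightarrow>
    e \<in> ring_hom (coord_ring X) L \<and> inj_on e (carrier (coord_ring X)) \<and>
    algebraic_closure L (function_field X L e) \<and>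
    derivation L \<delta> \<and>
    (\<forall>f\<in>polys. \<delta> (e (restrict f X)) = e (restrict (lam_deriv X lam f) X))"


section \<open>Jets\<close>

text \<open>
  Coordinates of a jet: those of the source and of the target, and \<open>Der i\<close> for the \<open>i\<close>-th
  derivative of the map read in the local coordinate \<open>\<lambda>\<close> on source and target, \<open>i \<ge> 1\<close>.
  The unused \<open>Der 0\<close> is fixed to be 0, as are the \<open>Der i\<close> with \<open>i > k\<close> in a \<open>k\<close>-jet.
\<close>
datatype 'n jvar = Src 'n | Tgt 'n | Der nat

type_synonym 'n jet = "'n jvar \<Rightarrow> complex"

definition src :: "'n jet \<Rightarrow> 'n \<Rightarrow> complex" where "src p = (\<lambda>i. p (Src i))"
definition tgt :: "'n jet \<Rightarrow> 'n \<Rightarrow> complex" where "tgt p = (\<lambda>i. p (Tgt i))"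

definition Aut_jets :: "nat \<Rightarrow> ('n \<Rightarrow> complex) set \<Rightarrow> 'n jet set" where
  "Aut_jets k X = {p. src p \<in> X \<and> tgt p \<in> X \<and> (k \<ge> 1 \<longrightarrow> p (Der 1) \<noteq> 0) \<and>
     (\<forall>i. i = 0 \<or> i > k \<longrightarrow> p (Der i) = 0)}"

definition Aut_inf :: "('n \<Rightarrow> complex) set \<Rightarrow> 'n jet set" where
  "Aut_inf X = {p. src p \<in> X \<and> tgt p \<in> X \<and> p (Der 1) \<noteq> 0 \<and> p (Der 0) = 0}"

text \<open>
  Composition, inverses and identities. The Taylor expansion of the map, read in \<open>\<lambda>\<close> and centred
  at source and target, is the sum of \<open>p (Der i) / i! T^i\<close>; jets are composed and inverted
  through these series, truncated at order \<open>k\<close>.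
\<close>
definition jet_fps :: "'n jet \<Rightarrow> complex fps" where
  "jet_fps p = Abs_fps (\<lambda>i. p (Der i) / fact i)"

definition mk_jet :: "nat \<Rightarrow> ('n \<Rightarrow> complex) \<Rightarrow> ('n \<Rightarrow> complex) \<Rightarrow> complex fps \<Rightarrow> 'n jet" where
  "mk_jet k x y a = (\<lambda>j. case j of Src i \<Rightarrow> x i | Tgt i \<Rightarrow> y i
     | Der i \<Rightarrow> if 1 \<le> i \<and> i \<le> k then fact i * fps_nth a i else 0)"

definition jet_comp :: "nat \<Rightarrow> 'n jet \<Rightarrow> 'n jet \<Rightarrow> 'n jet" where
  "jet_comp k q p = mk_jet k (src p) (tgt q) (fps_compose (jet_fps q) (jet_fps p))"

definition jet_inv :: "nat \<Rightarrow> 'n jet \<Rightarrow> 'n jet" where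
  "jet_inv k p = mk_jet k (tgt p) (src p) (fps_inv (jet_fps p))"

definition jet_id :: "nat \<Rightarrow> ('n \<Rightarrow> complex) \<Rightarrow> 'n jet" where
  "jet_id k x = mk_jet k x x fps_X"

text \<open>
  Functions of a jet that are polynomial in the source, the target, the derivatives of order
  at most \<open>k\<close>, and the inverse of the first derivative.
\<close>
definition jet_funs :: "nat \<Rightarrow> ('n jet \<Rightarrow> complex) set" where
  "jet_funs k = alg (range (\<lambda>i p. p (Src i)) \<union> range (\<lambda>i p. p (Tgt i))
     \<union> {(\<lambda>p. p (Der i)) | i. 1 \<le> i \<and> i \<le> k}
     \<union> (if k \<ge> 1 then {\<lambda>p. inverse (p (Der 1))} else {}))"

text \<open>
  The ring of regular functions on the infinite jets. The regular functions on the \<open>k\<close>-jets are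
  the subring of restrictions of functions in \<open>jet_funs k\<close>.
\<close>
definition Aut_ring :: "('n \<Rightarrow> complex) set \<Rightarrow> ('n jet \<Rightarrow> complex) ring" where
  "Aut_ring X = fun_ring (\<Union>k. jet_funs k) (Aut_inf X)"

text \<open>
  The total derivative \<open>\<partial>/\<partial>\<lambda> + \<phi>' \<partial>/\<partial>\<phi> + \<phi>'' \<partial>/\<partial>\<phi>' + \<dots>\<close>, as the derivative along a vector field.
\<close>
definition total_deriv ::
  "('n \<Rightarrow> complex) set \<Rightarrow> (('n \<Rightarrow> complex) \<Rightarrow> complex) \<Rightarrow> ('n jet \<Rightarrow> complex) \<Rightarrow> 'n jet \<Rightarrow> complex" where
  "total_deriv X lam f p = dir_deriv f p
     (\<lambda>j. case j of Src i \<Rightarrow> lam_field X lam (src p) i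
        | Tgt i \<Rightarrow> p (Der 1) * lam_field X lam (tgt p) i
        | Der i \<Rightarrow> if i = 0 then 0 else p (Der (Suc i)))"


section \<open>Closed sets\<close>

text \<open>A Zariski closed subset of the space of infinite jets is represented by its radical ideal.\<close>

definition radical_ideal :: "'a set \<Rightarrow> ('a, 'm) ring_scheme \<Rightarrow> bool" where
  "radical_ideal E A \<longleftrightarrow> ideal E A \<and>
    (\<forall>f\<in>carrier A. \<forall>n::nat. f [^]\<^bsub>A\<^esub> n \<in> E \<longrightarrow> f \<in> E)"

text \<open>
  The total derivative of a regular function on the infinite jets is computed on a
  representative \<open>f\<close> on the ambient space; its restriction does not depend on the choice.
\<close>
definition radical_D_ideal ::
  "('n \<Rightarrow> complex) set \<Rightarrow> (('n \<Rightarrow> complex) \<Rightarrow> complex) \<Rightarrow> ('n jet \<Rightarrow> complex) set \<Rightarrow> bool" where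
  "radical_D_ideal X lam E \<longleftrightarrow> radical_ideal E (Aut_ring X) \<and>
    (\<forall>f\<in>(\<Union>k. jet_funs k).
      restrict f (Aut_inf X) \<in> E \<longrightarrow> restrict (total_deriv X lam f) (Aut_inf X) \<in> E)"

definition radical_D_ideal_gen ::
  "('n \<Rightarrow> complex) set \<Rightarrow> (('n \<Rightarrow> complex) \<Rightarrow> complex) \<Rightarrow> ('n jet \<Rightarrow> complex) set
    \<Rightarrow> ('n jet \<Rightarrow> complex) set" where
  "radical_D_ideal_gen X lam S = \<Inter>{E. radical_D_ideal X lam E \<and> S \<subseteq> E}"

text \<open>The zero set, in the \<open>k\<close>-jets, of the functions of order at most \<open>k\<close> in the ideal \<open>E\<close>.\<close>
definition truncation ::
  "('n \<Rightarrow> complex) set \<Rightarrow> ('n jet \<Rightarrow> complex) set \<Rightarrow> nat \<Rightarrow> 'n jet set" where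
  "truncation X E k =
    {p \<in> Aut_jets k X. \<forall>f\<in>jet_funs k. restrict f (Aut_inf X) \<in> E \<longrightarrow> f p = 0}"

definition jet_closed :: "nat \<Rightarrow> ('n \<Rightarrow> complex) set \<Rightarrow> 'n jet set \<Rightarrow> bool" where
  "jet_closed k X Z \<longleftrightarrow> (\<exists>S\<subseteq>jet_funs k. Z = {p \<in> Aut_jets k X. \<forall>f\<in>S. f p = 0})"


section \<open>Groupoids\<close>

definition subgroupoid :: "nat \<Rightarrow> ('n \<Rightarrow> complex) set \<Rightarrow> 'n jet set \<Rightarrow> bool" where
  "subgroupoid k U Z \<longleftrightarrow> Z \<subseteq> Aut_jets k U \<and>
    (\<forall>x\<in>U. jet_id k x \<in> Z) \<and>
    (\<forall>p\<in>Z. jet_inv k p \<in> Z) \<and>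
    (\<forall>p\<in>Z. \<forall>q\<in>Z. tgt p = src q \<longrightarrow> jet_comp k q p \<in> Z)"

text \<open>
  \<open>U\<close> may be any open subset of the curve; its Zariski topology, and that of the jets over it,
  is induced by the ambient one. The \<open>k\<close>-jets over \<open>UNIV\<close> form an open subset of an affine space;
  smoothness refers to it, without restriction on the dimension of the components.
\<close>
definition strict_algebraic_subgroupoid :: "nat \<Rightarrow> ('n \<Rightarrow> complex) set \<Rightarrow> 'n jet set \<Rightarrow> bool" where
  "strict_algebraic_subgroupoid k U Z \<longleftrightarrow>
    jet_closed k U Z \<and> (\<forall>p\<in>Z. \<exists>r. smooth_at (jet_funs k) (Aut_jets k UNIV) Z r p) \<and>
    subgroupoid k U Z"

definition rational_subgroupoid :: "nat \<Rightarrow> ('n \<Rightarrow> complex) set \<Rightarrow> 'n jet set \<Rightarrow> bool" where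
  "rational_subgroupoid k X Z \<longleftrightarrow> jet_closed k X Z \<and>
    (\<exists>U. zariski_open_in X U \<and> U \<noteq> {} \<and>
      (\<forall>W. jet_closed k X W \<longrightarrow> Z \<inter> Aut_jets k U \<subseteq> W \<longrightarrow> Z \<subseteq> W) \<and>
      strict_algebraic_subgroupoid k U (Z \<inter> Aut_jets k U))"

definition D_groupoid ::
  "('n \<Rightarrow> complex) set \<Rightarrow> (('n \<Rightarrow> complex) \<Rightarrow> complex) \<Rightarrow> ('n jet \<Rightarrow> complex) set \<Rightarrow> bool" where
  "D_groupoid X lam E \<longleftrightarrow>
    radical_D_ideal X lam E \<and> (\<forall>k. rational_subgroupoid k X (truncation X E k))"

text \<open>The order is infinite for the ideal of the full groupoid.\<close>
definition groupoid_order :: "('n \<Rightarrow> complex) set \<Rightarrow> ('n jet \<Rightarrow> complex) set \<Rightarrow> enat" where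
  "groupoid_order X E = (INF k\<in>{k. truncation X E k \<subset> Aut_jets k X}. enat k)"

text \<open>Closed sets are given by their ideals, so inclusion of closed sets reverses that of ideals.\<close>
definition sub_D_groupoid ::
  "('n \<Rightarrow> complex) set \<Rightarrow> (('n \<Rightarrow> complex) \<Rightarrow> complex) \<Rightarrow> ('n jet \<Rightarrow> complex) set
    \<Rightarrow> ('n jet \<Rightarrow> complex) set \<Rightarrow> bool" where
  "sub_D_groupoid X lam H G \<longleftrightarrow> D_groupoid X lam H \<and> G \<subseteq> H"


section \<open>The Kummer groupoid\<close>

definition schwarzian :: "'n jet \<Rightarrow> complex" where
  "schwarzian p = p (Der 3) / p (Der 1) - 3 / 2 * (p (Der 2) / p (Der 1)) ^ 2"

definition kummer ::
  "('n \<Rightarrow> complex) set \<Rightarrow> (('n \<Rightarrow> complex) \<Rightarrow> complex) \<Rightarrow> (('n \<Rightarrow> complex) \<Rightarrow> complex)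
    \<Rightarrow> ('n jet \<Rightarrow> complex) set" where
  "kummer X lam R = radical_D_ideal_gen X lam
     {restrict (\<lambda>p. schwarzian p - R (src p) + R (tgt p) * p (Der 1) ^ 2) (Aut_inf X)}"

end

theory Submission
  imports Defs "HOL-Computational_Algebra.Fundamental_Theorem_Algebra"
begin

text \<open>
  Let \<open>H\<close> be the ideal of a subgroupoid of positive order that is strictly smaller than the Kummer
  groupoid, and write \<open>a = \<phi>'\<close>, \<open>b = \<phi>''\<close>, \<open>x\<close> for the source and \<open>y\<close> for the target. Modulo the
  Kummer equation every derivative of order at least 3 is a function of order 2, so that \<open>H\<close> contains
  a function of order at most 2 that is not identically zero (\<open>ex_order2_element\<close>), while positive
  order says that \<open>H\<close> contains no nonzero function of \<open>x\<close> and \<open>y\<close> alone. Both cases below end in the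
  same way: with a polynomial \<open>g(u)\<close> over the regular functions on \<open>X\<close>, of positive degree, that
  divides its own derivative under the vector field \<open>d/d\<lambda> - (u\<^sup>2 + R/2) \<partial>/\<partial>u\<close>. A root of such a
  Darboux polynomial in the algebraic closure solves the Riccati equation (\<open>darboux_imp_riccati\<close>).

  Suppose first that \<open>H\<close> contains no nonzero function of order 1. In the coordinates \<open>a\<close> and
  \<open>u = b / (2 a\<^sup>2)\<close> the derivation on the Kummer groupoid is \<open>a\<close> times
  \<open>\<partial>/\<partial>y + 2 a u \<partial>/\<partial>a - (u\<^sup>2 + R(y)/2) \<partial>/\<partial>u\<close>, up to terms that are of lower degree in \<open>a\<close>. An element
  of \<open>H\<close> of least degree in \<open>u\<close> divides its derivative by pseudo-division, and comparing the terms of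
  highest degree in \<open>a\<close> shows that its leading coefficient with respect to \<open>a\<close>, a polynomial in \<open>u\<close>,
  is a Darboux polynomial once \<open>x\<close> is given a constant value; the leading terms in \<open>u\<close> prevent it from
  being constant (\<open>generic_case\<close>).

  Suppose now that \<open>H\<close> contains a nonzero function of order 1, and let \<open>f(x, y, a)\<close> be such a function
  of least degree in \<open>a\<close>. Over a general pair \<open>(x, y)\<close> the 1-jets of the groupoid are exactly the roots
  of \<open>f\<close>. Quotients of two roots lie in a finite isotropy group and hence are roots of unity; therefore
  a power of \<open>a\<close> is a rational function \<open>m(x, y)\<close>, composition of jets says that it is a cocycle, and a
  cocycle splits: \<open>a^M = \<mu>(x) \<nu>(y)\<close> (\<open>power_relation\<close>). Differentiating gives
  \<open>b/a = \<sigma>(x) + \<rho>(y) a\<close> with \<open>\<sigma> = \<mu>' / (M \<mu>)\<close>, and differentiating again with the help of the Kummer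
  equation gives \<open>\<tau>(x) = - a\<^sup>2 n(y)\<close> with \<open>\<tau> = \<sigma>' - \<sigma>\<^sup>2/2 - R\<close>. Taking the \<open>M\<close>-th power and eliminating
  \<open>a\<close> separates the variables: \<open>\<tau>^M / \<mu>\<^sup>2\<close> is constant, that is, \<open>\<tau>' = 2 \<sigma> \<tau>\<close>. Consequently
  \<open>u = - \<sigma>/2 + sqrt (\<tau>/2)\<close> solves the Riccati equation, which is expressed by the Darboux polynomial
  \<open>(2 u + \<sigma>)\<^sup>2 - 2 \<tau>\<close> (\<open>discrete_case\<close>).
\<close>

section \<open>Darboux polynomials of the Riccati equation\<close>

definition shift :: "(nat \<Rightarrow> 'p \<Rightarrow> complex) \<Rightarrow> nat \<Rightarrow> 'p \<Rightarrow> complex" where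
  "shift h j = (case j of 0 \<Rightarrow> (\<lambda>x. 0) | Suc i \<Rightarrow> h i)"

definition formal_deriv :: "(nat \<Rightarrow> 'p \<Rightarrow> complex) \<Rightarrow> nat \<Rightarrow> 'p \<Rightarrow> complex" where
  "formal_deriv h j = (\<lambda>x. of_nat (Suc j) * h (Suc j) x)"

text \<open>
  Regular functions on the curve are represented by functions on the ambient space, so that all
  identities, including the rules for the derivation, are required at the points of \<open>X\<close> only.
\<close>
locale function_ring =
  fixes X :: "'p set" and P :: "('p \<Rightarrow> complex) set"
    and D :: "('p \<Rightarrow> complex) \<Rightarrow> 'p \<Rightarrow> complex"
  assumes const_in: "(\<lambda>x. c) \<in> P"
    and add_in: "f \<in> P \<Longrightarrow> g \<in> P \<Longrightarrow> (\<lambda>x. f x + g x) \<in> P"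
    and mult_in: "f \<in> P \<Longrightarrow> g \<in> P \<Longrightarrow> (\<lambda>x. f x * g x) \<in> P"
    and D_in: "f \<in> P \<Longrightarrow> D f \<in> P"
    and D_cong: "f \<in> P \<Longrightarrow> g \<in> P \<Longrightarrow> (\<And>x. x \<in> X \<Longrightarrow> f x = g x) \<Longrightarrow> x \<in> X \<Longrightarrow> D f x = D g x"
    and D_const: "x \<in> X \<Longrightarrow> D (\<lambda>x. c) x = 0"
    and D_add: "f \<in> P \<Longrightarrow> g \<in> P \<Longrightarrow> x \<in> X \<Longrightarrow> D (\<lambda>x. f x + g x) x = D f x + D g x"
    and D_mult: "f \<in> P \<Longrightarrow> g \<in> P \<Longrightarrow> x \<in> X \<Longrightarrow> D (\<lambda>x. f x * g x) x = D f x * g x + f x * D g x"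
    and no_zero_divisors: "f \<in> P \<Longrightarrow> g \<in> P \<Longrightarrow> (\<And>x. x \<in> X \<Longrightarrow> f x * g x = 0)
      \<Longrightarrow> (\<forall>x\<in>X. f x = 0) \<or> (\<forall>x\<in>X. g x = 0)"
begin

lemma diff_in: "f \<in> P \<Longrightarrow> g \<in> P \<Longrightarrow> (\<lambda>x. f x - g x) \<in> P"
  using add_in[OF _ mult_in[OF const_in[of "-1"]], of f g] by simp

lemma cmult_in: "f \<in> P \<Longrightarrow> (\<lambda>x. c * f x) \<in> P"
  by (rule mult_in[OF const_in])

lemma power_in: "f \<in> P \<Longrightarrow> (\<lambda>x. f x ^ n) \<in> P"
  by (induction n) (auto intro: const_in mult_in)

lemma D_cmult: "f \<in> P \<Longrightarrow> x \<in> X \<Longrightarrow> D (\<lambda>x. c * f x) x = c * D f x"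
  using D_mult[OF const_in, of f x c] D_const[of x c] by simp

lemma D_diff: "f \<in> P \<Longrightarrow> g \<in> P \<Longrightarrow> x \<in> X \<Longrightarrow> D (\<lambda>x. f x - g x) x = D f x - D g x"
  using D_add[OF _ cmult_in[of g "-1"], of f x] D_cmult[of g x "-1"] by simp

lemma D_power: "f \<in> P \<Longrightarrow> x \<in> X \<Longrightarrow> D (\<lambda>x. f x ^ n) x = of_nat n * f x ^ (n - 1) * D f x"
proof (induction n)
  case 0
  then show ?case by (simp add: D_const)
next
  case (Suc n)
  have "D (\<lambda>x. f x * f x ^ n) x = D f x * f x ^ n + f x * (of_nat n * f x ^ (n - 1) * D f x)"
    using Suc D_mult[OF _ power_in, of f f x n] by simp
  then show ?case
    by (cases n) (simp_all add: algebra_simps)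
qed

lemma shift_in: "(\<And>j. h j \<in> P) \<Longrightarrow> shift h j \<in> P"
  by (auto simp: shift_def const_in split: nat.split)

lemma formal_deriv_in: "(\<And>j. h j \<in> P) \<Longrightarrow> formal_deriv h j \<in> P"
  unfolding formal_deriv_def by (rule cmult_in)

text \<open>
  The coefficients of the image of \<open>h\<close> under the vector field \<open>d/d\<lambda> - (u\<^sup>2 + H) \<partial>/\<partial>u\<close>, whose integral
  curves are the solutions of \<open>u' + u\<^sup>2 + H = 0\<close>.
\<close>
definition \<Delta> :: "('p \<Rightarrow> complex) \<Rightarrow> (nat \<Rightarrow> 'p \<Rightarrow> complex) \<Rightarrow> nat \<Rightarrow> 'p \<Rightarrow> complex" where
  "\<Delta> H h j x = D (h j) x - (of_nat j - 1) * shift h j x - H x * formal_deriv h j x"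

lemma \<Delta>_in:
  assumes "\<And>j. h j \<in> P" "H \<in> P"
  shows "\<Delta> H h j \<in> P"
proof -
  have "(\<lambda>x. D (h j) x - (of_nat j - 1) * shift h j x - H x * formal_deriv h j x) \<in> P"
    by (intro diff_in D_in mult_in const_in shift_in formal_deriv_in assms)
  then show ?thesis by (simp add: \<Delta>_def[abs_def])
qed

text \<open>
  Because \<open>\<Delta> \<partial>/\<partial>u = \<partial>/\<partial>u \<Delta> + 2 u \<partial>/\<partial>u\<close>, differentiating an identity of this shape gives one of the
  same shape, in which the previous polynomial \<open>hp\<close> (with \<open>hp' = h\<close> if \<open>b\<close> is nonzero) is replaced
  by \<open>h\<close>.
\<close>
lemma \<Delta>_formal_deriv:
  assumes h: "\<And>j. h j \<in> P" and x: "x \<in> X"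
    and hp: "\<And>j. b * (of_nat (Suc j) * hp (Suc j) x) = b * h j x"
    and eq: "\<And>j. c * \<Delta> H h j x = a * shift h j x + l * h j x + b * hp j x"
  shows "c * \<Delta> H (formal_deriv h) j x
    = (a + 2 * c) * shift (formal_deriv h) j x + l * formal_deriv h j x + (a + b) * h j x"
proof -
  have D: "D (formal_deriv h j) x = of_nat (Suc j) * D (h (Suc j)) x"
    unfolding formal_deriv_def by (rule D_cmult[OF h x])
  have s: "shift (formal_deriv h) j x = of_nat j * h j x"
    by (cases j) (simp_all add: shift_def formal_deriv_def)
  have s': "shift h (Suc j) x = h j x" by (simp add: shift_def)
  have "c * \<Delta> H (formal_deriv h) j x = of_nat (Suc j) * (c * \<Delta> H h (Suc j) x) + 2 * c * (of_nat j * h j x)"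
    unfolding \<Delta>_def D s s' by (simp add: formal_deriv_def algebra_simps)
  also have "of_nat (Suc j) * (c * \<Delta> H h (Suc j) x)
      = of_nat (Suc j) * a * h j x + l * formal_deriv h j x + b * (of_nat (Suc j) * hp (Suc j) x)"
    unfolding eq s' by (simp add: formal_deriv_def algebra_simps)
  also have "b * (of_nat (Suc j) * hp (Suc j) x) = b * h j x" by (rule hp)
  finally show ?thesis unfolding s by (simp add: algebra_simps)
qed

end

text \<open>
  The algebraically closed differential field is given by its carrier, and \<open>\<epsilon>\<close> sends a regular
  function to its image in it.
\<close>
locale closed_extension = function_ring X P D + algebraically_closed L
  for X :: "'p set" and P D and L :: "'l ring" (structure) +
  fixes \<epsilon> :: "('p \<Rightarrow> complex) \<Rightarrow> 'l" and \<delta> :: "'l \<Rightarrow> 'l"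
  assumes eps_closed: "f \<in> P \<Longrightarrow> \<epsilon> f \<in> carrier L"
    and eps_cong: "f \<in> P \<Longrightarrow> g \<in> P \<Longrightarrow> (\<And>x. x \<in> X \<Longrightarrow> f x = g x) \<Longrightarrow> \<epsilon> f = \<epsilon> g"
    and eps_add: "f \<in> P \<Longrightarrow> g \<in> P \<Longrightarrow> \<epsilon> (\<lambda>x. f x + g x) = \<epsilon> f \<oplus> \<epsilon> g"
    and eps_mult: "f \<in> P \<Longrightarrow> g \<in> P \<Longrightarrow> \<epsilon> (\<lambda>x. f x * g x) = \<epsilon> f \<otimes> \<epsilon> g"
    and eps_zero: "\<epsilon> (\<lambda>x. 0) = \<zero>"
    and eps_one: "\<epsilon> (\<lambda>x. 1) = \<one>"
    and eps_eq_zero: "f \<in> P \<Longrightarrow> \<epsilon> f = \<zero> \<Longrightarrow> x \<in> X \<Longrightarrow> f x = 0"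
    and delta_closed: "a \<in> carrier L \<Longrightarrow> \<delta> a \<in> carrier L"
    and delta_add: "a \<in> carrier L \<Longrightarrow> b \<in> carrier L \<Longrightarrow> \<delta> (a \<oplus> b) = \<delta> a \<oplus> \<delta> b"
    and delta_mult: "a \<in> carrier L \<Longrightarrow> b \<in> carrier L \<Longrightarrow> \<delta> (a \<otimes> b) = \<delta> a \<otimes> b \<oplus> a \<otimes> \<delta> b"
    and delta_eps: "f \<in> P \<Longrightarrow> \<delta> (\<epsilon> f) = \<epsilon> (D f)"
begin

text \<open>
  The value at \<open>r\<close> of the polynomial of degree at most \<open>n\<close> with coefficients \<open>h\<close>, in Horner form:
  the recursion removes the constant coefficient, which makes multiplication by the variable
  (\<open>shift\<close>) a rewrite rule.
\<close>
primrec ev :: "nat \<Rightarrow> (nat \<Rightarrow> 'p \<Rightarrow> complex) \<Rightarrow> 'l \<Rightarrow> 'l" where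
  "ev 0 h r = \<epsilon> (h 0)"
| "ev (Suc n) h r = \<epsilon> (h 0) \<oplus> r \<otimes> ev n (\<lambda>j. h (Suc j)) r"

lemma ev_closed [simp]: "(\<And>j. h j \<in> P) \<Longrightarrow> r \<in> carrier L \<Longrightarrow> ev n h r \<in> carrier L"
  by (induction n arbitrary: h) (auto simp: eps_closed)

lemma ev_cong:
  "(\<And>j. h j \<in> P) \<Longrightarrow> (\<And>j. g j \<in> P) \<Longrightarrow> (\<And>j x. x \<in> X \<Longrightarrow> h j x = g j x) \<Longrightarrow> ev n h r = ev n g r"
proof (induction n arbitrary: h g)
  case 0
  then show ?case by (simp add: eps_cong)
next
  case (Suc n)
  have "ev n (\<lambda>j. h (Suc j)) r = ev n (\<lambda>j. g (Suc j)) r"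
    by (rule Suc.IH) (use Suc.prems in auto)
  then show ?case using Suc.prems eps_cong[of "h 0" "g 0"] by simp
qed

lemma ev_add:
  assumes "\<And>j. h j \<in> P" "\<And>j. g j \<in> P" "r \<in> carrier L"
  shows "ev n (\<lambda>j x. h j x + g j x) r = ev n h r \<oplus> ev n g r"
  using assms
proof (induction n arbitrary: h g)
  case 0
  then show ?case by (simp add: eps_add)
next
  case (Suc n)
  have IH: "ev n (\<lambda>j x. h (Suc j) x + g (Suc j) x) r
      = ev n (\<lambda>j. h (Suc j)) r \<oplus> ev n (\<lambda>j. g (Suc j)) r"
    by (rule Suc.IH) (use Suc.prems in auto)
  define a b where "a = ev n (\<lambda>j. h (Suc j)) r" and "b = ev n (\<lambda>j. g (Suc j)) r"
  have ab: "a \<in> carrier L" "b \<in> carrier L" "\<epsilon> (h 0) \<in> carrier L" "\<epsilon> (g 0) \<in> carrier L"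
    using Suc.prems by (auto simp: a_def b_def eps_closed)
  have "(\<epsilon> (h 0) \<oplus> \<epsilon> (g 0)) \<oplus> r \<otimes> (a \<oplus> b) = (\<epsilon> (h 0) \<oplus> r \<otimes> a) \<oplus> (\<epsilon> (g 0) \<oplus> r \<otimes> b)"
    using ab Suc.prems(3) by algebra
  then show ?case using IH Suc.prems by (simp add: eps_add a_def b_def)
qed

lemma ev_mult:
  assumes "c \<in> P" "\<And>j. h j \<in> P" "r \<in> carrier L"
  shows "ev n (\<lambda>j x. c x * h j x) r = \<epsilon> c \<otimes> ev n h r"
  using assms
proof (induction n arbitrary: h)
  case 0
  then show ?case by (simp add: eps_mult)
next
  case (Suc n)
  have IH: "ev n (\<lambda>j x. c x * h (Suc j) x) r = \<epsilon> c \<otimes> ev n (\<lambda>j. h (Suc j)) r"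
    by (rule Suc.IH) (use Suc.prems in auto)
  define a where "a = ev n (\<lambda>j. h (Suc j)) r"
  have ab: "a \<in> carrier L" "\<epsilon> (h 0) \<in> carrier L" "\<epsilon> c \<in> carrier L"
    using Suc.prems by (auto simp: a_def eps_closed)
  have "\<epsilon> c \<otimes> \<epsilon> (h 0) \<oplus> r \<otimes> (\<epsilon> c \<otimes> a) = \<epsilon> c \<otimes> (\<epsilon> (h 0) \<oplus> r \<otimes> a)"
    using ab Suc.prems(3) by algebra
  then show ?case using IH Suc.prems by (simp add: eps_mult a_def)
qed

lemma ev_shift: "(\<And>j. h j \<in> P) \<Longrightarrow> r \<in> carrier L \<Longrightarrow> ev (Suc n) (shift h) r = r \<otimes> ev n h r"
  by (simp add: shift_def eps_zero)

lemma ev_Suc_vanish: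
  assumes "\<And>j. h j \<in> P" "r \<in> carrier L" "\<And>x. x \<in> X \<Longrightarrow> h (Suc n) x = 0"
  shows "ev (Suc n) h r = ev n h r"
  using assms
proof (induction n arbitrary: h)
  case 0
  have "\<epsilon> (h (Suc 0)) = \<zero>"
    using eps_cong[of "h (Suc 0)" "\<lambda>x. 0"] 0 eps_zero by (simp add: const_in)
  then show ?case using 0 eps_closed by simp
next
  case (Suc n)
  have "ev (Suc n) (\<lambda>j. h (Suc j)) r = ev n (\<lambda>j. h (Suc j)) r"
    by (rule Suc.IH) (use Suc.prems in auto)
  then show ?case by simp
qed

text \<open>
  The chain rule for \<open>h(r)\<close>. The step rests on \<open>h = h(0) + z k\<close> and hence \<open>h' = k + z k'\<close>; the top
  coefficient is required to vanish because \<open>formal_deriv\<close> moves the coefficient \<open>n + 1\<close> into range.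
\<close>
lemma ev_deriv:
  assumes "\<And>j. h j \<in> P" "r \<in> carrier L" "\<And>x. x \<in> X \<Longrightarrow> h (Suc n) x = 0"
  shows "\<delta> (ev n h r) = ev n (\<lambda>j. D (h j)) r \<oplus> ev n (formal_deriv h) r \<otimes> \<delta> r"
  using assms
proof (induction n arbitrary: h)
  case 0
  have "\<epsilon> (formal_deriv h 0) = \<zero>"
    using eps_cong[of "formal_deriv h 0" "\<lambda>x. 0"] 0 eps_zero formal_deriv_in[of h]
    by (simp add: const_in formal_deriv_def)
  then show ?case using 0 by (simp add: delta_eps D_in eps_closed delta_closed)
next
  case (Suc n)
  define h' where "h' j = h (Suc j)" for j
  define E where "E = ev n h' r"
  define A where "A = ev n (\<lambda>j. D (h' j)) r"
  define B where "B = ev n (formal_deriv h') r"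
  have h': "h' j \<in> P" for j using Suc.prems by (simp add: h'_def)
  have hh: "(\<lambda>j. h (Suc j)) = h'" by (simp add: h'_def fun_eq_iff)
  have cl: "E \<in> carrier L" "A \<in> carrier L" "B \<in> carrier L"
    using h' Suc.prems(2) by (simp_all add: E_def A_def B_def D_in formal_deriv_in)
  have cl0: "\<epsilon> (h 0) \<in> carrier L" "\<epsilon> (D (h 0)) \<in> carrier L" "\<delta> r \<in> carrier L"
    using Suc.prems by (auto simp: eps_closed D_in delta_closed)
  have IH: "\<delta> E = A \<oplus> B \<otimes> \<delta> r"
    unfolding E_def A_def B_def by (rule Suc.IH) (use Suc.prems h' in \<open>auto simp: h'_def\<close>)
  have "ev (Suc n) (formal_deriv h) r = ev (Suc n) (\<lambda>j x. h' j x + shift (formal_deriv h') j x) r"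
  proof (rule ev_cong)
    show "(\<lambda>x. h' j x + shift (formal_deriv h') j x) \<in> P" for j
      by (intro add_in h' shift_in formal_deriv_in)
    show "formal_deriv h j x = h' j x + shift (formal_deriv h') j x" for j x
      by (cases j) (simp_all add: formal_deriv_def shift_def h'_def algebra_simps)
  qed (rule formal_deriv_in, rule Suc.prems)
  also have "\<dots> = ev (Suc n) h' r \<oplus> r \<otimes> B"
    unfolding B_def using h' Suc.prems(2)
    by (simp only: ev_add shift_in formal_deriv_in ev_shift)
  also have "ev (Suc n) h' r = E"
    unfolding E_def by (rule ev_Suc_vanish) (use h' Suc.prems in \<open>auto simp: h'_def\<close>)
  finally have fd: "ev (Suc n) (formal_deriv h) r = E \<oplus> r \<otimes> B" .
  have "\<delta> (ev (Suc n) h r) = \<epsilon> (D (h 0)) \<oplus> (\<delta> r \<otimes> E \<oplus> r \<otimes> \<delta> E)"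
    using Suc.prems cl cl0
    by (simp add: delta_add delta_mult delta_eps E_def hh)
  also have "\<dots> = (\<epsilon> (D (h 0)) \<oplus> r \<otimes> A) \<oplus> (E \<oplus> r \<otimes> B) \<otimes> \<delta> r"
    unfolding IH using cl cl0 Suc.prems(2) by algebra
  finally show ?case
    unfolding fd by (simp add: A_def h'_def)
qed

primrec coeff_list :: "nat \<Rightarrow> (nat \<Rightarrow> 'p \<Rightarrow> complex) \<Rightarrow> 'l list" where
  "coeff_list 0 h = [\<epsilon> (h 0)]"
| "coeff_list (Suc n) h = coeff_list n (\<lambda>j. h (Suc j)) @ [\<epsilon> (h 0)]"

lemma length_coeff_list: "length (coeff_list n h) = Suc n"
  by (induction n arbitrary: h) auto

lemma coeff_list_neq_Nil: "coeff_list n h \<noteq> []"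
  by (cases n) auto

lemma hd_coeff_list: "hd (coeff_list n h) = \<epsilon> (h n)"
  by (induction n arbitrary: h) (auto simp: coeff_list_neq_Nil)

lemma set_coeff_list: "(\<And>j. h j \<in> P) \<Longrightarrow> set (coeff_list n h) \<subseteq> carrier L"
proof (induction n arbitrary: h)
  case (Suc n)
  have "set (coeff_list n (\<lambda>j. h (Suc j))) \<subseteq> carrier L"
    by (rule Suc.IH) (rule Suc.prems)
  then show ?case using Suc.prems by (simp add: eps_closed)
qed (simp add: eps_closed)

lemma eval_coeff_list:
  assumes "\<And>j. h j \<in> P" and r: "r \<in> carrier L"
  shows "eval (coeff_list n h) r = ev n h r"
  using assms(1)
proof (induction n arbitrary: h)
  case 0
  then show ?case using r by (simp add: eps_closed)
next
  case (Suc n)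
  have "eval (coeff_list n (\<lambda>j. h (Suc j))) r = ev n (\<lambda>j. h (Suc j)) r"
    by (rule Suc.IH) (rule Suc.prems)
  moreover have "eval (coeff_list (Suc n) h) r
      = eval (coeff_list n (\<lambda>j. h (Suc j))) r \<otimes> r \<oplus> \<epsilon> (h 0)"
    unfolding coeff_list.simps
    by (rule eval_append_aux[OF set_coeff_list]) (use Suc.prems r in \<open>auto simp: eps_closed\<close>)
  moreover have "ev n (\<lambda>j. h (Suc j)) r \<in> carrier L" "\<epsilon> (h 0) \<in> carrier L"
    using Suc.prems r by (simp_all add: eps_closed)
  ultimately show ?case using r by (simp add: m_comm a_comm)
qed

lemma ex_root:
  assumes h: "\<And>j. h j \<in> P" and n: "n > 0" and nz: "\<epsilon> (h n) \<noteq> \<zero>"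
  shows "\<exists>r\<in>carrier L. ev n h r = \<zero>"
proof -
  let ?p = "coeff_list n h"
  have p: "?p \<in> carrier (poly_ring L)"
    unfolding univ_poly_carrier[symmetric] polynomial_def
    using set_coeff_list[of h n, OF h] nz hd_coeff_list[of n h] by simp
  have "splitted ?p" by (rule roots_over_carrier[OF p])
  then have "size (roots ?p) = n"
    using length_coeff_list[of n h] by (simp add: splitted_def)
  then obtain r where "r \<in># roots ?p" using n by (cases "roots ?p") auto
  then have "is_root ?p r" using roots_mem_iff_is_root[OF p] by simp
  then show ?thesis using eval_coeff_list[of h _ n, OF h] by (auto simp: is_root_def)
qed

text \<open>
  At a root \<open>r\<close> of \<open>h\<close> the chain rule expresses the derivative of the coefficients through \<open>h'(r) \<delta> r\<close>;
  what remains of \<open>\<Delta> h\<close> is the Riccati expression of \<open>r\<close> times \<open>- h'(r)\<close>.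
\<close>
lemma ev_riccati_deriv:
  assumes h: "\<And>j. h j \<in> P" and H: "H \<in> P" and r: "r \<in> carrier L"
    and van: "\<And>j x. x \<in> X \<Longrightarrow> j > n \<Longrightarrow> h j x = 0"
    and root: "ev n h r = \<zero>"
  shows "ev (Suc n) (\<Delta> H h) r \<oplus> (\<delta> r \<oplus> r \<otimes> r \<oplus> \<epsilon> H) \<otimes> ev n (formal_deriv h) r = \<zero>"
proof -
  let ?d = "formal_deriv h"
  have d: "?d j \<in> P" for j by (rule formal_deriv_in[OF h])
  define M where "M = (\<lambda>x::'p. - 1 :: complex)"
  have M: "M \<in> P" unfolding M_def by (rule const_in)
  define A where "A = ev n (\<lambda>j. D (h j)) r"
  define B where "B = ev n ?d r"
  have cl: "A \<in> carrier L" "B \<in> carrier L" "\<epsilon> H \<in> carrier L" "\<epsilon> M \<in> carrier L" "\<delta> r \<in> carrier L"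
    using h d H M r by (simp_all add: A_def B_def D_in eps_closed delta_closed)
  have "\<epsilon> M \<oplus> \<one> = \<zero>"
    using eps_add[OF M const_in[of 1]] by (simp add: M_def eps_zero eps_one)
  then have eM: "\<epsilon> M = \<ominus> \<one>"
    using cl by (metis minus_equality one_closed)
  have vd: "?d j x = 0" if "x \<in> X" "j \<ge> n" for j x
    using van[of x "Suc j"] that by (simp add: formal_deriv_def)
  have eA: "ev (Suc n) (\<lambda>j. D (h j)) r = A"
    unfolding A_def
  proof (rule ev_Suc_vanish)
    show "D (h (Suc n)) x = 0" if "x \<in> X" for x
      using D_cong[OF h const_in[of 0] _ that, of "Suc n"] van D_const[OF that] by simp
  qed (use h r D_in in auto)
  have eB: "ev (Suc n) ?d r = B"
    unfolding B_def by (rule ev_Suc_vanish) (use d r vd in auto)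
  have eC: "ev (Suc n) (shift (shift ?d)) r = r \<otimes> (r \<otimes> B)"
  proof -
    have "ev (Suc n) (shift (shift ?d)) r = r \<otimes> ev n (shift ?d) r"
      by (rule ev_shift) (use d r shift_in in auto)
    also have "ev n (shift ?d) r = ev (Suc n) (shift ?d) r"
      by (rule ev_Suc_vanish[symmetric]) (use d r vd shift_in in \<open>auto simp: shift_def\<close>)
    also have "\<dots> = r \<otimes> B"
      unfolding B_def by (rule ev_shift) (use d r in auto)
    finally show ?thesis .
  qed
  have "ev (Suc n) (\<Delta> H h) r = ev (Suc n) (\<lambda>j x. D (h j) x
     + (M x * shift (shift ?d) j x + M x * (H x * ?d j x))) r"
  proof (rule ev_cong)
    show "(\<lambda>x. D (h j) x + (M x * shift (shift ?d) j x + M x * (H x * ?d j x))) \<in> P" for j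
      by (intro add_in mult_in D_in h M H d shift_in)
    have *: "(of_nat j - 1) * shift h j x = shift (shift ?d) j x" for j x
      by (auto simp: shift_def formal_deriv_def split: nat.split)
    show "\<Delta> H h j x = D (h j) x + (M x * shift (shift ?d) j x + M x * (H x * ?d j x))" for j x
      unfolding \<Delta>_def * by (simp add: M_def)
    then show "\<Delta> H h j \<in> P" for j
      using \<open>\<And>j. (\<lambda>x. D (h j) x + (M x * shift (shift ?d) j x + M x * (H x * ?d j x))) \<in> P\<close>
      by presburger
  qed
  also have "\<dots> = A \<oplus> (\<epsilon> M \<otimes> (r \<otimes> (r \<otimes> B)) \<oplus> \<epsilon> M \<otimes> (\<epsilon> H \<otimes> B))"
    by (simp only: ev_add ev_mult add_in mult_in D_in h M H d shift_in r eA eB eC)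
  finally have E: "ev (Suc n) (\<Delta> H h) r = A \<oplus> (\<epsilon> M \<otimes> (r \<otimes> (r \<otimes> B)) \<oplus> \<epsilon> M \<otimes> (\<epsilon> H \<otimes> B))" .
  have "\<delta> \<zero> = \<zero>"
    using delta_eps[OF const_in[of 0]] eps_zero eps_cong[OF D_in[OF const_in[of 0]] const_in[of 0]] D_const
    by simp
  then have "A \<oplus> B \<otimes> \<delta> r = \<zero>"
    using ev_deriv[of h r n, OF h r] van root by (simp add: A_def B_def)
  then have A: "A = \<ominus> (B \<otimes> \<delta> r)"
    using cl by (metis minus_equality m_closed)
  show ?thesis unfolding E eM B_def[symmetric] unfolding A using cl r by algebra
qed

lemma ev_vanish_beyond:
  assumes "\<And>j. h j \<in> P" "r \<in> carrier L" "\<And>x. x \<in> X \<Longrightarrow> h (Suc n) x = 0" "ev n h r = \<zero>"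
  shows "ev (Suc n) h r = \<zero>" "ev (Suc n) (shift h) r = \<zero>"
  using ev_Suc_vanish[of h r n] ev_shift[of h r n] assms by simp_all

text \<open>
  Let \<open>r\<close> be a root of the Darboux polynomial \<open>g\<close>, of multiplicity \<open>k\<close>. The identity for \<open>g\<close>,
  differentiated \<open>k - 1\<close> times, shows that \<open>\<Delta>\<close> maps the derivative of order \<open>k - 1\<close> of \<open>g\<close> to a
  polynomial vanishing at \<open>r\<close>, and \<open>r\<close> is a simple root of that derivative, so that the factor
  \<open>h'(r)\<close> in \<open>ev_riccati_deriv\<close> can be cancelled.
\<close>
theorem darboux_imp_riccati:
  assumes g: "\<And>j. g j \<in> P" and H: "H \<in> P" and c: "c \<in> P" and l0: "l0 \<in> P" and l1: "l1 \<in> P"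
    and n: "n > 0" and van: "\<And>j x. x \<in> X \<Longrightarrow> j > n \<Longrightarrow> g j x = 0"
    and lead: "x0 \<in> X" "g n x0 \<noteq> 0" and c_nz: "x1 \<in> X" "c x1 \<noteq> 0"
    and eq: "\<And>j x. x \<in> X \<Longrightarrow> c x * \<Delta> H g j x = l1 x * shift g j x + l0 x * g j x"
  shows "\<exists>r\<in>carrier L. \<delta> r \<oplus> r \<otimes> r \<oplus> \<epsilon> H = \<zero>"
proof -
  define h where "h i = (formal_deriv ^^ i) g" for i
  have h0: "h 0 = g" and hSuc: "h (Suc i) = formal_deriv (h i)" for i
    by (simp_all add: h_def)
  have h_in: "h i j \<in> P" for i j
    by (induction i arbitrary: j) (simp_all add: h0 hSuc g formal_deriv_in)
  have h_van: "h i j x = 0" if "x \<in> X" "j > n" for i j x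
    using that by (induction i arbitrary: j) (simp_all add: h0 hSuc van formal_deriv_def)
  have "\<epsilon> (g n) \<noteq> \<zero>" using eps_eq_zero[OF g[of n], of x0] lead by auto
  then obtain r where r: "r \<in> carrier L" "ev n g r = \<zero>" using ex_root[of g n, OF g n] by auto
  have ec: "\<epsilon> c \<noteq> \<zero>" "\<epsilon> c \<in> carrier L" using eps_eq_zero[OF c, of x1] c_nz c by (auto simp: eps_closed)
  \<comment> \<open>The derivative of order \<open>n\<close> is a nonzero constant, so that the multiplicity of \<open>r\<close> is at most \<open>n\<close>.\<close>
  have nth: "h i j x = pochhammer (of_nat (Suc j)) i * g (j + i) x" for i j x
    by (induction i arbitrary: j) (simp_all add: h0 hSuc formal_deriv_def pochhammer_rec algebra_simps)
  have "ev n (h n) r \<noteq> \<zero>"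
  proof -
    have "ev n (h n) r = ev 0 (h n) r"
    proof -
      have "ev m (h n) r = ev 0 (h n) r" for m
      proof (induction m)
        case (Suc m)
        have "ev (Suc m) (h n) r = ev m (h n) r"
          by (rule ev_Suc_vanish) (use r h_in van nth in auto)
        with Suc show ?case by simp
      qed simp
      then show ?thesis by blast
    qed
    moreover have "h n 0 x0 \<noteq> 0"
      using lead by (simp add: nth pochhammer_fact[symmetric])
    ultimately show ?thesis using eps_eq_zero[OF h_in[of n 0], of x0] lead(1) by auto
  qed
  define k where "k = (LEAST k. ev n (h k) r \<noteq> \<zero>)"
  have k: "ev n (h k) r \<noteq> \<zero>" and kmin: "\<And>i. i < k \<Longrightarrow> ev n (h i) r = \<zero>"
    unfolding k_def using \<open>ev n (h n) r \<noteq> \<zero>\<close> by (rule LeastI, blast dest: not_less_Least)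
  have "k \<noteq> 0" using k r(2) h0 by (cases k) auto
  then obtain i where i: "k = Suc i" by (cases k) auto
  have *: "\<exists>a\<in>P. \<exists>b\<in>P. \<forall>x\<in>X. \<forall>j. c x * \<Delta> H (h (Suc i)) j x
      = a x * shift (h (Suc i)) j x + l0 x * h (Suc i) j x + b x * h i j x" for i
  proof (induction i)
    case 0
    show ?case
    proof (intro bexI ballI allI)
      fix x j assume x: "x \<in> X"
      have "c x * \<Delta> H (formal_deriv g) j x
        = (l1 x + 2 * c x) * shift (formal_deriv g) j x + l0 x * formal_deriv g j x + (l1 x + 0) * g j x"
        by (rule \<Delta>_formal_deriv[where hp = g]) (use g x eq in auto)
      then show "c x * \<Delta> H (h (Suc 0)) j x = (\<lambda>x. l1 x + 2 * c x) x * shift (h (Suc 0)) j x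
          + l0 x * h (Suc 0) j x + l1 x * h 0 j x" by (simp add: h0 hSuc)
    qed (intro add_in l1 cmult_in c)+
  next
    case (Suc i)
    then obtain a b where ab: "a \<in> P" "b \<in> P" and e: "\<And>x j. x \<in> X \<Longrightarrow> c x * \<Delta> H (h (Suc i)) j x
      = a x * shift (h (Suc i)) j x + l0 x * h (Suc i) j x + b x * h i j x" by blast
    show ?case
    proof (intro bexI ballI allI)
      fix x j assume x: "x \<in> X"
      have "c x * \<Delta> H (formal_deriv (h (Suc i))) j x
        = (a x + 2 * c x) * shift (formal_deriv (h (Suc i))) j x + l0 x * formal_deriv (h (Suc i)) j x
          + (a x + b x) * h (Suc i) j x"
      proof (rule \<Delta>_formal_deriv[where hp = "h i"])
        show "b x * (of_nat (Suc j) * h i (Suc j) x) = b x * h (Suc i) j x" for j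
          by (simp only: hSuc formal_deriv_def)
      qed (use h_in x e in blast)+
      then show "c x * \<Delta> H (h (Suc (Suc i))) j x = (\<lambda>x. a x + 2 * c x) x * shift (h (Suc (Suc i))) j x
          + l0 x * h (Suc (Suc i)) j x + (\<lambda>x. a x + b x) x * h (Suc i) j x" by (simp add: hSuc)
    qed (intro add_in ab cmult_in c)+
  qed
  have "\<exists>a\<in>P. \<exists>b\<in>P. \<exists>p. (\<forall>j. p j \<in> P) \<and> (\<forall>x\<in>X. \<forall>j>n. p j x = 0) \<and> ev n p r = \<zero> \<and>
      (\<forall>x\<in>X. \<forall>j. c x * \<Delta> H (h i) j x = a x * shift (h i) j x + (l0 x * h i j x + b x * p j x))"
  proof (cases i)
    case 0
    show ?thesis
      by (intro bexI[of _ l1] bexI[of _ "\<lambda>x. 0"] exI[of _ g])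
        (use g van r eq l1 const_in in \<open>auto simp: 0 h0\<close>)
  next
    case (Suc i')
    with *[of i'] obtain a b where "a \<in> P" "b \<in> P" "\<And>x j. x \<in> X \<Longrightarrow> c x * \<Delta> H (h i) j x
      = a x * shift (h i) j x + l0 x * h i j x + b x * h i' j x" by blast
    then show ?thesis using h_in h_van kmin[of i'] i Suc
      by (intro bexI[of _ a] bexI[of _ b] exI[of _ "h i'"]) auto
  qed
  then obtain a b p where ab: "a \<in> P" "b \<in> P" and p: "\<And>j. p j \<in> P"
      "\<And>j x. x \<in> X \<Longrightarrow> j > n \<Longrightarrow> p j x = 0" "ev n p r = \<zero>"
    and e: "\<And>x j. x \<in> X \<Longrightarrow> c x * \<Delta> H (h i) j x = a x * shift (h i) j x + (l0 x * h i j x + b x * p j x)"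
    by blast
  have ri: "ev n (h i) r = \<zero>" using kmin[of i] i by simp
  have "\<epsilon> c \<otimes> ev (Suc n) (\<Delta> H (h i)) r = ev (Suc n) (\<lambda>j x. c x * \<Delta> H (h i) j x) r"
    by (rule ev_mult[symmetric]) (use c H h_in r \<Delta>_in in auto)
  also have "\<dots> = ev (Suc n) (\<lambda>j x. a x * shift (h i) j x + (l0 x * h i j x + b x * p j x)) r"
    by (rule ev_cong) (use e in \<open>auto intro!: add_in mult_in c H h_in \<Delta>_in p l0 ab shift_in\<close>)
  also have "\<dots> = \<epsilon> a \<otimes> ev (Suc n) (shift (h i)) r
      \<oplus> (\<epsilon> l0 \<otimes> ev (Suc n) (h i) r \<oplus> \<epsilon> b \<otimes> ev (Suc n) p r)"
    by (simp only: ev_add ev_mult add_in mult_in ab l0 h_in shift_in p r)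
  also have "\<dots> = \<zero>"
    using ev_vanish_beyond[of "h i" r n] ev_vanish_beyond[of p r n] h_in h_van p r ri ab l0
    by (simp del: ev.simps add: eps_closed)
  finally have "ev (Suc n) (\<Delta> H (h i)) r = \<zero>"
    using ec r H h_in by (metis \<Delta>_in ev_closed integral)
  then have "(\<delta> r \<oplus> r \<otimes> r \<oplus> \<epsilon> H) \<otimes> ev n (h k) r = \<zero>"
    using ev_riccati_deriv[of "h i" H r n, OF h_in H r(1)] h_van ri h_in r H
    by (simp del: ev.simps add: i hSuc formal_deriv_in eps_closed delta_closed)
  then show ?thesis
    using k r H h_in integral[of "\<delta> r \<oplus> r \<otimes> r \<oplus> \<epsilon> H" "ev n (h k) r"]
    by (auto simp: eps_closed delta_closed)
qed

end

section \<open>Polynomial functions and derivations along the flow\<close>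

lemma alg_mono: "G \<subseteq> G' \<Longrightarrow> alg G \<subseteq> alg G'"
proof
  fix f assume "G \<subseteq> G'" "f \<in> alg G"
  then show "f \<in> alg G'" by (induction rule: alg.induct[OF \<open>f \<in> alg G\<close>]) (auto intro: alg.intros)
qed

lemma polys_intros:
  "(\<lambda>x. x i) \<in> polys" "(\<lambda>x. c) \<in> polys"
  "f \<in> polys \<Longrightarrow> g \<in> polys \<Longrightarrow> (\<lambda>x. f x + g x) \<in> polys"
  "f \<in> polys \<Longrightarrow> g \<in> polys \<Longrightarrow> (\<lambda>x. f x * g x) \<in> polys"
  unfolding polys_def by (auto intro: alg.intros)

lemma dir_deriv_polys:
  assumes "f \<in> polys"
  shows "((\<lambda>t. f (\<lambda>i. p i + t * v i)) has_field_derivative dir_deriv f p v) (at 0)"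
proof -
  have "(\<lambda>t. f (\<lambda>i. p i + t * v i)) field_differentiable at 0"
    using assms unfolding polys_def
  proof (induction rule: alg.induct)
    case (gen f)
    then obtain i where "f = (\<lambda>p. p i)" by auto
    have "((\<lambda>t. p i + t * v i) has_field_derivative v i) (at 0)"
      by (auto intro!: derivative_eq_intros)
    then show ?case using \<open>f = (\<lambda>p. p i)\<close> by (auto simp: field_differentiable_def)
  qed (auto intro!: field_differentiable_add field_differentiable_mult)
  then show ?thesis unfolding dir_deriv_def by (rule field_differentiable_derivI)
qed

lemma dir_deriv_const: "dir_deriv (\<lambda>x. c) p v = 0"
  by (simp add: dir_deriv_def)

lemma dir_deriv_add:
  assumes "f \<in> polys" "g \<in> polys"
  shows "dir_deriv (\<lambda>x. f x + g x) p v = dir_deriv f p v + dir_deriv g p v"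
  unfolding dir_deriv_def[of "\<lambda>x. f x + g x"]
  by (rule DERIV_imp_deriv) (intro DERIV_add dir_deriv_polys assms)

lemma dir_deriv_mult:
  assumes "f \<in> polys" "g \<in> polys"
  shows "dir_deriv (\<lambda>x. f x * g x) p v = dir_deriv f p v * g p + f p * dir_deriv g p v"
  unfolding dir_deriv_def[of "\<lambda>x. f x * g x"]
  using DERIV_mult[OF dir_deriv_polys[OF assms(1), of p v] dir_deriv_polys[OF assms(2), of p v]]
  by (intro DERIV_imp_deriv) (simp add: algebra_simps)

lemma dir_deriv_scale:
  assumes "f \<in> polys"
  shows "((\<lambda>t. f (\<lambda>i. p i + t * (a * v i))) has_field_derivative a * dir_deriv f p v) (at 0)"
proof -
  have 1: "((\<lambda>t. f (\<lambda>i. p i + t * v i)) has_field_derivative dir_deriv f p v) (at (0 * a))"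
    using dir_deriv_polys[OF assms, of p v] by simp
  have 2: "((\<lambda>t. t * a) has_field_derivative a) (at 0)"
    by (auto intro!: derivative_eq_intros)
  have "((\<lambda>t. f (\<lambda>i. p i + t * a * v i)) has_field_derivative dir_deriv f p v * a) (at 0)"
    by (rule DERIV_chain2[OF 1 2])
  then show ?thesis by (simp add: ac_simps)
qed

text \<open>The vector field along which \<open>total_deriv\<close> differentiates.\<close>
definition flow_dir ::
  "('n \<Rightarrow> complex) set \<Rightarrow> (('n \<Rightarrow> complex) \<Rightarrow> complex) \<Rightarrow> 'n jet \<Rightarrow> 'n jvar \<Rightarrow> complex" where
  "flow_dir X lam p = (\<lambda>j. case j of Src i \<Rightarrow> lam_field X lam (src p) i
        | Tgt i \<Rightarrow> p (Der 1) * lam_field X lam (tgt p) i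
        | Der i \<Rightarrow> if i = 0 then 0 else p (Der (Suc i)))"

text \<open>
  Besides the value, this asserts differentiability along the flow. It holds for all functions in
  \<open>jet_funs\<close> at jets with invertible first derivative and makes the usual rules available.
\<close>
definition has_total_deriv ::
  "('n \<Rightarrow> complex) set \<Rightarrow> (('n \<Rightarrow> complex) \<Rightarrow> complex) \<Rightarrow> ('n jet \<Rightarrow> complex) \<Rightarrow> 'n jet \<Rightarrow> complex \<Rightarrow> bool" where
  "has_total_deriv X lam f p d \<longleftrightarrow>
    ((\<lambda>t. f (\<lambda>j. p j + t * flow_dir X lam p j)) has_field_derivative d) (at 0)"

lemma has_total_deriv_imp: "has_total_deriv X lam f p d \<Longrightarrow> total_deriv X lam f p = d"
  unfolding has_total_deriv_def total_deriv_def dir_deriv_def flow_dir_def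
  by (rule DERIV_imp_deriv)

lemma has_total_deriv_src: "f \<in> polys \<Longrightarrow> has_total_deriv X lam (\<lambda>p. f (src p)) p (lam_deriv X lam f (src p))"
  unfolding has_total_deriv_def flow_dir_def src_def lam_deriv_def using dir_deriv_polys by simp

lemma has_total_deriv_tgt:
  "f \<in> polys \<Longrightarrow> has_total_deriv X lam (\<lambda>p. f (tgt p)) p (p (Der 1) * lam_deriv X lam f (tgt p))"
  unfolding has_total_deriv_def flow_dir_def tgt_def lam_deriv_def using dir_deriv_scale by simp

lemma has_total_deriv_Der: "i > 0 \<Longrightarrow> has_total_deriv X lam (\<lambda>p. p (Der i)) p (p (Der (Suc i)))"
  unfolding has_total_deriv_def flow_dir_def by (auto intro!: derivative_eq_intros)

lemma has_total_deriv_const: "has_total_deriv X lam (\<lambda>p. c) p 0"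
  unfolding has_total_deriv_def by auto

lemma has_total_deriv_add:
  "has_total_deriv X lam f p d \<Longrightarrow> has_total_deriv X lam g p d' \<Longrightarrow>
    has_total_deriv X lam (\<lambda>p. f p + g p) p (d + d')"
  unfolding has_total_deriv_def by (rule DERIV_add)

lemma has_total_deriv_mult:
  "has_total_deriv X lam f p d \<Longrightarrow> has_total_deriv X lam g p d' \<Longrightarrow>
    has_total_deriv X lam (\<lambda>p. f p * g p) p (d * g p + f p * d')"
  unfolding has_total_deriv_def
  by (drule (1) DERIV_mult) (simp add: algebra_simps)

lemma has_total_deriv_inverse:
  "has_total_deriv X lam f p d \<Longrightarrow> f p \<noteq> 0 \<Longrightarrow>
    has_total_deriv X lam (\<lambda>p. inverse (f p)) p (- d * inverse (f p) ^ 2)"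
  unfolding has_total_deriv_def
  by (drule DERIV_inverse_fun) (simp_all add: power2_eq_square)

lemma has_total_deriv_eq: "has_total_deriv X lam f p d \<Longrightarrow> d = d' \<Longrightarrow> has_total_deriv X lam f p d'"
  by simp

lemma has_total_deriv_cmult:
  "has_total_deriv X lam f p d \<Longrightarrow> has_total_deriv X lam (\<lambda>p. c * f p) p (c * d)"
  by (rule has_total_deriv_eq, rule has_total_deriv_mult[OF has_total_deriv_const]) auto

lemma has_total_deriv_diff:
  "has_total_deriv X lam f p d \<Longrightarrow> has_total_deriv X lam g p d' \<Longrightarrow>
    has_total_deriv X lam (\<lambda>p. f p - g p) p (d - d')"
  unfolding has_total_deriv_def by (rule DERIV_diff)

lemma has_total_deriv_power:
  "has_total_deriv X lam f p d \<Longrightarrow> has_total_deriv X lam (\<lambda>p. f p ^ n) p (of_nat n * f p ^ (n - 1) * d)"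
  unfolding has_total_deriv_def by (drule DERIV_power[where n = n]) (simp add: algebra_simps)

lemma has_total_deriv_sum:
  "(\<And>i. i \<in> S \<Longrightarrow> has_total_deriv X lam (f i) p (d i)) \<Longrightarrow>
    has_total_deriv X lam (\<lambda>p. \<Sum>i\<in>S. f i p) p (\<Sum>i\<in>S. d i)"
  unfolding has_total_deriv_def by (rule DERIV_sum)

lemma jet_funs_mono: "k \<le> k' \<Longrightarrow> jet_funs k \<subseteq> jet_funs k'"
  unfolding jet_funs_def by (rule alg_mono) auto

lemma jet_funs_intros:
  "(\<lambda>p. c) \<in> jet_funs k"
  "f \<in> jet_funs k \<Longrightarrow> g \<in> jet_funs k \<Longrightarrow> (\<lambda>p. f p + g p) \<in> jet_funs k"
  "f \<in> jet_funs k \<Longrightarrow> g \<in> jet_funs k \<Longrightarrow> (\<lambda>p. f p * g p) \<in> jet_funs k"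
  "1 \<le> i \<Longrightarrow> i \<le> k \<Longrightarrow> (\<lambda>p. p (Der i)) \<in> jet_funs k"
  "1 \<le> k \<Longrightarrow> (\<lambda>p. inverse (p (Der 1))) \<in> jet_funs k"
  unfolding jet_funs_def by (auto intro: alg.intros)

lemma jet_funs_diff: "f \<in> jet_funs k \<Longrightarrow> g \<in> jet_funs k \<Longrightarrow> (\<lambda>p. f p - g p) \<in> jet_funs k"
  using jet_funs_intros(2)[OF _ jet_funs_intros(3)[OF jet_funs_intros(1)[of "-1"]], of f k g] by simp

lemma jet_funs_power: "f \<in> jet_funs k \<Longrightarrow> (\<lambda>p. f p ^ n) \<in> jet_funs k"
  by (induction n) (auto intro: jet_funs_intros)

lemma jet_funs_sum: "(\<And>i. i \<in> S \<Longrightarrow> f i \<in> jet_funs k) \<Longrightarrow> (\<lambda>p. \<Sum>i\<in>S. f i p) \<in> jet_funs k"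
  by (induction S rule: infinite_finite_induct) (auto intro: jet_funs_intros)

lemma jet_funs_src: "f \<in> polys \<Longrightarrow> (\<lambda>p. f (src p)) \<in> jet_funs k"
  unfolding polys_def
  by (induction rule: alg.induct) (auto intro: jet_funs_intros simp: src_def jet_funs_def intro: alg.intros)

lemma jet_funs_tgt: "f \<in> polys \<Longrightarrow> (\<lambda>p. f (tgt p)) \<in> jet_funs k"
  unfolding polys_def
  by (induction rule: alg.induct) (auto intro: jet_funs_intros simp: tgt_def jet_funs_def intro: alg.intros)

section \<open>Radical differential ideals containing the Kummer equation\<close>

definition kummer_fun :: "(('n \<Rightarrow> complex) \<Rightarrow> complex) \<Rightarrow> 'n jet \<Rightarrow> complex" where
  "kummer_fun R p = schwarzian p - R (src p) + R (tgt p) * p (Der 1) ^ 2"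

lemma kummer_fun_alt:
  "kummer_fun R = (\<lambda>p. p (Der 3) * inverse (p (Der 1)) - 3 / 2 * (p (Der 2) * inverse (p (Der 1))) ^ 2
      - R (src p) + R (tgt p) * p (Der 1) ^ 2)"
  unfolding kummer_fun_def[abs_def] schwarzian_def divide_inverse ..

lemma kummer_fun_in: "R \<in> polys \<Longrightarrow> kummer_fun R \<in> jet_funs 3"
proof -
  assume R: "R \<in> polys"
  show ?thesis unfolding kummer_fun_alt
    by (intro jet_funs_diff jet_funs_intros jet_funs_power jet_funs_src[OF R] jet_funs_tgt[OF R]) auto
qed

text \<open>
  The locale is interpreted for the ideal of the subgroupoid, for another radical differential ideal
  that contains the Kummer equation, and for the intersection of the two.
\<close>
locale kummer_ideal =
  fixes X :: "('n::finite \<Rightarrow> complex) set" and lam R H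
  assumes irred: "zariski_irreducible X" and R: "R \<in> polys"
    and H: "radical_D_ideal X lam H"
    and kummer_in: "restrict (kummer_fun R) (Aut_inf X) \<in> H"
begin

text \<open>Equality with a regular function is demanded on the infinite jets over \<open>X\<close> only.\<close>
definition Reg :: "('n jet \<Rightarrow> complex) \<Rightarrow> bool" where
  "Reg f \<longleftrightarrow> (\<exists>k. \<exists>g\<in>jet_funs k. \<forall>p\<in>Aut_inf X. f p = g p)"

definition Van :: "('n jet \<Rightarrow> complex) \<Rightarrow> bool" where
  "Van f \<longleftrightarrow> restrict f (Aut_inf X) \<in> H"

lemma Reg_jet_funs: "f \<in> jet_funs k \<Longrightarrow> Reg f"
  unfolding Reg_def by blast

lemma Reg_iff: "Reg f \<longleftrightarrow> restrict f (Aut_inf X) \<in> carrier (Aut_ring X)"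
proof
  assume "Reg f"
  then obtain k g where g: "g \<in> jet_funs k" "\<And>p. p \<in> Aut_inf X \<Longrightarrow> f p = g p"
    unfolding Reg_def by blast
  then have "restrict f (Aut_inf X) = restrict g (Aut_inf X)" by (auto simp: restrict_def)
  then show "restrict f (Aut_inf X) \<in> carrier (Aut_ring X)"
    using g by (auto simp: Aut_ring_def fun_ring_def)
next
  assume "restrict f (Aut_inf X) \<in> carrier (Aut_ring X)"
  then obtain k g where g: "g \<in> jet_funs k" "restrict f (Aut_inf X) = restrict g (Aut_inf X)"
    by (auto simp: Aut_ring_def fun_ring_def)
  then have "f p = g p" if "p \<in> Aut_inf X" for p
    using that by (metis restrict_apply')
  then show "Reg f" unfolding Reg_def using g by blast
qed

lemma Reg_cong: "Reg f \<Longrightarrow> (\<And>p. p \<in> Aut_inf X \<Longrightarrow> f p = g p) \<Longrightarrow> Reg g"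
  unfolding Reg_def by (metis (no_types, lifting))

lemma Reg_obtain2:
  assumes "Reg f" "Reg g"
  obtains k f' g' where "f' \<in> jet_funs k" "g' \<in> jet_funs k"
    "\<And>p. p \<in> Aut_inf X \<Longrightarrow> f p = f' p" "\<And>p. p \<in> Aut_inf X \<Longrightarrow> g p = g' p"
proof -
  obtain k f' l g' where "f' \<in> jet_funs k" "g' \<in> jet_funs l"
    "\<And>p. p \<in> Aut_inf X \<Longrightarrow> f p = f' p" "\<And>p. p \<in> Aut_inf X \<Longrightarrow> g p = g' p"
    using assms unfolding Reg_def by blast
  moreover from this have "f' \<in> jet_funs (max k l)" "g' \<in> jet_funs (max k l)"
    using jet_funs_mono[of k "max k l"] jet_funs_mono[of l "max k l"] by auto
  ultimately show ?thesis using that by blast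
qed

lemma Reg_add: "Reg f \<Longrightarrow> Reg g \<Longrightarrow> Reg (\<lambda>p. f p + g p)"
  by (erule (1) Reg_obtain2) (rule Reg_cong[OF Reg_jet_funs[OF jet_funs_intros(2)]], auto)

lemma Reg_mult: "Reg f \<Longrightarrow> Reg g \<Longrightarrow> Reg (\<lambda>p. f p * g p)"
  by (erule (1) Reg_obtain2) (rule Reg_cong[OF Reg_jet_funs[OF jet_funs_intros(3)]], auto)

lemma Reg_const: "Reg (\<lambda>p. c)"
  using Reg_jet_funs[OF jet_funs_intros(1)] by blast

lemma Reg_diff: "Reg f \<Longrightarrow> Reg g \<Longrightarrow> Reg (\<lambda>p. f p - g p)"
  using Reg_add[OF _ Reg_mult[OF Reg_const[of "-1"]], of f g] by simp

lemma ideal_H: "ideal H (Aut_ring X)"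
  using H unfolding radical_D_ideal_def radical_ideal_def by blast

lemma Van_Reg: "Van f \<Longrightarrow> Reg f"
  unfolding Van_def Reg_iff using ideal.Icarr[OF ideal_H] .

lemma Van_cong: "Van f \<Longrightarrow> (\<And>p. p \<in> Aut_inf X \<Longrightarrow> f p = g p) \<Longrightarrow> Van g"
  unfolding Van_def by (metis restrict_ext)

lemma Van_add: assumes "Van f" "Van g" shows "Van (\<lambda>p. f p + g p)"
proof -
  have "restrict f (Aut_inf X) \<oplus>\<^bsub>Aut_ring X\<^esub> restrict g (Aut_inf X) \<in> H"
    using assms ideal_H unfolding Van_def
    by (simp add: additive_subgroup.a_closed ideal.axioms(1))
  then show ?thesis unfolding Van_def
    by (simp add: Aut_ring_def fun_ring_def restrict_def cong: if_cong)
qed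

lemma Van_mult: assumes "Reg f" "Van g" shows "Van (\<lambda>p. f p * g p)"
proof -
  have "restrict f (Aut_inf X) \<otimes>\<^bsub>Aut_ring X\<^esub> restrict g (Aut_inf X) \<in> H"
    using assms ideal_H unfolding Van_def Reg_iff
    by (simp add: ideal.I_l_closed)
  then show ?thesis unfolding Van_def
    by (simp add: Aut_ring_def fun_ring_def restrict_def cong: if_cong)
qed

lemma Van_zero: "(\<And>p. p \<in> Aut_inf X \<Longrightarrow> f p = 0) \<Longrightarrow> Van f"
  using additive_subgroup.zero_closed[OF ideal.axioms(1)[OF ideal_H]]
  unfolding Van_def by (simp add: Aut_ring_def fun_ring_def restrict_def cong: if_cong)

lemma Van_diff: assumes "Van f" "Van g" shows "Van (\<lambda>p. f p - g p)"
  using Van_add[OF assms(1) Van_mult[OF Reg_const[of "-1"] assms(2)]] by simp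

lemma Van_radical: assumes "Reg f" "Van (\<lambda>p. f p ^ n)" shows "Van f"
proof -
  interpret ideal H "Aut_ring X" by (rule ideal_H)
  have "restrict f (Aut_inf X) [^]\<^bsub>Aut_ring X\<^esub> n = restrict (\<lambda>p. f p ^ n) (Aut_inf X)"
  proof (induction n)
    case 0
    show ?case by (simp add: Aut_ring_def fun_ring_def)
  next
    case (Suc n)
    have "restrict f (Aut_inf X) [^]\<^bsub>Aut_ring X\<^esub> Suc n
      = restrict (\<lambda>p. f p ^ n) (Aut_inf X) \<otimes>\<^bsub>Aut_ring X\<^esub> restrict f (Aut_inf X)"
      by (simp only: nat_pow_Suc Suc)
    also have "\<dots> = restrict (\<lambda>p. f p ^ Suc n) (Aut_inf X)"
      by (simp add: Aut_ring_def fun_ring_def restrict_def mult.commute fun_eq_iff)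
    finally show ?case .
  qed
  then show ?thesis
    using H assms unfolding radical_D_ideal_def radical_ideal_def Van_def Reg_iff by metis
qed

lemma Van_total_deriv:
  assumes "f \<in> jet_funs k" "Van f" "\<And>p. p \<in> Aut_inf X \<Longrightarrow> has_total_deriv X lam f p (g p)"
  shows "Van g"
proof -
  have "restrict (total_deriv X lam f) (Aut_inf X) \<in> H"
    using H assms(1,2) unfolding radical_D_ideal_def Van_def by blast
  then have "Van (total_deriv X lam f)" by (simp add: Van_def)
  then show ?thesis by (rule Van_cong) (use has_total_deriv_imp assms(3) in blast)
qed

lemma X_nonempty: "X \<noteq> {}"
  using irred unfolding zariski_irreducible_def by blast

lemma polys_no_zero_divisors:
  assumes "f \<in> polys" "g \<in> polys" "\<And>x. x \<in> X \<Longrightarrow> f x * g x = 0"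
  shows "(\<forall>x\<in>X. f x = 0) \<or> (\<forall>x\<in>X. g x = 0)"
proof -
  have *: "zariski_closed {x. f x = 0}" if "f \<in> polys" for f :: "('n \<Rightarrow> complex) \<Rightarrow> complex"
    unfolding zariski_closed_def using that by (intro exI[of _ "{f}"]) auto
  have "X \<subseteq> {x. f x = 0} \<union> {x. g x = 0}" using assms(3) by auto
  then have "X \<subseteq> {x. f x = 0} \<or> X \<subseteq> {x. g x = 0}"
    using irred *[OF assms(1)] *[OF assms(2)] unfolding zariski_irreducible_def by blast
  then show ?thesis by auto
qed

text \<open>
  Along these jets every regular function is a polynomial function of the source, and the Kummer
  expression is \<open>c\<close> plus a function of the source.
\<close>
definition test_jet :: "('n \<Rightarrow> complex) \<Rightarrow> complex \<Rightarrow> ('n \<Rightarrow> complex) \<Rightarrow> 'n jet" where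
  "test_jet y c x = (\<lambda>j. case j of Src i \<Rightarrow> x i | Tgt i \<Rightarrow> y i
     | Der i \<Rightarrow> if i = 1 then 1 else if i = 3 then c else 0)"

lemma test_jet_polys: "f \<in> jet_funs k \<Longrightarrow> (\<lambda>x. f (test_jet y c x)) \<in> polys"
  unfolding jet_funs_def
proof (induction rule: alg.induct)
  case (gen f)
  then show ?case
    by (auto simp: test_jet_def intro: polys_intros split: if_splits)
qed (auto intro: polys_intros)

text \<open>
  The ideal is stable under the total derivative and is contained in the ring of regular functions.
  Applied to \<open>f\<close> times the Kummer expression \<open>\<kappa>\<close>, this shows that \<open>f' \<kappa>\<close> is regular, because \<open>f \<kappa>'\<close>
  is. As \<open>\<kappa>\<close> has coefficient 1 in the third derivative over jets with first derivative 1, evaluation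
  at two test jets isolates \<open>f'\<close>.
\<close>
lemma lam_deriv_regular:
  assumes f: "f \<in> polys"
  shows "\<exists>g\<in>polys. \<forall>x\<in>X. lam_deriv X lam f x = g x"
proof -
  let ?f = "\<lambda>p. f (src p) * kummer_fun R p"
  have kV: "Van (kummer_fun R)" using kummer_in by (simp add: Van_def)
  have k_in: "kummer_fun R \<in> jet_funs 3" by (rule kummer_fun_in[OF R])
  have f_in: "?f \<in> jet_funs 3" by (intro jet_funs_intros(3) jet_funs_src[OF f] k_in)
  have "Van ?f" by (rule Van_mult[OF Reg_jet_funs[OF jet_funs_src[OF f]] kV])
  have "\<exists>d. has_total_deriv X lam (kummer_fun R) p d" if "p \<in> Aut_inf X" for p
  proof -
    have nz: "p (Der 1) \<noteq> 0" using that by (simp add: Aut_inf_def)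
    show ?thesis
      unfolding kummer_fun_alt
      by (rule exI, (rule has_total_deriv_add has_total_deriv_diff has_total_deriv_mult
        has_total_deriv_power has_total_deriv_inverse has_total_deriv_Der has_total_deriv_src[OF R]
        has_total_deriv_tgt[OF R] has_total_deriv_const nz | (simp; fail))+)
  qed
  then have k_deriv: "has_total_deriv X lam (kummer_fun R) p (total_deriv X lam (kummer_fun R) p)"
    if "p \<in> Aut_inf X" for p
    using that has_total_deriv_imp by blast
  have "Van (total_deriv X lam (kummer_fun R))"
    by (rule Van_total_deriv[OF k_in kV k_deriv])
  moreover have "Van (\<lambda>p. lam_deriv X lam f (src p) * kummer_fun R p
      + f (src p) * total_deriv X lam (kummer_fun R) p)"
    by (rule Van_total_deriv[OF f_in \<open>Van ?f\<close>])
      (intro has_total_deriv_mult has_total_deriv_src[OF f] k_deriv)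
  ultimately have "Van (\<lambda>p. lam_deriv X lam f (src p) * kummer_fun R p)"
    using Van_diff[OF _ Van_mult[OF Reg_jet_funs[OF jet_funs_src[OF f]]]] by fastforce
  then obtain k g where g: "g \<in> jet_funs k"
    "\<And>p. p \<in> Aut_inf X \<Longrightarrow> lam_deriv X lam f (src p) * kummer_fun R p = g p"
    using Van_Reg unfolding Reg_def by blast
  obtain y where y: "y \<in> X" using X_nonempty by blast
  have "lam_deriv X lam f x = g (test_jet y 1 x) + (-1) * g (test_jet y 0 x)" if x: "x \<in> X" for x
  proof -
    have s: "src (test_jet y c x) = x" "tgt (test_jet y c x) = y" for c
      by (auto simp: src_def tgt_def test_jet_def)
    have d: "test_jet y c x (Der 1) = 1" "test_jet y c x (Der 2) = 0" "test_jet y c x (Der 3) = c" for c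
      by (simp_all add: test_jet_def)
    have "test_jet y c x \<in> Aut_inf X" for c
      unfolding Aut_inf_def mem_Collect_eq s using x y by (simp add: test_jet_def)
    then have g_eq: "g (test_jet y c x) = lam_deriv X lam f x * (c - R x + R y)" for c
      using g(2)[of "test_jet y c x"]
      unfolding kummer_fun_def schwarzian_def s d by simp
    show ?thesis unfolding g_eq by (simp add: algebra_simps)
  qed
  moreover have "(\<lambda>x. g (test_jet y 1 x) + (-1) * g (test_jet y 0 x)) \<in> polys"
    by (rule polys_intros(3) polys_intros(4) polys_intros(2) test_jet_polys[OF g(1)])+
  ultimately show ?thesis by (intro bexI[of _ "\<lambda>x. g (test_jet y 1 x) + (-1) * g (test_jet y 0 x)"] ballI)
qed

definition dX :: "(('n \<Rightarrow> complex) \<Rightarrow> complex) \<Rightarrow> ('n \<Rightarrow> complex) \<Rightarrow> complex" where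
  "dX f = (SOME g. g \<in> polys \<and> (\<forall>x\<in>X. lam_deriv X lam f x = g x))"

lemma dX_in: "f \<in> polys \<Longrightarrow> dX f \<in> polys"
  and lam_deriv_dX: "f \<in> polys \<Longrightarrow> x \<in> X \<Longrightarrow> lam_deriv X lam f x = dX f x"
  using someI_ex[of "\<lambda>g. g \<in> polys \<and> (\<forall>x\<in>X. lam_deriv X lam f x = g x)"] lam_deriv_regular
  unfolding dX_def by blast+

lemma Aut_inf_Der1: "p \<in> Aut_inf X \<Longrightarrow> p (Der 1) \<noteq> 0"
  and Aut_inf_src: "p \<in> Aut_inf X \<Longrightarrow> src p \<in> X"
  and Aut_inf_tgt: "p \<in> Aut_inf X \<Longrightarrow> tgt p \<in> X"
  by (simp_all add: Aut_inf_def)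

lemma has_total_deriv_src_dX:
  "f \<in> polys \<Longrightarrow> p \<in> Aut_inf X \<Longrightarrow> has_total_deriv X lam (\<lambda>p. f (src p)) p (dX f (src p))"
  using has_total_deriv_src[of f X lam p] lam_deriv_dX[of f "src p"] Aut_inf_src by simp

lemma has_total_deriv_tgt_dX:
  "f \<in> polys \<Longrightarrow> p \<in> Aut_inf X \<Longrightarrow>
    has_total_deriv X lam (\<lambda>p. f (tgt p)) p (p (Der 1) * dX f (tgt p))"
  using has_total_deriv_tgt[of f X lam p] lam_deriv_dX[of f "tgt p"] Aut_inf_tgt by simp

text \<open>The total derivative of a function of order 2 is affine in the third derivative.\<close>
lemma total_deriv_order2:
  assumes "f \<in> jet_funs 2"
  shows "\<exists>u\<in>jet_funs 2. \<exists>w\<in>jet_funs 2. \<forall>p\<in>Aut_inf X.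
    has_total_deriv X lam f p (u p + p (Der 3) * w p)"
  using assms unfolding jet_funs_def[of 2]
proof (induction rule: alg.induct)
  case (gen f)
  then consider i where "f = (\<lambda>p. p (Src i))" | i where "f = (\<lambda>p. p (Tgt i))"
    | "f = (\<lambda>p. p (Der 1))" | "f = (\<lambda>p. p (Der 2))" | "f = (\<lambda>p. inverse (p (Der 1)))"
    by (auto simp: le_Suc_eq numeral_2_eq_2)
  then show ?case
  proof cases
    case 1
    then show ?thesis unfolding jet_funs_def[of 2, symmetric]
      using has_total_deriv_src_dX[OF polys_intros(1)[of i]]
      by (intro bexI[of _ "\<lambda>p. dX (\<lambda>x. x i) (src p)"] bexI[of _ "\<lambda>p. 0"])
        (auto simp: src_def[abs_def] intro!: jet_funs_intros jet_funs_src[unfolded src_def[abs_def]] dX_in polys_intros)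
  next
    case 2
    then show ?thesis unfolding jet_funs_def[of 2, symmetric]
      using has_total_deriv_tgt_dX[OF polys_intros(1)[of i]]
      by (intro bexI[of _ "\<lambda>p. p (Der 1) * dX (\<lambda>x. x i) (tgt p)"] bexI[of _ "\<lambda>p. 0"])
        (auto simp: tgt_def[abs_def] intro!: jet_funs_intros jet_funs_tgt[unfolded tgt_def[abs_def]] dX_in polys_intros)
  next
    case 3
    then show ?thesis unfolding jet_funs_def[of 2, symmetric]
      using has_total_deriv_Der[of 1 X lam]
      by (intro bexI[of _ "\<lambda>p. p (Der 2)"] bexI[of _ "\<lambda>p. 0"]) (auto simp: numeral_2_eq_2 intro!: jet_funs_intros)
  next
    case 4
    then show ?thesis unfolding jet_funs_def[of 2, symmetric]
      using has_total_deriv_Der[of 2 X lam]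
      by (intro bexI[of _ "\<lambda>p. 0"] bexI[of _ "\<lambda>p. 1"]) (auto simp: numeral_3_eq_3 numeral_2_eq_2 intro!: jet_funs_intros)
  next
    case 5
    have *: "has_total_deriv X lam f p (- p (Der 2) * inverse (p (Der 1)) ^ 2)" if "p \<in> Aut_inf X" for p
      unfolding 5 using has_total_deriv_inverse[OF has_total_deriv_Der[of 1 X lam p]] Aut_inf_Der1[OF that]
      by (simp add: numeral_2_eq_2)
    have "(\<lambda>p. (-1) * p (Der 2) * inverse (p (Der 1)) ^ 2) \<in> jet_funs 2"
      by (intro jet_funs_intros jet_funs_power) auto
    then show ?thesis unfolding jet_funs_def[of 2, symmetric] using *
      by (intro bexI[of _ "\<lambda>p. (-1) * p (Der 2) * inverse (p (Der 1)) ^ 2"] bexI[of _ "\<lambda>p. 0"])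
        (auto intro!: jet_funs_intros)
  qed
next
  case (const c)
  show ?case unfolding jet_funs_def[of 2, symmetric]
    by (intro bexI[of _ "\<lambda>p. 0"]) (auto intro!: jet_funs_intros has_total_deriv_const)
next
  case (add f g)
  then obtain u w u' w' where *: "u \<in> jet_funs 2" "w \<in> jet_funs 2" "u' \<in> jet_funs 2" "w' \<in> jet_funs 2"
    "\<And>p. p \<in> Aut_inf X \<Longrightarrow> has_total_deriv X lam f p (u p + p (Der 3) * w p)"
    "\<And>p. p \<in> Aut_inf X \<Longrightarrow> has_total_deriv X lam g p (u' p + p (Der 3) * w' p)"
    unfolding jet_funs_def[of 2, symmetric] by blast
  have "has_total_deriv X lam (\<lambda>p. f p + g p) p ((u p + u' p) + p (Der 3) * (w p + w' p))"
    if "p \<in> Aut_inf X" for p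
    by (rule has_total_deriv_eq[OF has_total_deriv_add[OF *(5,6)[OF that]]]) (simp add: algebra_simps)
  then show ?case unfolding jet_funs_def[of 2, symmetric]
    using * jet_funs_intros(2)[of _ 2] by (metis (no_types, lifting))
next
  case (mult f g)
  then obtain u w u' w' where *: "u \<in> jet_funs 2" "w \<in> jet_funs 2" "u' \<in> jet_funs 2" "w' \<in> jet_funs 2"
    "\<And>p. p \<in> Aut_inf X \<Longrightarrow> has_total_deriv X lam f p (u p + p (Der 3) * w p)"
    "\<And>p. p \<in> Aut_inf X \<Longrightarrow> has_total_deriv X lam g p (u' p + p (Der 3) * w' p)"
    unfolding jet_funs_def[of 2, symmetric] by blast
  have "has_total_deriv X lam (\<lambda>p. f p * g p) p ((u p * g p + f p * u' p) + p (Der 3) * (w p * g p + f p * w' p))"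
    if "p \<in> Aut_inf X" for p
    by (rule has_total_deriv_eq[OF has_total_deriv_mult[OF *(5,6)[OF that]]]) (simp add: algebra_simps)
  moreover have "(\<lambda>p. u p * g p + f p * u' p) \<in> jet_funs 2" "(\<lambda>p. w p * g p + f p * w' p) \<in> jet_funs 2"
    using mult.hyps * unfolding jet_funs_def[of 2, symmetric] by (auto intro!: jet_funs_intros)
  ultimately show ?case unfolding jet_funs_def[of 2, symmetric]
    by (intro bexI[of _ "\<lambda>p. u p * g p + f p * u' p"] bexI[of _ "\<lambda>p. w p * g p + f p * w' p"]) auto
qed

lemma Van_kummer: "Van (kummer_fun R)"
  using kummer_in by (simp add: Van_def)

lemma Der3_reduces: "\<exists>r\<in>jet_funs 2. Van (\<lambda>p. p (Der 3) - r p)"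
proof -
  let ?r = "\<lambda>p. p (Der 1) * (3/2 * (p (Der 2) * inverse (p (Der 1))) ^ 2 + R (src p) - R (tgt p) * p (Der 1) ^ 2)"
  have "Van (\<lambda>p. p (Der 1) * kummer_fun R p)"
    by (rule Van_mult[OF Reg_jet_funs[OF jet_funs_intros(4)[of 1 1]] Van_kummer]) auto
  then have "Van (\<lambda>p. p (Der 3) - ?r p)"
    by (rule Van_cong) (auto simp: kummer_fun_def schwarzian_def field_simps dest!: Aut_inf_Der1)
  moreover have "?r \<in> jet_funs 2"
    by (intro jet_funs_intros jet_funs_diff jet_funs_power jet_funs_src[OF R] jet_funs_tgt[OF R]) auto
  ultimately show ?thesis by (rule bexI[where x = ?r])
qed

text \<open>
  Differentiating a reduction of the derivative of order \<open>i\<close> gives one of order \<open>i + 1\<close>, after the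
  third derivative that appears is reduced by means of the Kummer equation itself.
\<close>
lemma Der_reduces:
  assumes "3 \<le> i"
  shows "\<exists>r\<in>jet_funs 2. Van (\<lambda>p. p (Der i) - r p)"
  using assms
proof (induction i rule: dec_induct)
  case base
  show ?case by (rule Der3_reduces)
next
  case (step i)
  then obtain r where r: "r \<in> jet_funs 2" "Van (\<lambda>p. p (Der i) - r p)" by blast
  obtain r3 where r3: "r3 \<in> jet_funs 2" "Van (\<lambda>p. p (Der 3) - r3 p)"
    using Der3_reduces by blast
  obtain u w where uw: "u \<in> jet_funs 2" "w \<in> jet_funs 2"
    "\<And>p. p \<in> Aut_inf X \<Longrightarrow> has_total_deriv X lam r p (u p + p (Der 3) * w p)"
    using total_deriv_order2[OF r(1)] by blast
  have "Van (\<lambda>p. p (Der (Suc i)) - (u p + p (Der 3) * w p))"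
  proof (rule Van_total_deriv[OF _ r(2)])
    show "(\<lambda>p. p (Der i) - r p) \<in> jet_funs i"
      using step r(1) jet_funs_mono[of 2 i] by (intro jet_funs_diff jet_funs_intros) auto
    show "has_total_deriv X lam (\<lambda>p. p (Der i) - r p) p (p (Der (Suc i)) - (u p + p (Der 3) * w p))"
      if "p \<in> Aut_inf X" for p
      using step by (intro has_total_deriv_diff has_total_deriv_Der uw that) auto
  qed
  then have "Van (\<lambda>p. p (Der (Suc i)) - (u p + p (Der 3) * w p) + w p * (p (Der 3) - r3 p))"
    by (intro Van_add Van_mult r3 Reg_jet_funs[OF uw(2)])
  then have "Van (\<lambda>p. p (Der (Suc i)) - (u p + r3 p * w p))"
    by (rule Van_cong) (simp add: algebra_simps)
  moreover have "(\<lambda>p. u p + r3 p * w p) \<in> jet_funs 2"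
    by (intro jet_funs_intros uw r3)
  ultimately show ?case by (rule bexI[where x = "\<lambda>p. u p + r3 p * w p"])
qed

lemma reduces_to_order2:
  assumes "f \<in> jet_funs k"
  shows "\<exists>g\<in>jet_funs 2. Van (\<lambda>p. f p - g p)"
  using assms unfolding jet_funs_def[of k]
proof (induction rule: alg.induct)
  case (gen f)
  show ?case
  proof (cases "\<exists>i\<ge>3. f = (\<lambda>p. p (Der i))")
    case True
    then obtain i where i: "i \<ge> 3" "f = (\<lambda>p. p (Der i))" by auto
    show ?thesis unfolding i(2) by (rule Der_reduces[OF i(1)])
  next
    case False
    have "f \<in> jet_funs 2"
    proof (cases "\<exists>i\<ge>1. f = (\<lambda>p. p (Der i))")
      case True
      then obtain i where i: "i \<ge> 1" "f = (\<lambda>p. p (Der i))" by auto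
      then have "i \<le> 2" using False by (metis Suc_leI eval_nat_numeral(3) not_le)
      then show ?thesis unfolding i(2) by (rule jet_funs_intros(4)[OF i(1)])
    next
      case False
      then show ?thesis using gen unfolding jet_funs_def[of 2]
        by (intro alg.gen) (auto split: if_splits)
    qed
    then show ?thesis by (intro bexI[of _ f] Van_zero) auto
  qed
next
  case (const c)
  then show ?case by (intro bexI[of _ "\<lambda>p. c"] Van_zero jet_funs_intros) auto
next
  case (add f g)
  then obtain f' g' where *: "f' \<in> jet_funs 2" "g' \<in> jet_funs 2"
    "Van (\<lambda>p. f p - f' p)" "Van (\<lambda>p. g p - g' p)" by blast
  show ?case
    using jet_funs_intros(2)[OF *(1,2)]
    by (rule bexI[rotated]) (rule Van_cong[OF Van_add[OF *(3,4)]], simp)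
next
  case (mult f g)
  then obtain f' g' where *: "f' \<in> jet_funs 2" "g' \<in> jet_funs 2"
    "Van (\<lambda>p. f p - f' p)" "Van (\<lambda>p. g p - g' p)" by blast
  have "Reg f" using mult.hyps Reg_jet_funs[of f k] by (simp add: jet_funs_def)
  show ?case
    using jet_funs_intros(3)[OF *(1,2)]
    by (rule bexI[rotated])
      (rule Van_cong[OF Van_add[OF Van_mult[OF \<open>Reg f\<close> *(4)] Van_mult[OF Reg_jet_funs[OF *(2)] *(3)]]],
        simp add: algebra_simps)
qed

end

lemma radical_D_ideal_Int:
  assumes "radical_D_ideal X lam H" "radical_D_ideal X lam E"
  shows "radical_D_ideal X lam (H \<inter> E)"
  using assms ring.i_intersect[of "Aut_ring X" H E] ideal.axioms(2)[of H "Aut_ring X"]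
  unfolding radical_D_ideal_def radical_ideal_def by auto

text \<open>
  By the definition of a generated ideal, an element of \<open>H\<close> outside the Kummer ideal lies outside
  some radical differential ideal \<open>E\<close> that contains the Kummer equation. Reduction to order 2 modulo
  \<open>H \<inter> E\<close> changes neither membership in \<open>H\<close> nor membership in \<open>E\<close>.
\<close>
lemma ex_order2_element:
  fixes X :: "('n::finite \<Rightarrow> complex) set"
  assumes irred: "zariski_irreducible X" and R: "R \<in> polys"
    and H: "radical_D_ideal X lam H" and sub: "kummer X lam R \<subseteq> H" and neq: "H \<noteq> kummer X lam R"
  shows "\<exists>f\<in>jet_funs 2. restrict f (Aut_inf X) \<in> H \<and> (\<exists>p\<in>Aut_inf X. f p \<noteq> 0)"
proof -
  let ?\<kappa> = "restrict (kummer_fun R) (Aut_inf X)"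
  have \<kappa>: "?\<kappa> = restrict (\<lambda>p. schwarzian p - R (src p) + R (tgt p) * p (Der 1) ^ 2) (Aut_inf X)"
    by (simp add: kummer_fun_def[abs_def])
  have \<kappa>H: "?\<kappa> \<in> H" using sub unfolding kummer_def radical_D_ideal_gen_def \<kappa> by blast
  obtain h where h: "h \<in> H" "h \<notin> kummer X lam R" using sub neq by blast
  then obtain E where E: "radical_D_ideal X lam E" "?\<kappa> \<in> E" "h \<notin> E"
    unfolding kummer_def radical_D_ideal_gen_def \<kappa> by blast
  interpret I: kummer_ideal X lam R "H \<inter> E"
    using irred R radical_D_ideal_Int[OF H E(1)] \<kappa>H E(2) by unfold_locales auto
  interpret H: kummer_ideal X lam R H
    using irred R H \<kappa>H by unfold_locales auto
  interpret E: kummer_ideal X lam R E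
    using irred R E by unfold_locales auto
  have "h \<in> carrier (Aut_ring X)" using ideal.Icarr[OF H.ideal_H h(1)] .
  then obtain k f where f: "f \<in> jet_funs k" "h = restrict f (Aut_inf X)"
    by (auto simp: Aut_ring_def fun_ring_def)
  obtain g where g: "g \<in> jet_funs 2" "I.Van (\<lambda>p. f p - g p)" using I.reduces_to_order2[OF f(1)] by blast
  have gH: "H.Van (\<lambda>p. f p - g p)" and gE: "E.Van (\<lambda>p. f p - g p)"
    using g(2) by (simp_all add: I.Van_def H.Van_def E.Van_def)
  have fH: "H.Van f" using h f by (simp add: H.Van_def)
  have "H.Van g" using H.Van_diff[OF fH gH] by simp
  moreover have "\<exists>p\<in>Aut_inf X. g p \<noteq> 0"
  proof (rule ccontr)
    assume "\<not> ?thesis"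
    then have "E.Van g" by (intro E.Van_zero) auto
    from E.Van_add[OF gE this] have "E.Van f" by simp
    then show False using f E(3) by (simp add: E.Van_def)
  qed
  ultimately show ?thesis using g(1) by (auto simp: H.Van_def)
qed

(* From here on, degree, coeff and monom refer to the type of polynomials, not to the polynomials
   over a ring given by its carrier. *)
hide_const (open) Polynomials.degree Polynomials.lead_coeff up_ring.coeff up_ring.monom

section \<open>Functions of source and target\<close>

type_synonym 'n bifun = "('n \<Rightarrow> complex) \<times> ('n \<Rightarrow> complex) \<Rightarrow> complex"
type_synonym 'n bifam = "('n \<Rightarrow> complex) \<times> ('n \<Rightarrow> complex) \<Rightarrow> complex poly"

text \<open>The functions of order 0, seen as functions on pairs of points.\<close>
definition bipolys :: "'n bifun set" where
  "bipolys = alg (range (\<lambda>i q. fst q i) \<union> range (\<lambda>i q. snd q i))"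

definition endpoints :: "'n jet \<Rightarrow> ('n \<Rightarrow> complex) \<times> ('n \<Rightarrow> complex)" where
  "endpoints p = (src p, tgt p)"

lemma bipolys_intros:
  "(\<lambda>q. c) \<in> bipolys"
  "F \<in> bipolys \<Longrightarrow> G \<in> bipolys \<Longrightarrow> (\<lambda>q. F q + G q) \<in> bipolys"
  "F \<in> bipolys \<Longrightarrow> G \<in> bipolys \<Longrightarrow> (\<lambda>q. F q * G q) \<in> bipolys"
  unfolding bipolys_def by (auto intro: alg.intros)

lemma bipolys_coord: "(\<lambda>q. fst q i) \<in> bipolys" "(\<lambda>q. snd q i) \<in> bipolys"
  unfolding bipolys_def by (auto intro: alg.intros)

lemma bipolys_power: "F \<in> bipolys \<Longrightarrow> (\<lambda>q. F q ^ n) \<in> bipolys"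
  by (induction n) (auto intro: bipolys_intros)

lemma bipolys_fst: "f \<in> polys \<Longrightarrow> (\<lambda>q. f (fst q)) \<in> bipolys"
  and bipolys_snd: "f \<in> polys \<Longrightarrow> (\<lambda>q. f (snd q)) \<in> bipolys"
  unfolding polys_def by (induction rule: alg.induct) (auto intro: bipolys_intros bipolys_coord)

lemma bipolys_induct [consumes 1, case_names fst snd const add mult]:
  assumes "F \<in> bipolys"
    and "\<And>i. Q (\<lambda>q. fst q i)" "\<And>i. Q (\<lambda>q. snd q i)" "\<And>c. Q (\<lambda>q. c)"
    and "\<And>F G. F \<in> bipolys \<Longrightarrow> G \<in> bipolys \<Longrightarrow> Q F \<Longrightarrow> Q G \<Longrightarrow> Q (\<lambda>q. F q + G q)"
    and "\<And>F G. F \<in> bipolys \<Longrightarrow> G \<in> bipolys \<Longrightarrow> Q F \<Longrightarrow> Q G \<Longrightarrow> Q (\<lambda>q. F q * G q)"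
  shows "Q F"
  using assms(1) unfolding bipolys_def
  by (induction rule: alg.induct) (auto intro: assms(2-) simp: bipolys_def)

lemma bipolys_slice:
  assumes "F \<in> bipolys"
  shows "(\<lambda>x. F (x, y)) \<in> polys" "(\<lambda>y. F (x, y)) \<in> polys"
  using assms by (induction rule: bipolys_induct) (auto intro: polys_intros)

lemma bipolys_jet_funs: "F \<in> bipolys \<Longrightarrow> (\<lambda>p. F (endpoints p)) \<in> jet_funs k"
proof (induction rule: bipolys_induct)
  case (fst i)
  then show ?case using jet_funs_src[OF polys_intros(1)[of i], of k] by (simp add: endpoints_def)
next
  case (snd i)
  then show ?case using jet_funs_tgt[OF polys_intros(1)[of i], of k] by (simp add: endpoints_def)
qed (auto intro: jet_funs_intros)

context kummer_ideal
begin

lemma endpoints_in: "p \<in> Aut_inf X \<Longrightarrow> endpoints p \<in> X \<times> X"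
  by (simp add: endpoints_def Aut_inf_def)

text \<open>
  Irreducibility of \<open>X \<times> X\<close>: if \<open>F\<close> and \<open>G\<close> are nonzero at \<open>(a, b)\<close> and \<open>(c, d)\<close>, irreducibility of
  \<open>X\<close> provides first a common \<open>y\<close> with \<open>F(a, y)\<close> and \<open>G(c, y)\<close> nonzero and then a common \<open>x\<close>.
\<close>
lemma bipolys_no_zero_divisors:
  assumes F: "F \<in> bipolys" and G: "G \<in> bipolys" and "\<And>q. q \<in> X \<times> X \<Longrightarrow> F q * G q = 0"
  shows "(\<forall>q\<in>X \<times> X. F q = 0) \<or> (\<forall>q\<in>X \<times> X. G q = 0)"
proof (rule ccontr)
  assume "\<not> ?thesis"
  then obtain a b c d where *: "a \<in> X" "b \<in> X" "F (a, b) \<noteq> 0" "c \<in> X" "d \<in> X" "G (c, d) \<noteq> 0"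
    by auto
  have "\<not> (\<forall>y\<in>X. F (a, y) = 0)" "\<not> (\<forall>y\<in>X. G (c, y) = 0)" using * by auto
  then obtain y where y: "y \<in> X" "F (a, y) \<noteq> 0" "G (c, y) \<noteq> 0"
    using polys_no_zero_divisors[OF bipolys_slice(2)[OF F, of a] bipolys_slice(2)[OF G, of c]]
    by (metis mult_eq_0_iff)
  have "\<not> (\<forall>x\<in>X. F (x, y) = 0)" "\<not> (\<forall>x\<in>X. G (x, y) = 0)" using * y by auto
  then show False
    using polys_no_zero_divisors[OF bipolys_slice(1)[OF F, of y] bipolys_slice(1)[OF G, of y]] assms(3) y(1)
    by auto
qed

end

text \<open>
  Polynomials over a ring \<open>S\<close> of functions, as families of polynomials over the ring of values. At
  every parameter one thus computes with polynomials over the complex numbers; the bound on the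
  degree makes finitely many coefficient functions suffice.
\<close>
definition polyfam :: "('q \<Rightarrow> 'a::comm_ring_1) set \<Rightarrow> ('q \<Rightarrow> 'a poly) set" where
  "polyfam S = {F. (\<exists>N. \<forall>q. degree (F q) \<le> N) \<and> (\<forall>i. (\<lambda>q. coeff (F q) i) \<in> S)}"

locale function_algebra =
  fixes S :: "('q \<Rightarrow> 'a::comm_ring_1) set"
  assumes zero: "(\<lambda>q. 0) \<in> S" and one: "(\<lambda>q. 1) \<in> S"
    and uminus: "F \<in> S \<Longrightarrow> (\<lambda>q. - F q) \<in> S"
    and add: "F \<in> S \<Longrightarrow> G \<in> S \<Longrightarrow> (\<lambda>q. F q + G q) \<in> S"
    and mult: "F \<in> S \<Longrightarrow> G \<in> S \<Longrightarrow> (\<lambda>q. F q * G q) \<in> S"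
begin

lemma diff: "F \<in> S \<Longrightarrow> G \<in> S \<Longrightarrow> (\<lambda>q. F q - G q) \<in> S"
  using add[OF _ uminus] by fastforce

lemma sum: "(\<And>i. i \<in> I \<Longrightarrow> F i \<in> S) \<Longrightarrow> (\<lambda>q. \<Sum>i\<in>I. F i q) \<in> S"
  by (induction I rule: infinite_finite_induct) (auto intro: zero add)

lemma polyfam_const:
  assumes "c \<in> S"
  shows "(\<lambda>q. [:c q:]) \<in> polyfam S"
proof -
  have "(\<lambda>q. coeff [:c q:] i) \<in> S" for i
    using assms zero by (cases i) simp_all
  then show ?thesis by (auto simp: polyfam_def)
qed

lemma polyfam_pCons: "c \<in> S \<Longrightarrow> F \<in> polyfam S \<Longrightarrow> (\<lambda>q. pCons (c q) (F q)) \<in> polyfam S"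
proof -
  assume c: "c \<in> S" and F: "F \<in> polyfam S"
  then obtain N where "\<And>q. degree (F q) \<le> N" by (auto simp: polyfam_def)
  then have "degree (pCons (c q) (F q)) \<le> Suc N" for q
    using degree_pCons_le[of "c q" "F q"] by (meson Suc_le_mono le_trans)
  moreover have "(\<lambda>q. coeff (pCons (c q) (F q)) i) \<in> S" for i
    using c F by (cases i) (auto simp: polyfam_def)
  ultimately show ?thesis unfolding polyfam_def by blast
qed

lemma polyfam_add:
  assumes "F \<in> polyfam S" "G \<in> polyfam S"
  shows "(\<lambda>q. F q + G q) \<in> polyfam S"
proof -
  obtain N M where "\<And>q. degree (F q) \<le> N" "\<And>q. degree (G q) \<le> M"
    using assms by (auto simp: polyfam_def)
  then have "degree (F q + G q) \<le> max N M" for q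
    by (meson degree_add_le le_trans max.cobounded1 max.cobounded2)
  moreover have "(\<lambda>q. coeff (F q + G q) i) \<in> S" for i
    using assms by (auto simp: polyfam_def intro: add)
  ultimately show ?thesis unfolding polyfam_def by blast
qed

lemma polyfam_uminus: "F \<in> polyfam S \<Longrightarrow> (\<lambda>q. - F q) \<in> polyfam S"
  unfolding polyfam_def by (auto intro: uminus)

lemma polyfam_mult:
  assumes "F \<in> polyfam S" "G \<in> polyfam S"
  shows "(\<lambda>q. F q * G q) \<in> polyfam S"
proof -
  obtain N M where NM: "\<And>q. degree (F q) \<le> N" "\<And>q. degree (G q) \<le> M"
    using assms by (auto simp: polyfam_def)
  have "degree (F q * G q) \<le> N + M" for q
    using degree_mult_le[of "F q" "G q"] add_mono[OF NM[of q]] by (rule le_trans)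
  moreover have "(\<lambda>q. coeff (F q * G q) i) \<in> S" for i
    unfolding coeff_mult using assms by (intro sum mult) (auto simp: polyfam_def)
  ultimately show ?thesis unfolding polyfam_def by blast
qed

lemma function_algebra_polyfam: "function_algebra (polyfam S)"
proof
  show "(\<lambda>q. 0) \<in> polyfam S" using polyfam_const[OF zero] by simp
  show "(\<lambda>q. 1) \<in> polyfam S" using polyfam_const[OF one] by (simp add: one_pCons)
qed (auto intro: polyfam_add polyfam_uminus polyfam_mult)

lemma polyfam_smult: "c \<in> S \<Longrightarrow> F \<in> polyfam S \<Longrightarrow> (\<lambda>q. Polynomial.smult (c q) (F q)) \<in> polyfam S"
  using polyfam_mult[OF polyfam_const, of c F] by simp

lemma polyfam_monom: "c \<in> S \<Longrightarrow> (\<lambda>q. Polynomial.monom (c q) n) \<in> polyfam S"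
proof (induction n)
  case 0
  then show ?case using polyfam_const by (simp add: monom_0)
next
  case (Suc n)
  then show ?case using polyfam_pCons[OF zero] by (simp add: monom_Suc)
qed

end

interpretation bipolys: function_algebra bipolys
proof
  show "(\<lambda>q. - F q) \<in> bipolys" if "F \<in> bipolys" for F :: "'n bifun"
    using bipolys_intros(3)[OF bipolys_intros(1)[of "-1"] that] by simp
qed (auto intro: bipolys_intros)

interpretation polyfam: function_algebra "polyfam bipolys"
  by (rule bipolys.function_algebra_polyfam)

lemma polyfam_coeff: "F \<in> polyfam S \<Longrightarrow> (\<lambda>q. coeff (F q) i) \<in> S"
  by (simp add: polyfam_def)

lemma order1_normal_form:
  assumes "f \<in> jet_funs 1"
  shows "\<exists>K. \<exists>F\<in>polyfam bipolys. \<forall>p. p (Der 1) \<noteq> 0 \<longrightarrow>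
    p (Der 1) ^ K * f p = poly (F (endpoints p)) (p (Der 1))"
  using assms unfolding jet_funs_def
proof (induction rule: alg.induct)
  case (gen f)
  then consider i where "f = (\<lambda>p. p (Src i))" | i where "f = (\<lambda>p. p (Tgt i))"
    | "f = (\<lambda>p. p (Der 1))" | "f = (\<lambda>p. inverse (p (Der 1)))"
    by (auto simp: le_Suc_eq)
  then show ?case
  proof cases
    case 1
    then show ?thesis
      by (intro exI[of _ 0] bexI[OF _ bipolys.polyfam_const[OF bipolys_coord(1)[of i]]])
        (simp add: endpoints_def src_def)
  next
    case 2
    then show ?thesis
      by (intro exI[of _ 0] bexI[OF _ bipolys.polyfam_const[OF bipolys_coord(2)[of i]]])
        (simp add: endpoints_def tgt_def)
  next
    case 3
    then show ?thesis
      by (intro exI[of _ 0] bexI[OF _ bipolys.polyfam_monom[OF bipolys.one, of 1]])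
        (simp add: poly_monom)
  next
    case 4
    then show ?thesis
      by (intro exI[of _ 1] bexI[OF _ bipolys.polyfam_const[OF bipolys.one]]) simp
  qed
next
  case (const c)
  show ?case
    by (intro exI[of _ 0] bexI[OF _ bipolys.polyfam_const[OF bipolys_intros(1)[of c]]]) simp
next
  case (add f g)
  then obtain K F M G where *: "F \<in> polyfam bipolys" "G \<in> polyfam bipolys"
    "\<And>p. p (Der 1) \<noteq> 0 \<Longrightarrow> p (Der 1) ^ K * f p = poly (F (endpoints p)) (p (Der 1))"
    "\<And>p. p (Der 1) \<noteq> 0 \<Longrightarrow> p (Der 1) ^ M * g p = poly (G (endpoints p)) (p (Der 1))" by blast
  let ?F = "\<lambda>q. Polynomial.monom 1 M * F q + Polynomial.monom 1 K * G q"
  have "p (Der 1) ^ (K + M) * (f p + g p) = poly (?F (endpoints p)) (p (Der 1))"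
    if "p (Der 1) \<noteq> 0" for p
    by (simp add: poly_monom *(3)[of p, OF that, symmetric] *(4)[of p, OF that, symmetric] power_add algebra_simps del: One_nat_def)
  moreover have "?F \<in> polyfam bipolys"
    by (intro bipolys.polyfam_add bipolys.polyfam_mult bipolys.polyfam_monom bipolys.one *)
  ultimately show ?case by (intro exI[of _ "K + M"] bexI[of _ ?F]) auto
next
  case (mult f g)
  then obtain K F M G where *: "F \<in> polyfam bipolys" "G \<in> polyfam bipolys"
    "\<And>p. p (Der 1) \<noteq> 0 \<Longrightarrow> p (Der 1) ^ K * f p = poly (F (endpoints p)) (p (Der 1))"
    "\<And>p. p (Der 1) \<noteq> 0 \<Longrightarrow> p (Der 1) ^ M * g p = poly (G (endpoints p)) (p (Der 1))" by blast
  have "p (Der 1) ^ (K + M) * (f p * g p) = poly (F (endpoints p) * G (endpoints p)) (p (Der 1))"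
    if "p (Der 1) \<noteq> 0" for p
    by (simp add: *(3)[of p, OF that, symmetric] *(4)[of p, OF that, symmetric] power_add algebra_simps del: One_nat_def)
  moreover have "(\<lambda>q. F q * G q) \<in> polyfam bipolys"
    by (intro bipolys.polyfam_mult *)
  ultimately show ?case by (intro exI[of _ "K + M"] bexI[of _ "\<lambda>q. F q * G q"]) auto
qed

text \<open>
  The coordinate in which the highest part of the derivation becomes the Riccati vector field.
\<close>
definition ucoord :: "'n jet \<Rightarrow> complex" where
  "ucoord p = p (Der 2) / (2 * p (Der 1) ^ 2)"

lemma order2_normal_form:
  assumes "f \<in> jet_funs 2"
  shows "\<exists>K. \<exists>F\<in>polyfam (polyfam bipolys). \<forall>p. p (Der 1) \<noteq> 0 \<longrightarrow>
    p (Der 1) ^ K * f p = poly (poly (F (endpoints p)) [:ucoord p:]) (p (Der 1))"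
  using assms unfolding jet_funs_def
proof (induction rule: alg.induct)
  case (gen f)
  then consider "f \<in> jet_funs 1" | "f = (\<lambda>p. p (Der 2))"
    unfolding jet_funs_def[of 1]
    by (auto simp: le_Suc_eq numeral_2_eq_2 intro: alg.gen)
  then show ?case
  proof cases
    case 1
    then obtain K F where F: "F \<in> polyfam bipolys" "\<And>p. p (Der 1) \<noteq> 0 \<Longrightarrow>
      p (Der 1) ^ K * f p = poly (F (endpoints p)) (p (Der 1))" using order1_normal_form by blast
    show ?thesis
      by (intro exI[of _ K] bexI[OF _ polyfam.polyfam_const[OF F(1)]]) (use F(2) in simp)
  next
    case 2
    have "(\<lambda>q. Polynomial.monom 2 2 :: complex poly) \<in> polyfam bipolys"
      by (rule bipolys.polyfam_monom[OF bipolys_intros(1)])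
    note * = polyfam.polyfam_monom[OF this, of 1]
    show ?thesis
      by (intro exI[of _ 0] bexI[OF _ *])
        (simp add: 2 poly_monom ucoord_def field_simps)
  qed
next
  case (const c)
  show ?case
    by (intro exI[of _ 0] bexI[OF _ polyfam.polyfam_const[OF bipolys.polyfam_const[OF bipolys_intros(1)[of c]]]]) simp
next
  case (add f g)
  then obtain K F M G where *: "F \<in> polyfam (polyfam bipolys)" "G \<in> polyfam (polyfam bipolys)"
    "\<And>p. p (Der 1) \<noteq> 0 \<Longrightarrow> p (Der 1) ^ K * f p = poly (poly (F (endpoints p)) [:ucoord p:]) (p (Der 1))"
    "\<And>p. p (Der 1) \<noteq> 0 \<Longrightarrow> p (Der 1) ^ M * g p = poly (poly (G (endpoints p)) [:ucoord p:]) (p (Der 1))" by blast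
  let ?F = "\<lambda>q. [:Polynomial.monom 1 M:] * F q + [:Polynomial.monom 1 K:] * G q"
  have "p (Der 1) ^ (K + M) * (f p + g p) = poly (poly (?F (endpoints p)) [:ucoord p:]) (p (Der 1))"
    if "p (Der 1) \<noteq> 0" for p
    by (simp add: poly_monom *(3)[of p, OF that, symmetric] *(4)[of p, OF that, symmetric] power_add algebra_simps del: One_nat_def)
  moreover have "?F \<in> polyfam (polyfam bipolys)"
    by (intro polyfam.polyfam_add polyfam.polyfam_mult polyfam.polyfam_const
        bipolys.polyfam_monom bipolys.one *)
  ultimately show ?case by (intro exI[of _ "K + M"] bexI[of _ ?F]) auto
next
  case (mult f g)
  then obtain K F M G where *: "F \<in> polyfam (polyfam bipolys)" "G \<in> polyfam (polyfam bipolys)"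
    "\<And>p. p (Der 1) \<noteq> 0 \<Longrightarrow> p (Der 1) ^ K * f p = poly (poly (F (endpoints p)) [:ucoord p:]) (p (Der 1))"
    "\<And>p. p (Der 1) \<noteq> 0 \<Longrightarrow> p (Der 1) ^ M * g p = poly (poly (G (endpoints p)) [:ucoord p:]) (p (Der 1))" by blast
  have "p (Der 1) ^ (K + M) * (f p * g p)
      = poly (poly (F (endpoints p) * G (endpoints p)) [:ucoord p:]) (p (Der 1))"
    if "p (Der 1) \<noteq> 0" for p
    by (simp add: *(3)[of p, OF that, symmetric] *(4)[of p, OF that, symmetric] power_add algebra_simps del: One_nat_def)
  moreover have "(\<lambda>q. F q * G q) \<in> polyfam (polyfam bipolys)"
    by (intro polyfam.polyfam_mult *)
  ultimately show ?case by (intro exI[of _ "K + M"] bexI[of _ "\<lambda>q. F q * G q"]) auto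
qed

section \<open>Partial derivatives with respect to source and target\<close>

lemma pderiv_sum: "pderiv (\<Sum>i\<in>S. f i) = (\<Sum>i\<in>S. pderiv (f i))"
  by (induction S rule: infinite_finite_induct) (simp_all add: pderiv_add)

text \<open>
  The ideal of a subgroupoid of positive order: it contains no nonzero function of the endpoints.
\<close>
locale kummer_subideal = kummer_ideal X lam R H
  for X :: "('n::finite \<Rightarrow> complex) set" and lam R H +
  fixes L :: "'l ring" and e :: "(('n \<Rightarrow> complex) \<Rightarrow> complex) \<Rightarrow> 'l" and \<delta> :: "'l \<Rightarrow> 'l"
  assumes closure: "function_field_closure X lam L e \<delta>"
    and order_pos: "F \<in> bipolys \<Longrightarrow> Van (\<lambda>p. F (endpoints p)) \<Longrightarrow> q \<in> X \<times> X \<Longrightarrow> F q = 0"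
begin

abbreviation embed :: "(('n \<Rightarrow> complex) \<Rightarrow> complex) \<Rightarrow> 'l" where
  "embed f \<equiv> e (restrict f X)"

lemma e_hom: "e \<in> ring_hom (coord_ring X) L" and e_inj: "inj_on e (carrier (coord_ring X))"
  and L_closure: "algebraic_closure L (function_field X L e)" and \<delta>: "derivation L \<delta>"
  and \<delta>_lam: "f \<in> polys \<Longrightarrow> \<delta> (embed f) = embed (lam_deriv X lam f)"
  using closure unfolding function_field_closure_def by auto

lemma L_closed: "algebraically_closed L"
proof -
  interpret algebraic_closure L "function_field X L e" by (rule L_closure)
  show ?thesis by unfold_locales
qed

lemma coord_carrier: "f \<in> polys \<Longrightarrow> restrict f X \<in> carrier (coord_ring X)"
  by (simp add: coord_ring_def fun_ring_def)

lemma embed_cong: "(\<And>x. x \<in> X \<Longrightarrow> f x = g x) \<Longrightarrow> embed f = embed g"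
  by (metis restrict_ext)

lemma embed_inj: "f \<in> polys \<Longrightarrow> g \<in> polys \<Longrightarrow> embed f = embed g \<Longrightarrow> x \<in> X \<Longrightarrow> f x = g x"
  using inj_onD[OF e_inj _ coord_carrier coord_carrier, of f g] by (metis restrict_apply')

lemma \<delta>_embed: "f \<in> polys \<Longrightarrow> \<delta> (embed f) = embed (dX f)"
  using \<delta>_lam[of f] embed_cong[of "lam_deriv X lam f" "dX f"] lam_deriv_dX[of f] by simp

text \<open>
  Independence of the representative, for which the existence of \<open>\<delta>\<close> is used: \<open>\<delta>\<close> sees only the
  restriction to \<open>X\<close>, and the embedding into the field is injective.
\<close>
lemma dX_cong:
  assumes "f \<in> polys" "g \<in> polys" "\<And>x. x \<in> X \<Longrightarrow> f x = g x" "x \<in> X"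
  shows "dX f x = dX g x"
proof -
  have "embed (dX f) = embed (dX g)"
    using \<delta>_embed[OF assms(1)] \<delta>_embed[OF assms(2)] embed_cong[of f g] assms(3) by simp
  then show ?thesis using embed_inj dX_in assms by blast
qed

lemma embed_add: "f \<in> polys \<Longrightarrow> g \<in> polys \<Longrightarrow> embed (\<lambda>x. f x + g x) = embed f \<oplus>\<^bsub>L\<^esub> embed g"
proof -
  assume "f \<in> polys" "g \<in> polys"
  then have "e (restrict f X \<oplus>\<^bsub>coord_ring X\<^esub> restrict g X) = embed f \<oplus>\<^bsub>L\<^esub> embed g"
    by (intro ring_hom_add[OF e_hom] coord_carrier)
  moreover have "restrict f X \<oplus>\<^bsub>coord_ring X\<^esub> restrict g X = restrict (\<lambda>x. f x + g x) X"
    by (auto simp: coord_ring_def fun_ring_def restrict_def fun_eq_iff)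
  ultimately show ?thesis by simp
qed

lemma embed_mult: "f \<in> polys \<Longrightarrow> g \<in> polys \<Longrightarrow> embed (\<lambda>x. f x * g x) = embed f \<otimes>\<^bsub>L\<^esub> embed g"
proof -
  assume "f \<in> polys" "g \<in> polys"
  then have "e (restrict f X \<otimes>\<^bsub>coord_ring X\<^esub> restrict g X) = embed f \<otimes>\<^bsub>L\<^esub> embed g"
    by (intro ring_hom_mult[OF e_hom] coord_carrier)
  moreover have "restrict f X \<otimes>\<^bsub>coord_ring X\<^esub> restrict g X = restrict (\<lambda>x. f x * g x) X"
    by (auto simp: coord_ring_def fun_ring_def restrict_def fun_eq_iff)
  ultimately show ?thesis by simp
qed

lemma embed_closed: "f \<in> polys \<Longrightarrow> embed f \<in> carrier L"
  by (intro ring_hom_closed[OF e_hom] coord_carrier)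

lemma embed_one: "embed (\<lambda>x. 1) = \<one>\<^bsub>L\<^esub>"
  using ring_hom_one[OF e_hom] by (simp add: coord_ring_def fun_ring_def)

lemma embed_zero: "embed (\<lambda>x. 0) = \<zero>\<^bsub>L\<^esub>"
proof -
  interpret algebraically_closed L by (rule L_closed)
  have "embed (\<lambda>x. 0) = embed (\<lambda>x. 0) \<oplus>\<^bsub>L\<^esub> embed (\<lambda>x. 0)"
    using embed_add[of "\<lambda>x. 0" "\<lambda>x. 0"] polys_intros(2)[of 0] by simp
  then show ?thesis using embed_closed[of "\<lambda>x. 0"] polys_intros(2)[of 0]
    by (metis local.add.r_cancel_one)
qed

sublocale function_ring X polys dX
proof
  have lam: "lam_deriv X lam f x = dX f x" if "f \<in> polys" "x \<in> X" for f x
    using that by (rule lam_deriv_dX)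
  show "dX (\<lambda>x. c) x = 0" if "x \<in> X" for c x
    unfolding lam[OF polys_intros(2) that, symmetric] lam_deriv_def by (rule dir_deriv_const)
  show "dX (\<lambda>x. f x + g x) x = dX f x + dX g x" if "f \<in> polys" "g \<in> polys" "x \<in> X" for f g x
    using that lam[of "\<lambda>x. f x + g x" x] lam[of f x] lam[of g x]
    by (simp add: lam_deriv_def dir_deriv_add polys_intros)
  show "dX (\<lambda>x. f x * g x) x = dX f x * g x + f x * dX g x" if "f \<in> polys" "g \<in> polys" "x \<in> X" for f g x
    using that lam[of "\<lambda>x. f x * g x" x] lam[of f x] lam[of g x]
    by (simp add: lam_deriv_def dir_deriv_mult polys_intros)
  show "(\<forall>x\<in>X. f x = 0) \<or> (\<forall>x\<in>X. g x = 0)"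
    if "f \<in> polys" "g \<in> polys" "\<And>x. x \<in> X \<Longrightarrow> f x * g x = 0" for f g
    by (rule polys_no_zero_divisors[OF that])
  show "dX f x = dX g x" if "f \<in> polys" "g \<in> polys" "\<And>x. x \<in> X \<Longrightarrow> f x = g x" "x \<in> X" for f g x
    by (rule dX_cong[OF that])
qed (auto intro: polys_intros dX_in)

lemma closed_extension_L: "closed_extension X polys dX L embed \<delta>"
proof -
  interpret algebraically_closed L by (rule L_closed)
  show ?thesis
  proof
    show "f x = 0" if "f \<in> polys" "embed f = \<zero>\<^bsub>L\<^esub>" "x \<in> X" for f x
      using embed_inj[OF that(1) polys_intros(2)[of 0]] that embed_zero by simp
    show "embed f = embed g" if "\<And>x. x \<in> X \<Longrightarrow> f x = g x" for f g
      by (rule embed_cong[OF that])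
  qed (use \<delta> in \<open>auto simp: derivation_def embed_add embed_mult embed_closed embed_one embed_zero \<delta>_embed\<close>)
qed

text \<open>
  \<open>F1\<close> and \<open>F2\<close> are the derivatives of \<open>F\<close> along the source and the target. Both have to be regular
  on pairs, not only on each slice, which is why they are found by induction on \<open>F\<close>.
\<close>
definition partial_derivs ::
  "'n bifun \<Rightarrow> 'n bifun
    \<Rightarrow> 'n bifun \<Rightarrow> bool" where
  "partial_derivs F F1 F2 \<longleftrightarrow> F1 \<in> bipolys \<and> F2 \<in> bipolys \<and>
    (\<forall>x\<in>X. \<forall>y\<in>X. F1 (x, y) = dX (\<lambda>x. F (x, y)) x \<and> F2 (x, y) = dX (\<lambda>y. F (x, y)) y) \<and>
    (\<forall>p\<in>Aut_inf X. has_total_deriv X lam (\<lambda>p. F (endpoints p)) p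
        (F1 (endpoints p) + p (Der 1) * F2 (endpoints p)))"

lemma partial_derivsI:
  assumes "F1 \<in> bipolys" "F2 \<in> bipolys"
    and "\<And>x y. x \<in> X \<Longrightarrow> y \<in> X \<Longrightarrow> F1 (x, y) = dX (\<lambda>x. F (x, y)) x"
    and "\<And>x y. x \<in> X \<Longrightarrow> y \<in> X \<Longrightarrow> F2 (x, y) = dX (\<lambda>y. F (x, y)) y"
    and "\<And>p. p \<in> Aut_inf X \<Longrightarrow> has_total_deriv X lam (\<lambda>p. F (endpoints p)) p
        (F1 (endpoints p) + p (Der 1) * F2 (endpoints p))"
  shows "partial_derivs F F1 F2"
  unfolding partial_derivs_def using assms by (intro conjI ballI)

lemma partial_derivsD:
  assumes "partial_derivs F F1 F2"
  shows "F1 \<in> bipolys" "F2 \<in> bipolys"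
    and "x \<in> X \<Longrightarrow> y \<in> X \<Longrightarrow> F1 (x, y) = dX (\<lambda>x. F (x, y)) x"
    and "x \<in> X \<Longrightarrow> y \<in> X \<Longrightarrow> F2 (x, y) = dX (\<lambda>y. F (x, y)) y"
    and "p \<in> Aut_inf X \<Longrightarrow> has_total_deriv X lam (\<lambda>p. F (endpoints p)) p
        (F1 (endpoints p) + p (Der 1) * F2 (endpoints p))"
  using assms unfolding partial_derivs_def by simp_all

lemma ex_partial_derivs:
  assumes "F \<in> bipolys"
  shows "\<exists>F1 F2. partial_derivs F F1 F2"
  using assms
proof (induction rule: bipolys_induct)
  case (fst i)
  have p: "(\<lambda>x. x i) \<in> polys" by (rule polys_intros)
  have "partial_derivs (\<lambda>q. fst q i) (\<lambda>q. dX (\<lambda>x. x i) (fst q)) (\<lambda>q. 0)"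
    by (rule partial_derivsI)
      (use has_total_deriv_src_dX[OF p] bipolys_fst[OF dX_in[OF p]] in
        \<open>simp_all add: endpoints_def D_const bipolys_intros(1)\<close>)
  then show ?case by blast
next
  case (snd i)
  have p: "(\<lambda>x. x i) \<in> polys" by (rule polys_intros)
  have "partial_derivs (\<lambda>q. snd q i) (\<lambda>q. 0) (\<lambda>q. dX (\<lambda>x. x i) (snd q))"
    by (rule partial_derivsI)
      (use has_total_deriv_tgt_dX[OF p] bipolys_snd[OF dX_in[OF p]] in
        \<open>simp_all add: endpoints_def D_const bipolys_intros(1)\<close>)
  then show ?case by blast
next
  case (const c)
  have "partial_derivs (\<lambda>q. c) (\<lambda>q. 0) (\<lambda>q. 0)"
    by (rule partial_derivsI) (simp_all add: D_const bipolys_intros(1) has_total_deriv_const)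
  then show ?case by blast
next
  case (add F G)
  then obtain F1 F2 G1 G2 where *: "partial_derivs F F1 F2" "partial_derivs G G1 G2" by blast
  note F = partial_derivsD[OF *(1)] and G = partial_derivsD[OF *(2)]
  have "partial_derivs (\<lambda>q. F q + G q) (\<lambda>q. F1 q + G1 q) (\<lambda>q. F2 q + G2 q)"
  proof (rule partial_derivsI)
    fix p assume p: "p \<in> Aut_inf X"
    show "has_total_deriv X lam (\<lambda>p. F (endpoints p) + G (endpoints p)) p
      (F1 (endpoints p) + G1 (endpoints p) + p (Der 1) * (F2 (endpoints p) + G2 (endpoints p)))"
      by (rule has_total_deriv_eq[OF has_total_deriv_add[OF F(5)[OF p] G(5)[OF p]]]) (simp add: algebra_simps)
  qed (use F(1-4) G(1-4) add.hyps in \<open>simp_all add: bipolys_intros(2) bipolys_slice D_add\<close>)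
  then show ?case by blast
next
  case (mult F G)
  then obtain F1 F2 G1 G2 where *: "partial_derivs F F1 F2" "partial_derivs G G1 G2" by blast
  note F = partial_derivsD[OF *(1)] and G = partial_derivsD[OF *(2)]
  have "partial_derivs (\<lambda>q. F q * G q) (\<lambda>q. F1 q * G q + F q * G1 q) (\<lambda>q. F2 q * G q + F q * G2 q)"
  proof (rule partial_derivsI)
    fix p assume p: "p \<in> Aut_inf X"
    show "has_total_deriv X lam (\<lambda>p. F (endpoints p) * G (endpoints p)) p
      (F1 (endpoints p) * G (endpoints p) + F (endpoints p) * G1 (endpoints p)
        + p (Der 1) * (F2 (endpoints p) * G (endpoints p) + F (endpoints p) * G2 (endpoints p)))"
      by (rule has_total_deriv_eq[OF has_total_deriv_mult[OF F(5)[OF p] G(5)[OF p]]]) (simp add: algebra_simps)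
  qed (use F(1-4) G(1-4) mult.hyps in \<open>simp_all add: bipolys_intros(2,3) bipolys_slice D_mult\<close>)
  then show ?case by blast
qed

definition dS :: "'n bifun \<Rightarrow> 'n bifun"
  where "dS F = fst (SOME D. partial_derivs F (fst D) (snd D))"

definition dT :: "'n bifun \<Rightarrow> 'n bifun"
  where "dT F = snd (SOME D. partial_derivs F (fst D) (snd D))"

lemma partial_derivs: "F \<in> bipolys \<Longrightarrow> partial_derivs F (dS F) (dT F)"
  unfolding dS_def dT_def using ex_partial_derivs[of F]
  by (intro someI_ex[of "\<lambda>D. partial_derivs F (fst D) (snd D)"]) auto

lemma dS: "F \<in> bipolys \<Longrightarrow> dS F \<in> bipolys"
    "F \<in> bipolys \<Longrightarrow> x \<in> X \<Longrightarrow> y \<in> X \<Longrightarrow> dS F (x, y) = dX (\<lambda>x. F (x, y)) x"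
  and dT: "F \<in> bipolys \<Longrightarrow> dT F \<in> bipolys"
    "F \<in> bipolys \<Longrightarrow> x \<in> X \<Longrightarrow> y \<in> X \<Longrightarrow> dT F (x, y) = dX (\<lambda>y. F (x, y)) y"
  and has_total_deriv_bipolys: "F \<in> bipolys \<Longrightarrow> p \<in> Aut_inf X \<Longrightarrow>
    has_total_deriv X lam (\<lambda>p. F (endpoints p)) p (dS F (endpoints p) + p (Der 1) * dT F (endpoints p))"
  using partial_derivsD[OF partial_derivs, of F] by simp_all

lemma dS_vanish: "F \<in> bipolys \<Longrightarrow> (\<And>q. q \<in> X \<times> X \<Longrightarrow> F q = 0) \<Longrightarrow> q \<in> X \<times> X \<Longrightarrow> dS F q = 0"
  using dS(2)[of F "fst q" "snd q"] D_cong[of "\<lambda>x. F (x, snd q)" "\<lambda>x. 0" "fst q"]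
    bipolys_slice(1)[of F "snd q"] polys_intros(2)[of 0] D_const[of "fst q" 0] by auto

lemma dT_vanish: "F \<in> bipolys \<Longrightarrow> (\<And>q. q \<in> X \<times> X \<Longrightarrow> F q = 0) \<Longrightarrow> q \<in> X \<times> X \<Longrightarrow> dT F q = 0"
  using dT(2)[of F "fst q" "snd q"] D_cong[of "\<lambda>y. F (fst q, y)" "\<lambda>x. 0" "snd q"]
    bipolys_slice(2)[of F "fst q"] polys_intros(2)[of 0] D_const[of "snd q" 0] by auto

text \<open>
  Apply \<open>D\<close> to every coefficient. For the derivatives below, \<open>D 0\<close> is known to vanish on \<open>X \<times> X\<close> only;
  the sum therefore stops at the least common bound of the degrees.
\<close>
definition polyfam_map ::
  "('n bifun \<Rightarrow> ('n \<Rightarrow> complex) \<times> ('n \<Rightarrow> complex) \<Rightarrow> complex)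
    \<Rightarrow> 'n bifam \<Rightarrow> 'n bifam"
  where "polyfam_map D F q =
    (\<Sum>i\<le>(LEAST N. \<forall>q. degree (F q) \<le> N). Polynomial.monom (D (\<lambda>q. coeff (F q) i) q) i)"

abbreviation "dSf \<equiv> polyfam_map dS"
abbreviation "dTf \<equiv> polyfam_map dT"

lemma polyfam_bound:
  assumes "F \<in> polyfam S"
  shows "degree (F q) \<le> (LEAST N. \<forall>q. degree (F q) \<le> N)"
  using assms LeastI_ex[of "\<lambda>N. \<forall>q. degree (F q) \<le> N"] by (auto simp: polyfam_def)

lemma polyfam_map_in:
  assumes "F \<in> polyfam bipolys" "\<And>F. F \<in> bipolys \<Longrightarrow> D F \<in> bipolys"
  shows "polyfam_map D F \<in> polyfam bipolys"
  unfolding polyfam_map_def[abs_def]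
  by (intro polyfam.sum bipolys.polyfam_monom assms(2) polyfam_coeff[OF assms(1)])

lemma coeff_polyfam_map:
  assumes F: "F \<in> polyfam bipolys" and q: "q \<in> X \<times> X"
    and D: "\<And>F. F \<in> bipolys \<Longrightarrow> (\<And>q. q \<in> X \<times> X \<Longrightarrow> F q = 0) \<Longrightarrow> D F q = 0"
  shows "coeff (polyfam_map D F q) i = D (\<lambda>q. coeff (F q) i) q"
proof -
  have "D (\<lambda>q. coeff (F q) i) q = 0" if "i > (LEAST N. \<forall>q. degree (F q) \<le> N)"
  proof (rule D[OF polyfam_coeff[OF F]])
    show "coeff (F q) i = 0" for q using polyfam_bound[OF F, of q] that by (intro coeff_eq_0) linarith
  qed
  then show ?thesis unfolding polyfam_map_def by (auto simp: coeff_sum coeff_monom not_le)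
qed

lemma dSf: "F \<in> polyfam bipolys \<Longrightarrow> dSf F \<in> polyfam bipolys"
    "F \<in> polyfam bipolys \<Longrightarrow> q \<in> X \<times> X \<Longrightarrow> coeff (dSf F q) i = dS (\<lambda>q. coeff (F q) i) q"
  and dTf: "F \<in> polyfam bipolys \<Longrightarrow> dTf F \<in> polyfam bipolys"
    "F \<in> polyfam bipolys \<Longrightarrow> q \<in> X \<times> X \<Longrightarrow> coeff (dTf F q) i = dT (\<lambda>q. coeff (F q) i) q"
  by (rule polyfam_map_in coeff_polyfam_map dS(1) dT(1) dS_vanish dT_vanish | assumption | blast)+

lemma has_total_deriv_polyfam:
  assumes F: "F \<in> polyfam bipolys" and p: "p \<in> Aut_inf X"
  shows "has_total_deriv X lam (\<lambda>p. poly (F (endpoints p)) (p (Der 1))) p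
      (poly (dSf F (endpoints p)) (p (Der 1)) + p (Der 1) * poly (dTf F (endpoints p)) (p (Der 1))
        + p (Der 2) * poly (pderiv (F (endpoints p))) (p (Der 1)))"
proof -
  define N where "N = (LEAST N. \<forall>q. degree (F q) \<le> N)"
  have N: "degree (F q) \<le> N" for q unfolding N_def by (rule polyfam_bound[OF F])
  have c: "(\<lambda>q. coeff (F q) i) \<in> bipolys" for i by (rule polyfam_coeff[OF F])
  have poly_D: "poly (polyfam_map D F q) a = (\<Sum>i\<le>N. D (\<lambda>q. coeff (F q) i) q * a ^ i)" for D q a
    unfolding polyfam_map_def N_def by (simp add: poly_sum poly_monom)
  have FN: "F q = (\<Sum>i\<le>N. Polynomial.monom (coeff (F q) i) i)" for q
    by (rule poly_as_sum_of_monoms'[OF N, symmetric])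
  have poly_F: "poly (F q) a = (\<Sum>i\<le>N. coeff (F q) i * a ^ i)" for q a
    by (subst FN) (simp add: poly_sum poly_monom)
  have poly_F': "poly (pderiv (F q)) a = (\<Sum>i\<le>N. coeff (F q) i * (of_nat i * a ^ (i - 1)))" for q a
    by (subst FN) (simp add: pderiv_sum pderiv_monom poly_sum poly_monom algebra_simps)
  have "has_total_deriv X lam (\<lambda>p. poly (F (endpoints p)) (p (Der 1))) p
    (\<Sum>i\<le>N. (dS (\<lambda>q. coeff (F q) i) (endpoints p) + p (Der 1) * dT (\<lambda>q. coeff (F q) i) (endpoints p)) * p (Der 1) ^ i
      + coeff (F (endpoints p)) i * (of_nat i * p (Der 1) ^ (i - 1) * p (Der (Suc 1))))"
    unfolding poly_F
    by (intro has_total_deriv_sum has_total_deriv_mult has_total_deriv_bipolys c p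
        has_total_deriv_power has_total_deriv_Der) simp
  then show ?thesis
    by (rule has_total_deriv_eq)
      (simp add: poly_D poly_F' sum.distrib sum_distrib_left algebra_simps numeral_2_eq_2)
qed

lemma jet_funs_polyfam:
  assumes F: "F \<in> polyfam bipolys" and k: "k \<ge> 1"
  shows "(\<lambda>p. poly (F (endpoints p)) (p (Der 1))) \<in> jet_funs k"
proof -
  obtain N where N: "\<And>q. degree (F q) \<le> N" using F by (auto simp: polyfam_def)
  have *: "poly (F q) a = (\<Sum>i\<le>N. coeff (F q) i * a ^ i)" for q a
    by (subst poly_as_sum_of_monoms'[OF N, symmetric]) (simp add: poly_sum poly_monom)
  show ?thesis unfolding *
    by (intro jet_funs_sum jet_funs_intros(3) jet_funs_power jet_funs_intros(4)
        bipolys_jet_funs[OF polyfam_coeff[OF F]]) (use k in auto)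
qed

end

section \<open>No equation of order 1: the degree argument at infinity\<close>

lemma coeff_mult_top:
  fixes p q :: "'a::comm_semiring_0 poly"
  assumes "degree p \<le> m" "degree q \<le> n"
  shows "coeff (p * q) (m + n) = coeff p m * coeff q n"
proof -
  have "coeff (p * q) (m + n) = (\<Sum>i\<le>m + n. coeff p i * coeff q (m + n - i))" by (rule coeff_mult)
  also have "\<dots> = (\<Sum>i\<in>{m}. coeff p i * coeff q (m + n - i))"
  proof (rule sum.mono_neutral_right)
    show "\<forall>i\<in>{..m + n} - {m}. coeff p i * coeff q (m + n - i) = 0"
    proof
      fix i assume "i \<in> {..m + n} - {m}"
      then have "i > m \<or> m + n - i > n" by auto
      then show "coeff p i * coeff q (m + n - i) = 0"
        using assms by (auto simp: coeff_eq_0)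
    qed
  qed auto
  finally show ?thesis by simp
qed

text \<open>
  The bookkeeping for the derivation in the coordinates \<open>a\<close> and \<open>u\<close>: on the left the coefficients of
  the powers of \<open>u\<close> in the reduced derivative, on the right the product rule applied to \<open>\<Sum>g j u^j\<close>.
  Here \<open>s\<close>, \<open>t\<close> and \<open>h\<close> stand for the derivatives of the coefficients with respect to the source, the
  target and \<open>a\<close>, and \<open>r\<close> and \<open>r'\<close> for the values of \<open>R\<close> at source and target.
\<close>
lemma sum_shift_identity:
  fixes g s t h :: "nat \<Rightarrow> complex"
  defines "prev \<equiv> \<lambda>g j. case j of 0 \<Rightarrow> 0 | Suc i \<Rightarrow> g i"
  assumes g: "\<And>j. j > d \<Longrightarrow> g j = 0" and st: "s (Suc d) = 0" "t (Suc d) = 0"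
  shows "(\<Sum>j\<le>Suc d. (a * s j + a\<^sup>2 * (t j + 2 * (a * prev h j) - (of_nat j - 1) * prev g j
          - r' / 2 * of_nat (Suc j) * g (Suc j)) + r / 2 * of_nat (Suc j) * g (Suc j)) * u ^ j)
    = (\<Sum>j\<le>d. a * (s j + a * t j + 2 * a\<^sup>2 * u * h j) * u ^ j
          + g j * (of_nat j * u ^ (j - 1)) * (r / 2 - a\<^sup>2 * u\<^sup>2 - r' * a\<^sup>2 / 2))"
proof -
  have S1: "(\<Sum>j\<le>Suc d. prev h j * u ^ j) = u * (\<Sum>j\<le>d. h j * u ^ j)"
    unfolding sum.atMost_Suc_shift prev_def by (simp add: sum_distrib_left algebra_simps)
  have S2: "(\<Sum>j\<le>Suc d. (of_nat j - 1) * prev g j * u ^ j) = u\<^sup>2 * (\<Sum>j\<le>d. g j * (of_nat j * u ^ (j - 1)))"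
  proof -
    have e: "of_nat j * g j * u ^ Suc j = u\<^sup>2 * (g j * (of_nat j * u ^ (j - 1)))" for j
      by (cases j) (simp_all add: power2_eq_square)
    have "(\<Sum>j\<le>Suc d. (of_nat j - 1) * prev g j * u ^ j) = (\<Sum>j\<le>d. of_nat j * g j * u ^ Suc j)"
      unfolding sum.atMost_Suc_shift prev_def by simp
    also have "\<dots> = u\<^sup>2 * (\<Sum>j\<le>d. g j * (of_nat j * u ^ (j - 1)))"
      unfolding sum_distrib_left by (rule sum.cong[OF refl]) (rule e)
    finally show ?thesis .
  qed
  have S3: "(\<Sum>j\<le>Suc d. of_nat (Suc j) * g (Suc j) * u ^ j) = (\<Sum>j\<le>d. g j * (of_nat j * u ^ (j - 1)))"
  proof -
    have "(\<Sum>j\<le>Suc (Suc d). g j * (of_nat j * u ^ (j - 1))) = (\<Sum>j\<le>Suc d. of_nat (Suc j) * g (Suc j) * u ^ j)"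
      unfolding sum.atMost_Suc_shift by (simp add: algebra_simps)
    then show ?thesis using g by simp
  qed
  have st': "(\<Sum>j\<le>Suc d. s j * u ^ j) = (\<Sum>j\<le>d. s j * u ^ j)" "(\<Sum>j\<le>Suc d. t j * u ^ j) = (\<Sum>j\<le>d. t j * u ^ j)"
    using st by simp_all
  have "(\<Sum>j\<le>Suc d. (a * s j + a\<^sup>2 * (t j + 2 * (a * prev h j) - (of_nat j - 1) * prev g j
          - r' / 2 * of_nat (Suc j) * g (Suc j)) + r / 2 * of_nat (Suc j) * g (Suc j)) * u ^ j)
    = a * (\<Sum>j\<le>Suc d. s j * u ^ j) + a\<^sup>2 * (\<Sum>j\<le>Suc d. t j * u ^ j)
      + 2 * a ^ 3 * (\<Sum>j\<le>Suc d. prev h j * u ^ j) - a\<^sup>2 * (\<Sum>j\<le>Suc d. (of_nat j - 1) * prev g j * u ^ j)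
      + (r / 2 - a\<^sup>2 * r' / 2) * (\<Sum>j\<le>Suc d. of_nat (Suc j) * g (Suc j) * u ^ j)"
    unfolding sum_distrib_left sum.distrib[symmetric] sum_subtractf[symmetric]
    by (rule sum.cong) (simp_all add: algebra_simps add_divide_distrib diff_divide_distrib power2_eq_square power3_eq_cube)
  also have "\<dots> = (\<Sum>j\<le>d. a * (s j + a * t j + 2 * a\<^sup>2 * u * h j) * u ^ j
          + g j * (of_nat j * u ^ (j - 1)) * (r / 2 - a\<^sup>2 * u\<^sup>2 - r' * a\<^sup>2 / 2))"
    unfolding st' S1 S2 S3
    unfolding sum_distrib_left sum.distrib[symmetric] sum_subtractf[symmetric]
    by (rule sum.cong) (simp_all add: algebra_simps add_divide_distrib diff_divide_distrib power2_eq_square power3_eq_cube)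
  finally show ?thesis .
qed

context kummer_subideal
begin

lemma ucoord_alt: "ucoord = (\<lambda>p. (1/2) * (p (Der 2) * inverse (p (Der 1)) ^ 2))"
  by (simp add: fun_eq_iff ucoord_def divide_simps)

lemma ucoord_in: "ucoord \<in> jet_funs 2"
  unfolding ucoord_alt by (intro jet_funs_intros(3) jet_funs_power jet_funs_intros(1) jet_funs_intros(4,5)) auto

lemma has_total_deriv_ucoord:
  assumes p: "p \<in> Aut_inf X"
  shows "has_total_deriv X lam ucoord p (kummer_fun R p / (2 * p (Der 1)) - p (Der 1) * ucoord p ^ 2
    + R (src p) / (2 * p (Der 1)) - R (tgt p) * p (Der 1) / 2)"
proof -
  have nz: "p (Der 1) \<noteq> 0" using p by (rule Aut_inf_Der1)
  have 1: "has_total_deriv X lam (\<lambda>p. p (Der 1)) p (p (Der 2))"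
    "has_total_deriv X lam (\<lambda>p. p (Der 2)) p (p (Der 3))"
    using has_total_deriv_Der[of 1 X lam p] has_total_deriv_Der[of 2 X lam p]
    by (simp_all add: numeral_2_eq_2 numeral_3_eq_3)
  have 2: "has_total_deriv X lam ucoord p ((1/2) * (p (Der 3) * inverse (p (Der 1)) ^ 2
      + p (Der 2) * (of_nat 2 * inverse (p (Der 1)) ^ (2 - 1) * (- p (Der 2) * inverse (p (Der 1)) ^ 2))))"
    unfolding ucoord_alt
    by (intro has_total_deriv_cmult has_total_deriv_mult has_total_deriv_power has_total_deriv_inverse 1 nz)
  have 3: "p (Der 3) = p (Der 1) * (kummer_fun R p + 3/2 * (p (Der 2) / p (Der 1)) ^ 2
      + R (src p) - R (tgt p) * p (Der 1) ^ 2)"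
    using nz by (simp add: kummer_fun_def schwarzian_def)
  have 4: "(1/2) * ((a * (k + 3/2 * (b / a) ^ 2 + r - r' * a ^ 2)) * inverse a ^ 2
      + b * (of_nat 2 * inverse a ^ (2 - 1) * (- b * inverse a ^ 2)))
    = k / (2 * a) - a * (b / (2 * a ^ 2)) ^ 2 + r / (2 * a) - r' * a / 2" if "a \<noteq> 0" for a b k r r' :: complex
    using that by (simp add: field_simps power2_eq_square)
  show ?thesis
    by (rule has_total_deriv_eq[OF 2]) (unfold 3 ucoord_def, rule 4[OF nz])
qed

definition uval :: "nat \<Rightarrow> (nat \<Rightarrow> ('n \<Rightarrow> complex) \<times> ('n \<Rightarrow> complex) \<Rightarrow> complex poly) \<Rightarrow> 'n jet \<Rightarrow> complex" where
  "uval d G p = (\<Sum>j\<le>d. poly (G j (endpoints p)) (p (Der 1)) * ucoord p ^ j)"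

definition shift_family :: "(nat \<Rightarrow> ('n \<Rightarrow> complex) \<times> ('n \<Rightarrow> complex) \<Rightarrow> complex poly) \<Rightarrow>
    nat \<Rightarrow> 'n bifam" where
  "shift_family G j = (case j of 0 \<Rightarrow> (\<lambda>q. 0) | Suc i \<Rightarrow> G i)"

text \<open>
  The coefficient of \<open>u^j\<close> in \<open>a\<close> times the derivative of \<open>\<Sum>G j u^j\<close>, after elimination of the third
  derivative through the Kummer equation. Only the terms with the factor \<open>a\<^sup>2\<close> reach the highest
  degree in \<open>a\<close>; together they are the Riccati vector field at the target, up to the term
  \<open>2 a u \<partial>/\<partial>a\<close>.
\<close>
definition reduced_deriv where
  "reduced_deriv G j q = pCons 0 (dSf (G j) q)
    + Polynomial.monom 1 2 * (dTf (G j) q + Polynomial.smult 2 (pCons 0 (pderiv (shift_family G j q)))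
      - Polynomial.smult (of_nat j - 1) (shift_family G j q) - Polynomial.smult (R (snd q) / 2 * of_nat (Suc j)) (G (Suc j) q))
    + Polynomial.smult (R (fst q) / 2 * of_nat (Suc j)) (G (Suc j) q)"

lemma uval_in: "(\<And>j. G j \<in> polyfam bipolys) \<Longrightarrow> uval d G \<in> jet_funs 2"
  unfolding uval_def[abs_def]
  by (intro jet_funs_sum jet_funs_intros(3) jet_funs_power ucoord_in jet_funs_polyfam) auto

lemma Reg_polyfam: "F \<in> polyfam bipolys \<Longrightarrow> Reg (\<lambda>p. poly (F (endpoints p)) (p (Der 1)))"
  by (rule Reg_jet_funs[OF jet_funs_polyfam, of _ 1]) auto

lemma shift_family_in: "(\<And>j. G j \<in> polyfam bipolys) \<Longrightarrow> shift_family G j \<in> polyfam bipolys"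
  by (auto simp: shift_family_def polyfam.zero split: nat.split)

lemma pderiv_in:
  assumes "F \<in> polyfam bipolys"
  shows "(\<lambda>q. pCons 0 (pderiv (F q))) \<in> polyfam bipolys"
proof -
  obtain N where N: "\<And>q. degree (F q) \<le> N" using assms by (auto simp: polyfam_def)
  have "degree (pderiv (F q)) \<le> N" for q
    using N[of q] degree_pderiv[of "F q"] by linarith
  moreover have "(\<lambda>q. coeff (pderiv (F q)) i) \<in> bipolys" for i
    using bipolys_intros(3)[OF bipolys_intros(1) polyfam_coeff[OF assms, of "Suc i"]]
    by (simp add: coeff_pderiv)
  ultimately have "(\<lambda>q. pderiv (F q)) \<in> polyfam bipolys" by (auto simp: polyfam_def)
  then show ?thesis by (intro bipolys.polyfam_pCons bipolys_intros(1))
qed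

lemma reduced_deriv_in:
  assumes G: "\<And>j. G j \<in> polyfam bipolys"
  shows "reduced_deriv G j \<in> polyfam bipolys"
proof -
  have R1: "(\<lambda>q. R (fst q) / 2 * of_nat (Suc j)) \<in> bipolys" "(\<lambda>q. R (snd q) / 2 * of_nat (Suc j)) \<in> bipolys"
    using bipolys_intros(3)[OF bipolys_fst[OF R] bipolys_intros(1)[of "of_nat (Suc j) / 2"]]
      bipolys_intros(3)[OF bipolys_snd[OF R] bipolys_intros(1)[of "of_nat (Suc j) / 2"]] by simp_all
  show ?thesis unfolding reduced_deriv_def[abs_def]
    by (intro polyfam.add polyfam.mult polyfam.diff bipolys.polyfam_pCons bipolys_intros(1)
        bipolys.polyfam_smult bipolys.polyfam_monom R1 dSf dTf shift_family_in pderiv_in G)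
qed

lemma dSf_vanish:
  assumes "F \<in> polyfam bipolys" "\<And>q. q \<in> X \<times> X \<Longrightarrow> F q = 0" "q \<in> X \<times> X"
  shows "dSf F q = 0" "dTf F q = 0"
  using assms dSf(2)[OF assms(1,3)] dTf(2)[OF assms(1,3)]
    dS_vanish[OF polyfam_coeff[OF assms(1)], of _ q] dT_vanish[OF polyfam_coeff[OF assms(1)], of _ q]
  by (auto simp: poly_eq_iff)

lemma Van_reduced_deriv:
  assumes G: "\<And>j. G j \<in> polyfam bipolys" and van: "\<And>j q. j > d \<Longrightarrow> G j q = 0" and V: "Van (uval d G)"
  shows "Van (uval (Suc d) (reduced_deriv G))"
proof -
  let ?E = "\<lambda>p. \<Sum>j\<le>d. poly (G j (endpoints p)) (p (Der 1)) * (of_nat j * ucoord p ^ (j - 1))"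
  let ?du = "\<lambda>p. kummer_fun R p / (2 * p (Der 1)) - p (Der 1) * ucoord p ^ 2
    + R (src p) / (2 * p (Der 1)) - R (tgt p) * p (Der 1) / 2"
  let ?D = "\<lambda>p. \<Sum>j\<le>d. (poly (dSf (G j) (endpoints p)) (p (Der 1)) + p (Der 1) * poly (dTf (G j) (endpoints p)) (p (Der 1))
        + p (Der 2) * poly (pderiv (G j (endpoints p))) (p (Der 1))) * ucoord p ^ j
        + poly (G j (endpoints p)) (p (Der 1)) * (of_nat j * ucoord p ^ (j - 1) * ?du p)"
  have D: "Van ?D"
  proof (rule Van_total_deriv[OF uval_in[of G, OF G] V])
    fix p assume p: "p \<in> Aut_inf X"
    show "has_total_deriv X lam (uval d G) p (?D p)"
      unfolding uval_def[abs_def]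
      by (intro has_total_deriv_sum has_total_deriv_mult has_total_deriv_polyfam G p
          has_total_deriv_power has_total_deriv_ucoord)
  qed
  have "?E \<in> jet_funs 2"
    by (intro jet_funs_sum jet_funs_intros(3) jet_funs_power ucoord_in jet_funs_polyfam G jet_funs_intros(1)) auto
  then have E: "Van (\<lambda>p. (1/2 * ?E p) * kummer_fun R p)"
    by (intro Van_mult Van_kummer Reg_mult Reg_const Reg_jet_funs)
  have a: "Reg (\<lambda>p. p (Der 1))" by (rule Reg_jet_funs[OF jet_funs_intros(4)[of 1 1]]) auto
  have "Van (\<lambda>p. p (Der 1) * ?D p - (1/2 * ?E p) * kummer_fun R p)"
    by (rule Van_diff[OF Van_mult[OF a D] E])
  then show ?thesis
  proof (rule Van_cong)
    fix p assume p: "p \<in> Aut_inf X"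
    define a u k where "a = p (Der 1)" and "u = ucoord p" and "k = kummer_fun R p"
    define g s t h where "g j = poly (G j (endpoints p)) a" and "s j = poly (dSf (G j) (endpoints p)) a"
      and "t j = poly (dTf (G j) (endpoints p)) a" and "h j = poly (pderiv (G j (endpoints p))) a" for j
    have a: "a \<noteq> 0" using Aut_inf_Der1[OF p] by (simp add: a_def)
    have b: "p (Der 2) = 2 * a ^ 2 * u" using a by (simp add: u_def ucoord_def a_def)
    have g0: "g j = 0" if "j > d" for j using van[OF that] by (simp add: g_def)
    have st0: "s (Suc d) = 0" "t (Suc d) = 0"
      using dSf_vanish[OF G, of "Suc d" "endpoints p"] van endpoints_in[OF p] by (simp_all add: s_def t_def)
    have prev: "poly (shift_family G j (endpoints p)) a = (case j of 0 \<Rightarrow> 0 | Suc i \<Rightarrow> g i)"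
      "poly (pderiv (shift_family G j (endpoints p))) a = (case j of 0 \<Rightarrow> 0 | Suc i \<Rightarrow> h i)" for j
      by (auto simp: shift_family_def g_def h_def split: nat.split)
    have "uval (Suc d) (reduced_deriv G) p = (\<Sum>j\<le>Suc d. (a * s j + a\<^sup>2 * (t j + 2 * (a * (case j of 0 \<Rightarrow> 0 | Suc i \<Rightarrow> h i))
          - (of_nat j - 1) * (case j of 0 \<Rightarrow> 0 | Suc i \<Rightarrow> g i)
          - R (tgt p) / 2 * of_nat (Suc j) * g (Suc j)) + R (src p) / 2 * of_nat (Suc j) * g (Suc j)) * u ^ j)"
      unfolding uval_def reduced_deriv_def a_def[symmetric] u_def[symmetric]
      by (rule sum.cong[OF refl])
        (simp add: prev poly_monom g_def[symmetric] s_def[symmetric] t_def[symmetric], simp add: endpoints_def)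
    also have "\<dots> = (\<Sum>j\<le>d. a * (s j + a * t j + 2 * a\<^sup>2 * u * h j) * u ^ j
          + g j * (of_nat j * u ^ (j - 1)) * (R (src p) / 2 - a\<^sup>2 * u\<^sup>2 - R (tgt p) * a\<^sup>2 / 2))"
      by (rule sum_shift_identity[where g = g and s = s and t = t and h = h and d = d]) (use g0 st0 in auto)
    also have "\<dots> = p (Der 1) * ?D p - (1/2 * ?E p) * kummer_fun R p"
      unfolding a_def[symmetric] u_def[symmetric] k_def[symmetric] b
        g_def[symmetric] s_def[symmetric] t_def[symmetric] h_def[symmetric]
      unfolding sum_distrib_left sum_distrib_right sum_subtractf[symmetric]
      by (rule sum.cong[OF refl]) (use a in \<open>simp add: field_simps power2_eq_square\<close>)
    finally show "p (Der 1) * ?D p - (1/2 * ?E p) * kummer_fun R p = uval (Suc d) (reduced_deriv G) p" by simp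
  qed
qed

text \<open>
  Derivation of the coefficients does not raise the degree in \<open>a\<close>, because a coefficient that
  vanishes on \<open>X \<times> X\<close> has vanishing derivatives there.
\<close>
lemma degree_reduced_deriv:
  assumes G: "\<And>j. G j \<in> polyfam bipolys" and N: "\<And>j q. q \<in> X \<times> X \<Longrightarrow> degree (G j q) \<le> N" and q: "q \<in> X \<times> X"
  shows "degree (reduced_deriv G j q) \<le> N + 2"
    and "coeff (reduced_deriv G j q) (N + 2) = dT (\<lambda>q. coeff (G j q) N) q + 2 * of_nat N * coeff (shift_family G j q) N
      - (of_nat j - 1) * coeff (shift_family G j q) N - R (snd q) / 2 * of_nat (Suc j) * coeff (G (Suc j) q) N"
proof -
  have van: "coeff (G j q) i = 0" if "i > N" "q \<in> X \<times> X" for i j q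
    using N[OF that(2), of j] that(1) by (intro coeff_eq_0) simp
  have S: "coeff (dSf (G j) q) i = 0" if "i > N" for i
    unfolding dSf(2)[OF G q] by (rule dS_vanish[OF polyfam_coeff[OF G] _ q]) (use van that in auto)
  have T: "coeff (dTf (G j) q) i = 0" if "i > N" for i
    unfolding dTf(2)[OF G q] by (rule dT_vanish[OF polyfam_coeff[OF G] _ q]) (use van that in auto)
  have P: "coeff (shift_family G j q) i = 0" if "i > N" for i
    using van[OF that q] by (auto simp: shift_family_def split: nat.split)
  have \<theta>: "coeff (pCons 0 (pderiv (shift_family G j q))) i = of_nat i * coeff (shift_family G j q) i" for i
    by (cases i) (simp_all add: coeff_pderiv)
  have shift: "coeff (Polynomial.monom 1 2 * p) (Suc (Suc i)) = coeff p i" for p :: "complex poly" and i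
    using coeff_monom_mult[of 1 2 p "Suc (Suc i)"] by simp
  have *: "coeff (reduced_deriv G j q) (Suc (Suc i)) = coeff (dSf (G j) q) (Suc i) + (coeff (dTf (G j) q) i
      + 2 * (of_nat i * coeff (shift_family G j q) i) - (of_nat j - 1) * coeff (shift_family G j q) i
      - R (snd q) / 2 * of_nat (Suc j) * coeff (G (Suc j) q) i)
      + R (fst q) / 2 * of_nat (Suc j) * coeff (G (Suc j) q) (Suc (Suc i))" for i
    unfolding reduced_deriv_def coeff_add shift coeff_diff coeff_smult \<theta> by simp
  show "degree (reduced_deriv G j q) \<le> N + 2"
  proof (rule degree_le, intro allI impI)
    fix i assume "i > N + 2"
    then obtain i' where "i = Suc (Suc i')" "i' > N" by (metis add_2_eq_Suc' less_Suc_eq_0_disj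
      Suc_less_eq not_less_zero old.nat.exhaust)
    then show "coeff (reduced_deriv G j q) i = 0"
      using S[of "Suc i'"] T[of i'] P[of i'] van[OF _ q, of i'] van[OF _ q, of i] by (simp add: *)
  qed
  show "coeff (reduced_deriv G j q) (N + 2) = dT (\<lambda>q. coeff (G j q) N) q + 2 * of_nat N * coeff (shift_family G j q) N
      - (of_nat j - 1) * coeff (shift_family G j q) N - R (snd q) / 2 * of_nat (Suc j) * coeff (G (Suc j) q) N"
    using S[of "Suc N"] van[OF _ q, of "Suc (Suc N)"] by (simp add: * dTf(2)[OF G q])
qed

text \<open>
  For the coefficient of \<open>u^(d + 1)\<close> only the leading coefficient \<open>G d\<close> contributes, through
  \<open>2 a u \<partial>/\<partial>a\<close> and \<open>- u\<^sup>2 \<partial>/\<partial>u\<close>; this is the origin of the factor \<open>2 n - d\<close>.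
\<close>
lemma degree_reduced_deriv_top:
  assumes G: "\<And>j. G j \<in> polyfam bipolys" and van: "\<And>j q. j > d \<Longrightarrow> G j q = 0"
    and n: "degree (G d q) \<le> n" and q: "q \<in> X \<times> X"
  shows "degree (reduced_deriv G (Suc d) q) \<le> n + 2"
    and "coeff (reduced_deriv G (Suc d) q) (n + 2) = (2 * of_nat n - of_nat d) * coeff (G d q) n"
    and "j > Suc d \<Longrightarrow> reduced_deriv G j q = 0"
proof -
  have z: "dSf (G j) q = 0" "dTf (G j) q = 0" if "j > d" for j
    using dSf_vanish[OF G, of j q] van[OF that] q by auto
  show "reduced_deriv G j q = 0" if "j > Suc d"
    using that z[of j] van by (cases j) (auto simp: reduced_deriv_def shift_family_def)
  have eq: "reduced_deriv G (Suc d) q = Polynomial.monom 1 2 * (Polynomial.smult 2 (pCons 0 (pderiv (G d q)))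
      - Polynomial.smult (of_nat d) (G d q))"
    using z[of "Suc d"] van by (simp add: reduced_deriv_def shift_family_def)
  have \<theta>: "coeff (pCons 0 (pderiv (G d q))) i = of_nat i * coeff (G d q) i" for i
    by (cases i) (simp_all add: coeff_pderiv)
  have shift: "coeff (Polynomial.monom 1 2 * p) (Suc (Suc i)) = coeff p i" for p :: "complex poly" and i
    using coeff_monom_mult[of 1 2 p "Suc (Suc i)"] by simp
  have *: "coeff (reduced_deriv G (Suc d) q) (Suc (Suc i)) = (2 * of_nat i - of_nat d) * coeff (G d q) i" for i
    unfolding eq shift coeff_diff coeff_smult \<theta> by (simp add: algebra_simps)
  show "coeff (reduced_deriv G (Suc d) q) (n + 2) = (2 * of_nat n - of_nat d) * coeff (G d q) n"
    using *[of n] by simp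
  show "degree (reduced_deriv G (Suc d) q) \<le> n + 2"
  proof (rule degree_le, intro allI impI)
    fix i assume "i > n + 2"
    then obtain i' where "i = Suc (Suc i')" "i' > n"
      by (metis add_2_eq_Suc' less_Suc_eq_0_disj Suc_less_eq not_less_zero old.nat.exhaust)
    then show "coeff (reduced_deriv G (Suc d) q) i = 0"
      using n by (simp add: * coeff_eq_0)
  qed
qed

lemma uval_mult: "poly (c (endpoints p)) (p (Der 1)) * uval d G p = uval d (\<lambda>j q. c q * G j q) p"
  by (simp add: uval_def sum_distrib_left algebra_simps)

lemma uval_diff: "uval d G p - uval d G' p = uval d (\<lambda>j q. G j q - G' j q) p"
  by (simp add: uval_def sum_subtractf algebra_simps)

lemma uval_prevf: "ucoord p * uval d G p = uval (Suc d) (shift_family G) p"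
  unfolding uval_def sum.atMost_Suc_shift by (simp add: shift_family_def sum_distrib_left algebra_simps)

lemma uval_Suc_vanish: "(\<And>q. G (Suc d) q = 0) \<Longrightarrow> uval (Suc d) G p = uval d G p"
  by (simp add: uval_def)

text \<open>
  An element of \<open>H\<close> of least degree \<open>d + 1\<close> in \<open>u\<close> divides its derivative. The derivative has degree
  \<open>d + 2\<close>, so that two steps of pseudo-division suffice; the remainder \<open>U\<close> lies in \<open>H\<close> and has smaller
  degree. The quotient is \<open>c reduced_deriv(d + 2) u + T\<close>.
\<close>
lemma pseudo_division:
  assumes G: "\<And>j. G j \<in> polyfam bipolys" and van: "\<And>j q. j > Suc d \<Longrightarrow> G j q = 0"
    and V: "Van (uval (Suc d) G)"
    and min: "\<And>U. (\<And>j. U j \<in> polyfam bipolys) \<Longrightarrow> Van (uval d U) \<Longrightarrow> (\<forall>j\<le>d. \<forall>q\<in>X \<times> X. U j q = 0)"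
    and q: "q \<in> X \<times> X"
  defines "c \<equiv> G (Suc d)"
  defines "T \<equiv> \<lambda>q. c q * reduced_deriv G (Suc d) q - reduced_deriv G (Suc (Suc d)) q * G d q"
  shows "c q * (c q * reduced_deriv G j q) = c q * reduced_deriv G (Suc (Suc d)) q * shift_family G j q + T q * G j q"
proof -
  define S where "S j q = c q * reduced_deriv G j q - reduced_deriv G (Suc (Suc d)) q * shift_family G j q" for j q
  define U where "U j q = c q * S j q - T q * G j q" for j q
  have red: "reduced_deriv G j \<in> polyfam bipolys" for j by (rule reduced_deriv_in[OF G])
  have c: "c \<in> polyfam bipolys" unfolding c_def by (rule G)
  have T: "T \<in> polyfam bipolys" unfolding T_def by (intro polyfam.diff polyfam.mult c red G)
  have S: "S j \<in> polyfam bipolys" for j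
    unfolding S_def[abs_def] by (intro polyfam.diff polyfam.mult c red shift_family_in G)
  have U: "U j \<in> polyfam bipolys" for j
    unfolding U_def[abs_def] by (intro polyfam.diff polyfam.mult c S T G)
  have u: "Reg ucoord" by (rule Reg_jet_funs[OF ucoord_in])
  have "Van (uval (Suc (Suc d)) (reduced_deriv G))" by (rule Van_reduced_deriv[OF G van V])
  then have "Van (\<lambda>p. poly (c (endpoints p)) (p (Der 1)) * uval (Suc (Suc d)) (reduced_deriv G) p
      - poly (reduced_deriv G (Suc (Suc d)) (endpoints p)) (p (Der 1)) * (ucoord p * uval (Suc d) G p))"
    by (intro Van_diff Van_mult Reg_polyfam c red u V)
  then have "Van (uval (Suc (Suc d)) S)"
    unfolding uval_mult uval_prevf uval_diff S_def[abs_def] .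
  then have "Van (uval (Suc d) S)"
    by (rule Van_cong) (rule uval_Suc_vanish, simp add: S_def shift_family_def c_def)
  then have "Van (\<lambda>p. poly (c (endpoints p)) (p (Der 1)) * uval (Suc d) S p
      - poly (T (endpoints p)) (p (Der 1)) * uval (Suc d) G p)"
    by (intro Van_diff Van_mult Reg_polyfam c T V)
  then have "Van (uval (Suc d) U)"
    unfolding uval_mult uval_prevf uval_diff U_def[abs_def] .
  then have "Van (uval d U)"
    by (rule Van_cong) (rule uval_Suc_vanish, simp add: U_def S_def T_def shift_family_def c_def)
  then have U0: "U j q = 0" if "j \<le> d" for j
    using min[of U] U that q by blast
  consider "j \<le> d" | "j = Suc d" | "j = Suc (Suc d)" | "j > Suc (Suc d)" by linarith
  then have "U j q = 0"
  proof cases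
    case 4
    then show ?thesis
      using degree_reduced_deriv_top(3)[of G "Suc d" q _ j, OF G van order_refl q] van
      by (cases j) (simp_all add: U_def S_def shift_family_def)
  qed (use U0 van in \<open>simp_all add: U_def S_def T_def shift_family_def c_def\<close>)
  then show ?thesis by (simp add: U_def S_def algebra_simps)
qed

end

lemma ex_top_coeff:
  fixes p :: "'i \<Rightarrow> 'a::zero poly"
  assumes bound: "\<And>i. i \<in> I \<Longrightarrow> degree (p i) \<le> B" and i: "i \<in> I" "p i \<noteq> 0"
  obtains N j where "\<And>i. i \<in> I \<Longrightarrow> degree (p i) \<le> N" "j \<in> I" "coeff (p j) N \<noteq> 0"
proof -
  let ?I = "{i \<in> I. p i \<noteq> 0}"
  let ?S = "(\<lambda>i. degree (p i)) ` ?I"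
  have fin: "finite ?S" using bound by (intro finite_subset[of ?S "{..B}"]) auto
  have ne: "?S \<noteq> {}" using i by auto
  obtain j where j: "j \<in> ?I" "Max ?S = degree (p j)" using Max_in[OF fin ne] by auto
  show ?thesis
  proof (rule that)
    show "degree (p i) \<le> Max ?S" if "i \<in> I" for i
      using Max_ge[OF fin, of "degree (p i)"] that by (cases "p i = 0") auto
    show "j \<in> I" "coeff (p j) (Max ?S) \<noteq> 0" using j by auto
  qed
qed

context kummer_subideal
begin

lemma riccati_of_darboux:
  assumes "\<And>j. g j \<in> polys" "c \<in> polys" "l0 \<in> polys" "l1 \<in> polys"
    and "n > 0" "\<And>j x. x \<in> X \<Longrightarrow> j > n \<Longrightarrow> g j x = 0"
    and "x0 \<in> X" "g n x0 \<noteq> 0" "x1 \<in> X" "c x1 \<noteq> 0"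
    and "\<And>j x. x \<in> X \<Longrightarrow> c x * \<Delta> (\<lambda>x. 1 / 2 * R x) g j x = l1 x * shift g j x + l0 x * g j x"
  shows "\<exists>r\<in>carrier L. \<delta> r \<oplus>\<^bsub>L\<^esub> r \<otimes>\<^bsub>L\<^esub> r \<oplus>\<^bsub>L\<^esub> embed (\<lambda>x. 1 / 2 * R x) = \<zero>\<^bsub>L\<^esub>"
  by (rule closed_extension.darboux_imp_riccati[OF closed_extension_L, where g = g and c = c and n = n
        and ?l0.0 = l0 and ?l1.0 = l1 and ?x0.0 = x0 and ?x1.0 = x1])
    (rule assms cmult_in[OF R] | assumption)+

lemma uval_polyfam:
  assumes N: "\<And>q. degree (F q) \<le> N"
  shows "poly (poly (F (endpoints p)) [:ucoord p:]) (p (Der 1)) = uval N (\<lambda>j q. coeff (F q) j) p"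
proof -
  have "poly (F (endpoints p)) [:ucoord p:] = (\<Sum>j\<le>N. coeff (F (endpoints p)) j * [:ucoord p:] ^ j)"
    by (subst poly_as_sum_of_monoms'[OF N, symmetric]) (simp add: poly_sum poly_monom)
  then show ?thesis by (simp add: uval_def poly_sum)
qed

text \<open>
  Let \<open>N\<close> and \<open>n\<close> be the degrees in \<open>a\<close> of an element \<open>G\<close> of least degree in \<open>u\<close> and of its leading
  coefficient \<open>c\<close>. The coefficients of \<open>a^(2 n + N + 2)\<close> in \<open>pseudo_division\<close> say that the leading
  form \<open>g\<close> of \<open>G\<close>, in the degree \<open>N\<close>, is a Darboux polynomial for the derivation at the target; the
  source \<open>x0\<close> is a parameter, chosen so that nothing degenerates. If \<open>g\<close> were constant in \<open>u\<close>, its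
  coefficient identity for \<open>u\<close> would read \<open>2 N = 2 n - deg G\<close>, contrary to \<open>n \<le> N\<close>.
\<close>
lemma generic_case:
  assumes no1: "\<And>F q. F \<in> polyfam bipolys \<Longrightarrow> Van (\<lambda>p. poly (F (endpoints p)) (p (Der 1))) \<Longrightarrow>
      q \<in> X \<times> X \<Longrightarrow> F q = 0"
    and F: "F \<in> polyfam (polyfam bipolys)" "q0 \<in> X \<times> X" "F q0 \<noteq> 0"
      "Van (\<lambda>p. poly (poly (F (endpoints p)) [:ucoord p:]) (p (Der 1)))"
  shows "\<exists>r\<in>carrier L. \<delta> r \<oplus>\<^bsub>L\<^esub> r \<otimes>\<^bsub>L\<^esub> r \<oplus>\<^bsub>L\<^esub> embed (\<lambda>x. 1 / 2 * R x) = \<zero>\<^bsub>L\<^esub>"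
proof -
  \<comment> \<open>A nonzero element of \<open>H\<close> of least degree in \<open>u\<close>, which is positive by \<open>no1\<close>.\<close>
  define good where "good d \<longleftrightarrow> (\<exists>G. (\<forall>j. G j \<in> polyfam bipolys) \<and> Van (uval d G)
      \<and> (\<exists>j\<le>d. \<exists>q\<in>X \<times> X. G j q \<noteq> 0))" for d
  obtain M where M: "\<And>q. degree (F q) \<le> M" using F(1) by (auto simp: polyfam_def)
  have "good M"
    unfolding good_def
  proof (intro exI[of _ "\<lambda>j q. coeff (F q) j"] conjI allI)
    show "(\<lambda>q. coeff (F q) j) \<in> polyfam bipolys" for j by (rule polyfam_coeff[OF F(1)])
    show "Van (uval M (\<lambda>j q. coeff (F q) j))" using F(4) by (rule Van_cong) (rule uval_polyfam[OF M])
    have "coeff (F q0) (degree (F q0)) \<noteq> 0" using F(3) by simp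
    then show "\<exists>j\<le>M. \<exists>q\<in>X \<times> X. coeff (F q) j \<noteq> 0" using M F(2) by blast
  qed
  have "good (LEAST d. good d)" using \<open>good M\<close> by (rule LeastI)
  moreover have "\<not> good 0"
    using no1 by (auto simp: good_def uval_def[abs_def])
  ultimately obtain d where d: "good (Suc d)" "(LEAST d. good d) = Suc d"
    by (metis not0_implies_Suc)
  have "\<not> good d" using not_less_Least[of d good] d(2) by simp
  then have min: "\<forall>j\<le>d. \<forall>q\<in>X \<times> X. U j q = 0"
    if "\<And>j. U j \<in> polyfam bipolys" "Van (uval d U)" for U
    using that unfolding good_def by blast
  obtain G0 where G0: "\<And>j. G0 j \<in> polyfam bipolys" "Van (uval (Suc d) G0)"
      "\<exists>j\<le>Suc d. \<exists>q\<in>X \<times> X. G0 j q \<noteq> 0"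
    using d(1) unfolding good_def by blast
  define G where "G j = (if j \<le> Suc d then G0 j else (\<lambda>q. 0))" for j
  have G: "G j \<in> polyfam bipolys" for j by (simp add: G_def G0(1) polyfam.zero)
  have uG: "uval (Suc d) G = uval (Suc d) G0" by (simp add: uval_def fun_eq_iff G_def)
  have V: "Van (uval (Suc d) G)" using G0(2) by (simp add: uG)
  have van: "G j q = 0" if "j > Suc d" for j q using that by (simp add: G_def)
  define c where "c = G (Suc d)"
  have c: "c \<in> polyfam bipolys" unfolding c_def by (rule G)
  have "\<exists>q\<in>X \<times> X. c q \<noteq> 0"
  proof (rule ccontr)
    assume "\<not> ?thesis"
    then have c0: "c q = 0" if "q \<in> X \<times> X" for q using that by blast
    have "Van (uval d G)"
      by (rule Van_cong[OF V]) (use c0 endpoints_in in \<open>simp add: uval_def c_def\<close>)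
    then have "G j q = 0" if "j \<le> d" "q \<in> X \<times> X" for j q using min[of G, OF G] that by blast
    then have "G0 j q = 0" if "j \<le> Suc d" "q \<in> X \<times> X" for j q
      using c0[OF that(2)] that by (cases "j = Suc d") (auto simp: c_def G_def)
    then show False using G0(3) by blast
  qed
  then obtain qc where qc: "qc \<in> X \<times> X" "c qc \<noteq> 0" by blast
  have "\<exists>B. \<forall>q. degree (G j q) \<le> B" for j using G[of j] by (simp add: polyfam_def)
  then obtain b where b: "\<And>j q. degree (G j q) \<le> b j" by metis
  have B: "degree (G j q) \<le> (\<Sum>j\<le>Suc d. b j)" for j q
  proof (cases "j \<le> Suc d")
    case True
    then have "b j \<le> (\<Sum>j\<le>Suc d. b j)" by (intro member_le_sum) auto
    then show ?thesis using b[of j q] by linarith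
  qed (simp add: van)
  obtain N j1 where "\<And>i. i \<in> UNIV \<times> (X \<times> X) \<Longrightarrow> degree (case i of (j, q) \<Rightarrow> G j q) \<le> N"
      "j1 \<in> UNIV \<times> (X \<times> X)" "coeff (case j1 of (j, q) \<Rightarrow> G j q) N \<noteq> 0"
    by (rule ex_top_coeff[of "UNIV \<times> (X \<times> X)" "\<lambda>(j, q). G j q" "\<Sum>j\<le>Suc d. b j" "(Suc d, qc)"])
      (use B qc in \<open>auto simp: c_def\<close>)
  then obtain j0 q1 where N: "\<And>j q. q \<in> X \<times> X \<Longrightarrow> degree (G j q) \<le> N"
      and q1: "q1 \<in> X \<times> X" "coeff (G j0 q1) N \<noteq> 0"
    by (cases j1) fastforce
  obtain n q2 where n: "\<And>q. q \<in> X \<times> X \<Longrightarrow> degree (c q) \<le> n" and q2: "q2 \<in> X \<times> X" "coeff (c q2) n \<noteq> 0"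
    by (rule ex_top_coeff[of "X \<times> X" c "\<Sum>j\<le>Suc d. b j" qc]) (use B qc in \<open>auto simp: c_def\<close>)
  have "n \<le> N" using le_degree[OF q2(2)] N[OF q2(1), of "Suc d"] by (simp add: c_def)
  define T where "T q = c q * reduced_deriv G (Suc d) q - reduced_deriv G (Suc (Suc d)) q * G d q" for q
  have T: "T \<in> polyfam bipolys"
    unfolding T_def[abs_def] by (intro polyfam.diff polyfam.mult c reduced_deriv_in G)
  have bi: "(\<lambda>q. coeff (c q) n) \<in> bipolys" "(\<lambda>q. coeff (G j q) N) \<in> bipolys" "(\<lambda>q. coeff (T q) i) \<in> bipolys" for i j
    by (rule polyfam_coeff c G T)+
  obtain x0 y0 where xy0: "x0 \<in> X" "y0 \<in> X" "coeff (c (x0, y0)) n \<noteq> 0" "coeff (G j0 (x0, y0)) N \<noteq> 0"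
    using bipolys_no_zero_divisors[OF bi(1) bi(2)[of j0]] q1 q2 by (metis mem_Sigma_iff mult_eq_0_iff prod.collapse)
  define \<gamma> \<tau> where "\<gamma> y = coeff (c (x0, y)) n" and "\<tau> y = coeff (T (x0, y)) (n + (n + 2))" for y
  define g where "g j y = coeff (G j (x0, y)) N" for j y
  have g: "g j \<in> polys" for j unfolding g_def[abs_def] by (rule bipolys_slice(2)[OF bi(2)])
  have \<gamma>\<tau>: "\<gamma> \<in> polys" "\<tau> \<in> polys"
    unfolding \<gamma>_def[abs_def] \<tau>_def[abs_def] by (rule bipolys_slice(2)[OF bi(1)] bipolys_slice(2)[OF bi(3)])+
  define \<kappa> :: complex where "\<kappa> = 2 * of_nat n - of_nat (Suc d) - 2 * of_nat N"
  have "\<kappa> \<noteq> 0"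
  proof
    assume "\<kappa> = 0"
    then have "of_nat (2 * n) = (of_nat (Suc d + 2 * N) :: complex)" by (simp add: \<kappa>_def algebra_simps)
    then have "2 * n = Suc d + 2 * N" by (simp only: of_nat_eq_iff)
    with \<open>n \<le> N\<close> show False by simp
  qed
  \<comment> \<open>Where \<open>g j0\<close> vanishes, both sides do. Elsewhere the coefficient \<open>G j0\<close> attains the degree \<open>N\<close>, and
    this bounds the degree of \<open>T\<close>.\<close>
  have main: "(\<gamma> y * \<gamma> y * g j0 y) * \<Delta> (\<lambda>x. 1 / 2 * R x) g j y
      = (\<kappa> * (\<gamma> y * \<gamma> y * g j0 y)) * shift g j y + (\<tau> y * g j0 y) * g j y" if y: "y \<in> X" for j y
  proof (cases "g j0 y = 0")
    case False
    let ?q = "(x0, y)"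
    have q: "?q \<in> X \<times> X" using xy0(1) y by simp
    have prevN: "degree (shift_family G j ?q) \<le> N" "coeff (shift_family G j ?q) N = shift g j y" for j
      using N[OF q] by (auto simp: shift_family_def shift_def g_def split: nat.split)
    have id: "c ?q * (c ?q * reduced_deriv G j ?q) = c ?q * reduced_deriv G (Suc (Suc d)) ?q * shift_family G j ?q + T ?q * G j ?q" for j
      unfolding c_def T_def by (rule pseudo_division[of G, OF G van V min q])
    have Wj: "degree (reduced_deriv G j ?q) \<le> N + 2"
      "coeff (reduced_deriv G j ?q) (N + 2) = dT (\<lambda>q. coeff (G j q) N) ?q + 2 * of_nat N * coeff (shift_family G j ?q) N
      - (of_nat j - 1) * coeff (shift_family G j ?q) N - R (snd ?q) / 2 * of_nat (Suc j) * coeff (G (Suc j) ?q) N" for j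
      by (rule degree_reduced_deriv[of G, OF G _ q], erule N)+
    have nq: "degree (G (Suc d) ?q) \<le> n" using n[OF q] by (simp add: c_def)
    have Wt: "degree (reduced_deriv G (Suc (Suc d)) ?q) \<le> n + 2"
      "coeff (reduced_deriv G (Suc (Suc d)) ?q) (n + 2) = (2 * of_nat n - of_nat (Suc d)) * coeff (G (Suc d) ?q) n"
      by (rule degree_reduced_deriv_top[of G, OF G _ nq q], erule van)+
    have deg1: "degree (c ?q * (c ?q * reduced_deriv G j ?q)) \<le> n + (n + (N + 2))" for j
      using Wj(1) n[OF q] by (intro order_trans[OF degree_mult_le] add_mono)
    have degcW: "degree (c ?q * reduced_deriv G (Suc (Suc d)) ?q) \<le> n + (n + 2)"
      using Wt(1) n[OF q] by (intro order_trans[OF degree_mult_le] add_mono)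
    have deg2: "degree (c ?q * reduced_deriv G (Suc (Suc d)) ?q * shift_family G j ?q) \<le> n + (n + 2) + N" for j
      by (rule order_trans[OF degree_mult_le add_mono[OF degcW prevN(1)]])
    have degT: "degree (T ?q) \<le> n + (n + 2)"
    proof (cases "T ?q = 0")
      case nz: False
      have "G j0 ?q \<noteq> 0" using False by (auto simp: g_def)
      have "N \<le> degree (G j0 ?q)" using False by (intro le_degree) (simp add: g_def)
      have "degree (T ?q * G j0 ?q) \<le> n + (n + (N + 2))"
        using id[of j0] deg1[of j0] deg2[of j0]
          degree_diff_le[of "c ?q * (c ?q * reduced_deriv G j0 ?q)" "n + (n + (N + 2))" "c ?q * reduced_deriv G (Suc (Suc d)) ?q * shift_family G j0 ?q"]
        by (simp add: algebra_simps)
      then show ?thesis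
        using degree_mult_eq[OF nz \<open>G j0 ?q \<noteq> 0\<close>] \<open>N \<le> degree (G j0 ?q)\<close> by linarith
    qed simp
    have "coeff (c ?q * (c ?q * reduced_deriv G j ?q)) (n + (n + (N + 2))) = \<gamma> y * (\<gamma> y * coeff (reduced_deriv G j ?q) (N + 2))"
      by (subst coeff_mult_top[OF n[OF q] order_trans[OF degree_mult_le add_mono[OF n[OF q] Wj(1)]]],
          subst coeff_mult_top[OF n[OF q] Wj(1)]) (simp only: \<gamma>_def)
    moreover have "coeff (c ?q * reduced_deriv G (Suc (Suc d)) ?q * shift_family G j ?q) (n + (n + 2) + N)
        = \<gamma> y * ((2 * of_nat n - of_nat (Suc d)) * \<gamma> y) * shift g j y"
      by (subst coeff_mult_top[OF degcW prevN(1)], subst coeff_mult_top[OF n[OF q] Wt(1)], unfold Wt(2) prevN(2))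
        (simp only: \<gamma>_def c_def)
    moreover have "coeff (T ?q * G j ?q) (n + (n + 2) + N) = \<tau> y * g j y"
      by (subst coeff_mult_top[OF degT N[OF q]]) (simp only: \<tau>_def g_def)
    ultimately have "\<gamma> y * (\<gamma> y * coeff (reduced_deriv G j ?q) (N + 2))
        = \<gamma> y * ((2 * of_nat n - of_nat (Suc d)) * \<gamma> y) * shift g j y + \<tau> y * g j y"
      using arg_cong[OF id[of j], of "\<lambda>p. coeff p (n + (n + 2) + N)"] by (simp add: algebra_simps)
    moreover have "coeff (reduced_deriv G j ?q) (N + 2) = \<Delta> (\<lambda>x. 1 / 2 * R x) g j y + 2 * of_nat N * shift g j y"
      unfolding Wj(2) prevN(2) dT(2)[OF bi(2) xy0(1) y]
      by (simp add: \<Delta>_def formal_deriv_def g_def[abs_def] algebra_simps)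
    ultimately have eq: "\<gamma> y * \<gamma> y * \<Delta> (\<lambda>x. 1 / 2 * R x) g j y
        = \<kappa> * (\<gamma> y * \<gamma> y) * shift g j y + \<tau> y * g j y"
      by (simp add: \<kappa>_def algebra_simps)
    have "(\<gamma> y * \<gamma> y * g j0 y) * \<Delta> (\<lambda>x. 1 / 2 * R x) g j y
        = g j0 y * (\<gamma> y * \<gamma> y * \<Delta> (\<lambda>x. 1 / 2 * R x) g j y)"
      by (simp only: mult_ac)
    also have "\<dots> = (\<kappa> * (\<gamma> y * \<gamma> y * g j0 y)) * shift g j y + (\<tau> y * g j0 y) * g j y"
      unfolding eq by (simp only: distrib_left mult_ac)
    finally show ?thesis .
  qed simp
  have gy0: "g j0 y0 \<noteq> 0" "\<gamma> y0 \<noteq> 0" using xy0 by (simp_all add: g_def \<gamma>_def)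
  have g_van: "g j y = 0" if "j > Suc d" for j y using van[OF that] by (simp add: g_def)
  define m where "m = (GREATEST j. \<exists>y\<in>X. g j y \<noteq> 0)"
  have m1: "\<exists>y\<in>X. g m y \<noteq> 0"
    unfolding m_def by (rule GreatestI_nat[of _ j0 "Suc d"]) (use gy0 xy0(2) g_van not_less in blast)+
  have m2: "g j y = 0" if "y \<in> X" "j > m" for j y
    using Greatest_le_nat[of "\<lambda>j. \<exists>y\<in>X. g j y \<noteq> 0" j "Suc d"] that g_van not_less unfolding m_def by blast
  have "m > 0"
  proof (rule ccontr)
    assume "\<not> m > 0"
    then have z: "g j y = 0" if "y \<in> X" "j > 0" for j y using m2 that by auto
    have j0: "j0 = 0" using z[OF xy0(2), of j0] gy0 by blast
    have "dX (g 1) y0 = 0"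
      using D_cong[OF g polys_intros(2)[of 0] _ xy0(2), of 1] z D_const[OF xy0(2)] by simp
    then have "\<Delta> (\<lambda>x. 1 / 2 * R x) g 1 y0 = 0"
      using z[OF xy0(2)] by (simp add: \<Delta>_def formal_deriv_def)
    then show False
      using main[OF xy0(2), of 1] z[OF xy0(2), of 1] gy0 \<open>\<kappa> \<noteq> 0\<close> by (simp add: shift_def j0)
  qed
  from m1 obtain y1 where y1: "y1 \<in> X" "g m y1 \<noteq> 0" by blast
  show ?thesis
  proof (rule riccati_of_darboux[where g = g and n = m and c = "\<lambda>y. \<gamma> y * \<gamma> y * g j0 y"
        and ?l1.0 = "\<lambda>y. \<kappa> * (\<gamma> y * \<gamma> y * g j0 y)" and ?l0.0 = "\<lambda>y. \<tau> y * g j0 y"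
        and ?x0.0 = y1 and ?x1.0 = y0])
    show "(\<lambda>y. \<gamma> y * \<gamma> y * g j0 y) \<in> polys" "(\<lambda>y. \<tau> y * g j0 y) \<in> polys"
      "(\<lambda>y. \<kappa> * (\<gamma> y * \<gamma> y * g j0 y)) \<in> polys"
      using g \<gamma>\<tau> polys_intros(2) by (auto intro!: polys_intros(4))
  qed (use g m2 y1 \<open>m > 0\<close> xy0(2) gy0 main in auto)
qed

end

section \<open>Equations of order 1 and their groupoid\<close>

definition arrow :: "('n \<Rightarrow> complex) \<times> ('n \<Rightarrow> complex) \<Rightarrow> complex \<Rightarrow> 'n jet" where
  "arrow q a = (\<lambda>j. case j of Src i \<Rightarrow> fst q i | Tgt i \<Rightarrow> snd q i | Der i \<Rightarrow> if i = 1 then a else 0)"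

lemma arrow_simps: "src (arrow q a) = fst q" "tgt (arrow q a) = snd q"
  "endpoints (arrow q a) = q" "arrow q a (Der 1) = a"
  by (auto simp: arrow_def src_def tgt_def endpoints_def)

lemma arrow_in_Aut_jets: "arrow q a \<in> Aut_jets 1 X \<longleftrightarrow> q \<in> X \<times> X \<and> a \<noteq> 0"
  unfolding Aut_jets_def by (cases q) (auto simp: arrow_simps arrow_simps[unfolded One_nat_def], auto simp: arrow_def)

lemma jet_fps_arrow: "fps_nth (jet_fps (arrow q a)) 0 = 0" "fps_nth (jet_fps (arrow q a)) 1 = a"
  by (simp_all add: jet_fps_def arrow_def)

lemma fps_compose_nth_1: "fps_nth f 0 = 0 \<Longrightarrow> fps_nth (fps_compose f g) 1 = fps_nth f 1 * fps_nth g (1::nat)"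
  for f g :: "complex fps"
  by (simp add: fps_compose_nth)

lemma mk_jet_1: "mk_jet 1 x y f = arrow (x, y) (fps_nth f 1)"
  unfolding mk_jet_def arrow_def by (auto simp: fun_eq_iff split: jvar.split)

lemma jet_comp_arrow: "jet_comp 1 (arrow (y, w) c) (arrow (x, y) a) = arrow (x, w) (c * a)"
  unfolding jet_comp_def mk_jet_1 arrow_simps
  by (subst fps_compose_nth_1) (simp_all add: jet_fps_arrow jet_fps_arrow[unfolded One_nat_def])

lemma jet_inv_arrow: "a \<noteq> 0 \<Longrightarrow> jet_inv 1 (arrow (x, y) a) = arrow (y, x) (inverse a)"
proof -
  assume a: "a \<noteq> 0"
  let ?f = "jet_fps (arrow (x, y) a)"
  have "fps_compose (fps_inv ?f) ?f = fps_X"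
    by (rule fps_inv) (use a jet_fps_arrow[of "(x, y)" a] in auto)
  moreover have "fps_nth (fps_inv ?f) 0 = 0" by (simp add: fps_inv_def)
  ultimately have "fps_nth (fps_inv ?f) 1 * a = 1"
    using fps_compose_nth_1[of "fps_inv ?f" ?f] jet_fps_arrow(2)[of "(x, y)" a] by simp
  then have "fps_nth (fps_inv ?f) 1 = inverse a"
    using a by (metis inverse_unique mult.commute)
  then show ?thesis
    unfolding jet_inv_def mk_jet_1 arrow_simps fst_conv snd_conv by (simp only:)
qed

text \<open>
  The open set over which a rational subgroupoid is a groupoid contains the points of \<open>X\<close> at which
  a single polynomial \<open>\<omega>\<close> is nonzero, and restriction to them preserves composition and inversion.
\<close>
lemma rational_subgroupoid_1:
  assumes "rational_subgroupoid 1 X Z"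
  obtains \<omega> x0 where "\<omega> \<in> polys" "x0 \<in> X" "\<omega> x0 \<noteq> 0"
    "\<And>x y w a c. \<lbrakk>x \<in> X; y \<in> X; w \<in> X; \<omega> x \<noteq> 0; \<omega> y \<noteq> 0; \<omega> w \<noteq> 0; arrow (x, y) a \<in> Z; arrow (y, w) c \<in> Z\<rbrakk>
      \<Longrightarrow> arrow (x, w) (c * a) \<in> Z"
    "\<And>x y a. \<lbrakk>x \<in> X; y \<in> X; \<omega> x \<noteq> 0; \<omega> y \<noteq> 0; arrow (x, y) a \<in> Z\<rbrakk> \<Longrightarrow> arrow (y, x) (inverse a) \<in> Z"
proof -
  from assms obtain U where U: "zariski_open_in X U" "U \<noteq> {}" "subgroupoid 1 U (Z \<inter> Aut_jets 1 U)"
    and Z: "Z \<subseteq> Aut_jets 1 X"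
    unfolding rational_subgroupoid_def strict_algebraic_subgroupoid_def jet_closed_def by blast
  from U(1) obtain S where S: "S \<subseteq> polys" "U = X - {x. \<forall>f\<in>S. f x = 0}"
    unfolding zariski_open_in_def zariski_closed_def by blast
  with U(2) obtain \<omega> x0 where \<omega>: "\<omega> \<in> S" "x0 \<in> X" "\<omega> x0 \<noteq> 0" by blast
  have inU: "x \<in> U" if "x \<in> X" "\<omega> x \<noteq> 0" for x using that \<omega>(1) unfolding S(2) by blast
  have ZU: "arrow (x, y) a \<in> Z \<inter> Aut_jets 1 U \<and> a \<noteq> 0"
    if "arrow (x, y) a \<in> Z" "x \<in> X" "y \<in> X" "\<omega> x \<noteq> 0" "\<omega> y \<noteq> 0" for x y a
    using that inU Z arrow_in_Aut_jets[of "(x, y)" a X] arrow_in_Aut_jets[of "(x, y)" a U] by auto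
  show ?thesis
  proof (rule that[of \<omega> x0])
    show "arrow (x, w) (c * a) \<in> Z" if "x \<in> X" "y \<in> X" "w \<in> X" "\<omega> x \<noteq> 0" "\<omega> y \<noteq> 0" "\<omega> w \<noteq> 0"
      "arrow (x, y) a \<in> Z" "arrow (y, w) c \<in> Z" for x y w a c
    proof -
      have "jet_comp 1 (arrow (y, w) c) (arrow (x, y) a) \<in> Z \<inter> Aut_jets 1 U"
        using U(3) ZU[of x y a] ZU[of y w c] that unfolding subgroupoid_def
        by (metis arrow_simps(1,2) fst_conv snd_conv)
      then show ?thesis unfolding jet_comp_arrow by blast
    qed
    show "arrow (y, x) (inverse a) \<in> Z" if "x \<in> X" "y \<in> X" "\<omega> x \<noteq> 0" "\<omega> y \<noteq> 0" "arrow (x, y) a \<in> Z" for x y a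
    proof -
      have "jet_inv 1 (arrow (x, y) a) \<in> Z \<inter> Aut_jets 1 U"
        using U(3) ZU[of x y a] that unfolding subgroupoid_def by blast
      then show ?thesis using jet_inv_arrow[of a x y] ZU[of x y a] that by auto
    qed
  qed (use S \<omega> in auto)
qed

context kummer_subideal
begin

abbreviation pval :: "'n bifam \<Rightarrow> 'n jet \<Rightarrow> complex" where
  "pval F \<equiv> \<lambda>p. poly (F (endpoints p)) (p (Der 1))"

text \<open>
  \<open>F\<close> generates the part of order 1 of \<open>H\<close> up to denominators. That its constant coefficient is
  nonzero can be achieved because the first derivative is invertible.
\<close>
definition minimal_order1 ::
  "'n bifam \<Rightarrow> nat \<Rightarrow> bool" where
  "minimal_order1 F d \<longleftrightarrow> F \<in> polyfam bipolys \<and> (\<forall>q. degree (F q) \<le> d) \<and> Van (pval F) \<and> d > 0 \<and>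
    (\<exists>q\<in>X \<times> X. coeff (F q) d \<noteq> 0) \<and> (\<exists>q\<in>X \<times> X. coeff (F q) 0 \<noteq> 0) \<and>
    (\<forall>h\<in>polyfam bipolys. (\<forall>q. degree (h q) < d) \<longrightarrow> Van (pval h) \<longrightarrow> (\<forall>q\<in>X \<times> X. h q = 0))"

lemma ex_minimal_order1:
  assumes F: "F \<in> polyfam bipolys" "Van (pval F)" "q0 \<in> X \<times> X" "F q0 \<noteq> 0"
  shows "\<exists>F d. minimal_order1 F d"
proof -
  define good where "good d \<longleftrightarrow> (\<exists>F\<in>polyfam bipolys. (\<forall>q. degree (F q) \<le> d) \<and> Van (pval F) \<and> (\<exists>q\<in>X \<times> X. F q \<noteq> 0))" for d
  define d where "d = (LEAST d. good d)"
  have "\<exists>d. good d" using F unfolding good_def polyfam_def by blast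
  then have "good d" unfolding d_def by (rule LeastI_ex)
  then obtain F where F: "F \<in> polyfam bipolys" "\<And>q. degree (F q) \<le> d" "Van (pval F)" "\<exists>q\<in>X \<times> X. F q \<noteq> 0"
    unfolding good_def by blast
  have min: "h q = 0" if "h \<in> polyfam bipolys" "\<And>q. degree (h q) \<le> k" "k < d" "Van (pval h)" "q \<in> X \<times> X" for h k q
    using not_less_Least[of k good] that unfolding d_def good_def by blast
  have Fq: "coeff (F q) i = 0" if "i > d" for q i using F(2)[of q] that by (intro coeff_eq_0) linarith
  have pos: "d > 0"
  proof (rule ccontr)
    assume "\<not> d > 0"
    then have deg0: "F q = [:coeff (F q) 0:]" for q using F(2)[of q] by (metis degree_eq_zeroE coeff_pCons_0 le_zero_eq neq0_conv)
    have "Van (\<lambda>p. coeff (F (endpoints p)) 0)"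
      by (rule Van_cong[OF F(3)]) (subst deg0, simp)
    then have "coeff (F q) 0 = 0" if "q \<in> X \<times> X" for q
      using order_pos[OF polyfam_coeff[OF F(1)]] that by blast
    then show False using F(4) deg0 by (metis pCons_0_0)
  qed
  have top: "\<exists>q\<in>X \<times> X. coeff (F q) d \<noteq> 0"
  proof (rule ccontr)
    assume "\<not> ?thesis"
    then have z: "coeff (F q) d = 0" if "q \<in> X \<times> X" for q using that by blast
    let ?h = "\<lambda>q. F q - Polynomial.monom (coeff (F q) d) d"
    have "?h \<in> polyfam bipolys"
      by (intro polyfam.diff F bipolys.polyfam_monom polyfam_coeff[OF F(1)])
    moreover have "degree (?h q) \<le> d - 1" for q
      by (rule degree_le) (use Fq \<open>d > 0\<close> in \<open>auto simp: coeff_monom not_le\<close>)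
    moreover have "Van (pval ?h)"
      by (rule Van_cong[OF F(3)]) (use z endpoints_in in auto)
    ultimately have "?h q = 0" if "q \<in> X \<times> X" for q using min[of ?h "d - 1" q] \<open>d > 0\<close> that by simp
    then show False using F(4) z by fastforce
  qed
  have bot: "\<exists>q\<in>X \<times> X. coeff (F q) 0 \<noteq> 0"
  proof (rule ccontr)
    assume "\<not> ?thesis"
    then have z: "coeff (F q) 0 = 0" if "q \<in> X \<times> X" for q using that by blast
    let ?h = "\<lambda>q. poly_shift 1 (F q)"
    have "degree (?h q) \<le> d - 1" for q
      by (rule degree_le) (use Fq in \<open>auto simp: coeff_poly_shift\<close>)
    moreover from this have h: "?h \<in> polyfam bipolys"
      unfolding polyfam_def using polyfam_coeff[OF F(1)] by (auto simp: coeff_poly_shift)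
    moreover have eq: "F q = pCons 0 (?h q)" if "q \<in> X \<times> X" for q
      using z[OF that] by (intro poly_eqI) (auto simp: coeff_pCons coeff_poly_shift split: nat.split)
    have "Van (\<lambda>p. inverse (p (Der 1)) * pval F p)"
      by (rule Van_mult[OF Reg_jet_funs[OF jet_funs_intros(5)[of 1]] F(3)]) simp
    then have "Van (pval ?h)"
    proof (rule Van_cong)
      fix p assume p: "p \<in> Aut_inf X"
      have "pval F p = p (Der 1) * pval ?h p"
        using arg_cong[OF eq[OF endpoints_in[OF p]], of "\<lambda>f. poly f (p (Der 1))"] by simp
      then show "inverse (p (Der 1)) * pval F p = pval ?h p"
        using Aut_inf_Der1[OF p] by (simp del: One_nat_def)
    qed
    ultimately have "?h q = 0" if "q \<in> X \<times> X" for q using min[of ?h "d - 1" q] \<open>d > 0\<close> that by simp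
    then show False using F(4) eq by fastforce
  qed
  have least: "\<forall>h\<in>polyfam bipolys. (\<forall>q. degree (h q) < d) \<longrightarrow> Van (pval h) \<longrightarrow> (\<forall>q\<in>X \<times> X. h q = 0)"
  proof (intro ballI allI impI)
    fix h q assume *: "h \<in> polyfam bipolys" "\<forall>q. degree (h q) < d" "Van (pval h)" "q \<in> X \<times> X"
    have "degree (h q) \<le> d - 1" for q using *(2)[rule_format, of q] by linarith
    then show "h q = 0" using min[OF *(1) _ _ *(3,4), of "d - 1"] pos by simp
  qed
  have "minimal_order1 F d"
    unfolding minimal_order1_def by (intro conjI allI F(1-3) pos top bot least)
  then show ?thesis by blast
qed

text \<open>
  The step of pseudo-division by \<open>F\<close> on which the inductions in the next two lemmas are based.
\<close>
lemma division_step: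
  assumes "minimal_order1 F d" and h: "h \<in> polyfam bipolys" "\<And>q. degree (h q) \<le> m" and m: "d \<le> m"
  defines "h' \<equiv> \<lambda>q. Polynomial.smult (coeff (F q) d) (h q) - Polynomial.monom (coeff (h q) m) (m - d) * F q"
  shows "h' \<in> polyfam bipolys" "degree (h' q) \<le> m - 1"
proof -
  have F: "F \<in> polyfam bipolys" "\<And>q. degree (F q) \<le> d" "d > 0"
    using assms(1) unfolding minimal_order1_def by blast+
  show "h' \<in> polyfam bipolys" unfolding h'_def
    by (intro polyfam.diff polyfam.mult bipolys.polyfam_smult bipolys.polyfam_monom
        polyfam_coeff[OF F(1)] polyfam_coeff[OF h(1)] F h)
  show "degree (h' q) \<le> m - 1"
  proof (rule degree_le, intro allI impI)
    fix i assume i: "i > m - 1"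
    show "coeff (h' q) i = 0"
    proof (cases "i = m")
      case True
      then show ?thesis using m by (simp add: h'_def coeff_monom_mult)
    next
      case False
      then have "i > m" using i by linarith
      moreover from this have "i - (m - d) > d" using m by linarith
      ultimately have "coeff (h q) i = 0" "coeff (F q) (i - (m - d)) = 0"
        using h(2)[of q] F(2)[of q] by (auto intro!: coeff_eq_0)
      then show ?thesis using \<open>i > m\<close> by (simp add: h'_def coeff_monom_mult)
    qed
  qed
qed

lemma vanish_at_roots:
  assumes F: "minimal_order1 F d" and h: "h \<in> polyfam bipolys" "Van (pval h)"
    and q: "q \<in> X \<times> X" "coeff (F q) d \<noteq> 0" "poly (F q) a = 0"
  shows "poly (h q) a = 0"
proof -
  have F': "F \<in> polyfam bipolys" "Van (pval F)" "d > 0"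
    and min: "\<And>h q. h \<in> polyfam bipolys \<Longrightarrow> (\<And>q. degree (h q) < d) \<Longrightarrow> Van (pval h) \<Longrightarrow> q \<in> X \<times> X \<Longrightarrow> h q = 0"
    using F unfolding minimal_order1_def by blast+
  obtain m where "\<And>q. degree (h q) \<le> m" using h(1) by (auto simp: polyfam_def)
  then show ?thesis using h
  proof (induction m arbitrary: h rule: less_induct)
    case (less m)
    show ?case
    proof (cases "m < d")
      case True
      then have "h q = 0" using min[of h q] less.prems q(1) by (meson le_less_trans)
      then show ?thesis by simp
    next
      case False
      then have m: "d \<le> m" by simp
      let ?h' = "\<lambda>q. Polynomial.smult (coeff (F q) d) (h q) - Polynomial.monom (coeff (h q) m) (m - d) * F q"
      note h' = division_step[OF F less.prems(2,1) m]
      have "Van (\<lambda>p. pval (\<lambda>q. [:coeff (F q) d:]) p * pval h p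
          - pval (\<lambda>q. Polynomial.monom (coeff (h q) m) (m - d)) p * pval F p)"
        by (intro Van_diff Van_mult Reg_polyfam less.prems F' bipolys.polyfam_const bipolys.polyfam_monom
            polyfam_coeff[OF F'(1)] polyfam_coeff[OF less.prems(2)])
      then have "Van (pval ?h')" by (rule Van_cong) simp
      then have "poly (?h' q) a = 0"
        using less.IH[of "m - 1" ?h'] h' m F'(3) by simp
      then show ?thesis using q by simp
    qed
  qed
qed

text \<open>
  Where the leading coefficient of \<open>F\<close> is nonzero, a remainder of degree less than \<open>d\<close> that is
  divisible by \<open>F\<close> is zero. This replaces the passage to a prime ideal.
\<close>
lemma dvd_imp_Van:
  assumes F: "minimal_order1 F d" and h: "h \<in> polyfam bipolys"
    and dvd: "\<And>q. q \<in> X \<times> X \<Longrightarrow> coeff (F q) d \<noteq> 0 \<Longrightarrow> F q dvd h q"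
  shows "\<exists>k. Van (\<lambda>p. coeff (F (endpoints p)) d ^ k * pval h p)"
proof -
  have F': "F \<in> polyfam bipolys" "Van (pval F)" "d > 0" "\<And>q. degree (F q) \<le> d"
    using F unfolding minimal_order1_def by blast+
  have Rd: "Reg (\<lambda>p. coeff (F (endpoints p)) d)"
    by (rule Reg_jet_funs[OF bipolys_jet_funs[OF polyfam_coeff[OF F'(1)]]])
  obtain m where "\<And>q. degree (h q) \<le> m" using h(1) by (auto simp: polyfam_def)
  then show ?thesis using h dvd
  proof (induction m arbitrary: h rule: less_induct)
    case (less m)
    show ?case
    proof (cases "m < d")
      case True
      have "coeff (F q) d = 0 \<or> h q = 0" if "q \<in> X \<times> X" for q
      proof (rule ccontr)
        assume *: "\<not> ?thesis"
        then have "F q dvd h q" "h q \<noteq> 0" using less.prems(3)[OF that] by auto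
        then have "degree (F q) \<le> degree (h q)" by (rule dvd_imp_degree_le)
        moreover have "d \<le> degree (F q)" using * by (intro le_degree) auto
        ultimately show False using less.prems(1)[of q] True by linarith
      qed
      then have "Van (\<lambda>p. coeff (F (endpoints p)) d ^ 1 * pval h p)"
        by (intro Van_zero) (use endpoints_in in fastforce)
      then show ?thesis by blast
    next
      case False
      then have m: "d \<le> m" by simp
      let ?h' = "\<lambda>q. Polynomial.smult (coeff (F q) d) (h q) - Polynomial.monom (coeff (h q) m) (m - d) * F q"
      note h' = division_step[OF F less.prems(2,1) m]
      have "F q dvd ?h' q" if "q \<in> X \<times> X" "coeff (F q) d \<noteq> 0" for q
        using less.prems(3)[OF that] by (intro dvd_diff dvd_smult dvd_mult) auto
      then obtain k where k: "Van (\<lambda>p. coeff (F (endpoints p)) d ^ k * pval ?h' p)"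
        using less.IH[of "m - 1" ?h'] h' m F'(3) by auto
      have "Reg (\<lambda>p. coeff (F (endpoints p)) d ^ k)"
        by (rule Reg_jet_funs[OF jet_funs_power[OF bipolys_jet_funs[OF polyfam_coeff[OF F'(1)]]]])
      then have "Van (\<lambda>p. coeff (F (endpoints p)) d ^ k * pval ?h' p
          + coeff (F (endpoints p)) d ^ k * (pval (\<lambda>q. Polynomial.monom (coeff (h q) m) (m - d)) p * pval F p))"
        by (intro Van_add k Van_mult Reg_polyfam F' bipolys.polyfam_monom polyfam_coeff[OF less.prems(2)])
      then have "Van (\<lambda>p. coeff (F (endpoints p)) d ^ Suc k * pval h p)"
        by (rule Van_cong) (simp add: algebra_simps)
      then show ?thesis by blast
    qed
  qed
qed

text \<open>
  Over a pair of points at which the extreme coefficients of \<open>F\<close> do not vanish, the groupoid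
  consists of the roots of \<open>F\<close>. In particular it is nonempty there.
\<close>
lemma root_imp_arrow:
  assumes F: "minimal_order1 F d" and q: "q \<in> X \<times> X" "coeff (F q) d \<noteq> 0" "coeff (F q) 0 \<noteq> 0"
  shows "arrow q a \<in> truncation X H 1 \<longleftrightarrow> poly (F q) a = 0"
proof
  have F': "F \<in> polyfam bipolys" "Van (pval F)" using F unfolding minimal_order1_def by blast+
  show "poly (F q) a = 0" if "arrow q a \<in> truncation X H 1"
  proof -
    have "pval F (arrow q a) = 0"
      using that jet_funs_polyfam[OF F'(1), of 1] F'(2) unfolding truncation_def Van_def by blast
    then show ?thesis by (simp add: arrow_simps[unfolded One_nat_def] arrow_simps)
  qed
  assume a: "poly (F q) a = 0"
  then have a0: "a \<noteq> 0" using q(3) by (auto simp: poly_0_coeff_0)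
  have "f (arrow q a) = 0" if f: "f \<in> jet_funs 1" "Van f" for f
  proof -
    obtain K h where h: "h \<in> polyfam bipolys" "\<And>p. p (Der 1) \<noteq> 0 \<Longrightarrow> p (Der 1) ^ K * f p = pval h p"
      using order1_normal_form[OF f(1)] by blast
    have "Van (\<lambda>p. p (Der 1) ^ K * f p)"
      by (rule Van_mult[OF Reg_jet_funs[OF jet_funs_power[OF jet_funs_intros(4)[of 1 1]]] f(2)]) auto
    then have "Van (pval h)" by (rule Van_cong) (rule h(2)[OF Aut_inf_Der1])
    then have "poly (h q) a = 0" using vanish_at_roots[OF F h(1) _ q(1,2) a] by blast
    then show ?thesis using h(2)[of "arrow q a"] a0 by (simp add: arrow_simps[unfolded One_nat_def] arrow_simps)
  qed
  then show "arrow q a \<in> truncation X H 1"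
    using a0 q(1) arrow_in_Aut_jets[of q a X] unfolding truncation_def Van_def by blast
qed

end

text \<open>
  If all roots have the same \<open>N\<close>-th power, the product of the roots shows that its \<open>d\<close>-th power is a
  rational function of the coefficients.
\<close>
lemma prod_roots_power:
  fixes p :: "complex poly"
  assumes d: "degree p \<le> d" "coeff p d \<noteq> 0" and a: "\<And>r. poly p r = 0 \<Longrightarrow> r ^ N = a ^ N"
  shows "coeff p d ^ N * a ^ (N * d) = (-1) ^ (N * d) * coeff p 0 ^ N"
proof -
  have deg: "degree p = d" using d le_degree by (meson le_antisym)
  obtain root where root: "Polynomial.smult (coeff p d) (\<Prod>i<d. [:-root i, 1:]) = p"
    using complex_poly_decompose'[of p] deg by auto
  have poly_p: "poly p x = coeff p d * (\<Prod>i<d. x - root i)" for x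
  proof -
    have "poly p x = poly (Polynomial.smult (coeff p d) (\<Prod>i<d. [:-root i, 1:])) x"
      by (simp only: root)
    then show ?thesis by (simp only: poly_smult poly_prod) simp
  qed
  have "poly p (root i) = 0" if "i < d" for i
    unfolding poly_p using that by (auto intro!: prod_zero)
  then have r: "root i ^ N = a ^ N" if "i < d" for i using a that by blast
  have "coeff p 0 = coeff p d * (\<Prod>i<d. - root i)"
    using poly_p[of 0] by (simp add: poly_0_coeff_0)
  then have "coeff p 0 ^ N = coeff p d ^ N * (\<Prod>i<d. (- root i) ^ N)"
    by (simp add: power_mult_distrib prod_power_distrib)
  also have "(\<Prod>i<d. (- root i) ^ N) = (\<Prod>i<d. (-1) ^ N * a ^ N)"
    by (rule prod.cong) (use r in \<open>auto simp: power_minus[of "root _"]\<close>)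
  also have "\<dots> = (-1) ^ (N * d) * a ^ (N * d)"
    by (simp add: power_mult power_mult_distrib)
  finally show ?thesis
    by (simp add: power_mult_distrib[symmetric] flip: power_add mult.assoc)
qed

lemma poly_ex_root: "degree p \<le> d \<Longrightarrow> d > 0 \<Longrightarrow> coeff p d \<noteq> 0 \<Longrightarrow> \<exists>a::complex. poly p a = 0"
  using fundamental_theorem_of_algebra[of p] le_degree[of p d] by (auto simp: constant_degree)

context kummer_subideal
begin

lemma bipolys_mult_nonzero:
  assumes "F \<in> bipolys" "G \<in> bipolys" "\<exists>q\<in>X \<times> X. F q \<noteq> 0" "\<exists>q\<in>X \<times> X. G q \<noteq> 0"
  shows "\<exists>q\<in>X \<times> X. F q * G q \<noteq> 0"
  using bipolys_no_zero_divisors[OF assms(1,2)] assms(3,4) by blast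

lemma polys_mult_nonzero:
  assumes "f \<in> polys" "g \<in> polys" "\<exists>x\<in>X. f x \<noteq> 0" "\<exists>x\<in>X. g x \<noteq> 0"
  shows "\<exists>x\<in>X. f x * g x \<noteq> 0"
  using polys_no_zero_divisors[OF assms(1,2)] assms(3,4) by blast

text \<open>
  The splitting of the cocycle. Exponents: \<open>N = d!\<close> is a multiple of the order of every quotient of
  two of the at most \<open>d\<close> roots, and \<open>M = N d\<close> comes from \<open>prod_roots_power\<close>. The relation lies in
  \<open>H\<close> only after multiplication by some \<open>E\<close>: the argument gives it at general points, and
  \<open>dvd_imp_Van\<close> together with the Nullstellensatz in one variable turns this into membership.
\<close>
lemma power_relation:
  assumes F: "minimal_order1 F d" and grp: "rational_subgroupoid 1 X (truncation X H 1)"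
  obtains E \<Omega> P1 P2 Q1 Q2 M where
    "E \<in> bipolys" "\<Omega> \<in> bipolys" "P1 \<in> polys" "P2 \<in> polys" "Q1 \<in> polys" "Q2 \<in> polys" "M > (0::nat)"
    "\<exists>q\<in>X \<times> X. E q \<noteq> 0" "\<exists>q\<in>X \<times> X. \<Omega> q \<noteq> 0"
    "\<exists>x\<in>X. P1 x \<noteq> 0" "\<exists>x\<in>X. P2 x \<noteq> 0" "\<exists>x\<in>X. Q1 x \<noteq> 0" "\<exists>x\<in>X. Q2 x \<noteq> 0"
    "Van (\<lambda>p. E (endpoints p) * (P1 (src p) * P2 (tgt p) * p (Der 1) ^ M - Q1 (src p) * Q2 (tgt p)))"
    "\<And>q. q \<in> X \<times> X \<Longrightarrow> \<Omega> q \<noteq> 0 \<Longrightarrow>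
      \<exists>a. \<forall>h\<in>polyfam bipolys. Van (pval h) \<longrightarrow> poly (h q) a = 0"
proof -
  have F': "F \<in> polyfam bipolys" "\<And>q. degree (F q) \<le> d" "d > 0"
      "\<exists>q\<in>X \<times> X. coeff (F q) d \<noteq> 0" "\<exists>q\<in>X \<times> X. coeff (F q) 0 \<noteq> 0"
    using F unfolding minimal_order1_def by blast+
  note cF = polyfam_coeff[OF F'(1)]
  from grp obtain \<omega> x0 where \<omega>: "\<omega> \<in> polys" "x0 \<in> X" "\<omega> x0 \<noteq> 0"
    and comp: "\<And>x y w a c. \<lbrakk>x \<in> X; y \<in> X; w \<in> X; \<omega> x \<noteq> 0; \<omega> y \<noteq> 0; \<omega> w \<noteq> 0;
        arrow (x, y) a \<in> truncation X H 1; arrow (y, w) c \<in> truncation X H 1\<rbrakk> \<Longrightarrow> arrow (x, w) (c * a) \<in> truncation X H 1"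
    and inv: "\<And>x y a. \<lbrakk>x \<in> X; y \<in> X; \<omega> x \<noteq> 0; \<omega> y \<noteq> 0; arrow (x, y) a \<in> truncation X H 1\<rbrakk>
        \<Longrightarrow> arrow (y, x) (inverse a) \<in> truncation X H 1"
    by (rule rational_subgroupoid_1) (rule that)
  define \<theta> where "\<theta> q = coeff (F q) d * coeff (F q) 0 * (\<omega> (fst q) * \<omega> (snd q))" for q
  have \<theta>: "\<theta> \<in> bipolys"
    unfolding \<theta>_def[abs_def] by (intro bipolys_intros cF bipolys_fst[OF \<omega>(1)] bipolys_snd[OF \<omega>(1)])
  have \<theta>_nz: "\<exists>q\<in>X \<times> X. \<theta> q \<noteq> 0"
    unfolding \<theta>_def using \<omega>
    by (intro bipolys_mult_nonzero bipolys_intros cF bipolys_fst bipolys_snd F' bexI[of _ "(x0, x0)"]) auto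
  have rel: "arrow q a \<in> truncation X H 1 \<longleftrightarrow> poly (F q) a = 0" if "q \<in> X \<times> X" "\<theta> q \<noteq> 0" for q a
    using root_imp_arrow[OF F that(1)] that(2) by (auto simp: \<theta>_def)
  define N where "N = (fact d :: nat)"
  define M where "M = N * d"
  have "M > 0" using F'(3) by (simp add: M_def N_def)

  \<comment> \<open>A quotient \<open>\<gamma>\<close> of two roots belongs to the isotropy group at \<open>y\<close>. All \<open>\<gamma>^k a\<close> are roots again, and
    there are at most \<open>d\<close> of them.\<close>
  have same: "a' ^ N = a ^ N"
    if x: "x \<in> X" and y: "y \<in> X" and \<theta>q: "\<theta> (x, y) \<noteq> 0" and a: "poly (F (x, y)) a = 0" and a': "poly (F (x, y)) a' = 0" for x y a a'
  proof -
    have q: "(x, y) \<in> X \<times> X" and \<omega>xy: "\<omega> x \<noteq> 0" "\<omega> y \<noteq> 0" and nz: "coeff (F (x, y)) 0 \<noteq> 0" "F (x, y) \<noteq> 0"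
      using x y \<theta>q by (auto simp: \<theta>_def)
    have a0: "a \<noteq> 0" "a' \<noteq> 0" using a a' nz by (auto simp: poly_0_coeff_0)
    define \<gamma> where "\<gamma> = a' * inverse a"
    have \<gamma>0: "\<gamma> \<noteq> 0" using a0 by (simp add: \<gamma>_def)
    have "arrow (y, x) (inverse a) \<in> truncation X H 1"
      using inv[OF x y \<omega>xy] rel[OF q \<theta>q] a by blast
    then have \<gamma>: "arrow (y, y) \<gamma> \<in> truncation X H 1"
      unfolding \<gamma>_def using comp[OF y x y \<omega>xy(2,1,2)] rel[OF q \<theta>q] a' by blast
    have "arrow (x, y) (\<gamma> ^ k * a) \<in> truncation X H 1" for k
    proof (induction k)
      case 0
      then show ?case using rel[OF q \<theta>q] a by simp
    next
      case (Suc k)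
      then show ?case using comp[OF x y y \<omega>xy(1,2,2) _ \<gamma>] by (simp add: mult.assoc)
    qed
    then have roots: "poly (F (x, y)) (\<gamma> ^ k * a) = 0" for k using rel[OF q \<theta>q] by blast
    have "\<not> inj_on (\<lambda>k. \<gamma> ^ k * a) {0..d}"
    proof
      assume "inj_on (\<lambda>k. \<gamma> ^ k * a) {0..d}"
      then have "Suc d = card ((\<lambda>k. \<gamma> ^ k * a) ` {0..d})" by (simp add: card_image)
      also have "\<dots> \<le> card {z. poly (F (x, y)) z = 0}"
        using roots poly_roots_finite[OF nz(2)] by (intro card_mono) auto
      also have "\<dots> \<le> degree (F (x, y))" by (rule card_poly_roots_bound[OF nz(2)])
      finally show False using F'(2)[of "(x, y)"] by simp
    qed
    then obtain i j where "i \<le> d" "j \<le> d" "i \<noteq> j" "\<gamma> ^ i = \<gamma> ^ j"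
      using a0 by (auto simp: inj_on_def)
    then obtain i j where ij: "i < j" "j \<le> d" "\<gamma> ^ i = \<gamma> ^ j"
      by (metis linorder_neqE_nat)
    have "\<gamma> ^ j = \<gamma> ^ i * \<gamma> ^ (j - i)" using ij(1) by (simp flip: power_add)
    then have "\<gamma> ^ (j - i) = 1" using ij \<gamma>0 by simp
    moreover have "j - i dvd N" unfolding N_def by (rule dvd_fact) (use ij in auto)
    ultimately have "\<gamma> ^ N = 1" by (metis dvdE power_mult power_one)
    moreover have "a' = \<gamma> * a" using a0 by (simp add: \<gamma>_def)
    ultimately show ?thesis by (simp add: power_mult_distrib)
  qed
  define A B where "A q = coeff (F q) d ^ N" and "B q = (-1) ^ M * coeff (F q) 0 ^ N" for q
  have AB: "A \<in> bipolys" "B \<in> bipolys"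
    unfolding A_def[abs_def] B_def[abs_def] by (intro bipolys_intros bipolys_power cF)+
  have AB_nz: "A q \<noteq> 0" "B q \<noteq> 0" if "\<theta> q \<noteq> 0" for q
    using that by (auto simp: A_def B_def \<theta>_def)
  have rootM: "A q * a ^ M = B q" if "q \<in> X \<times> X" "\<theta> q \<noteq> 0" "poly (F q) a = 0" for q a
    unfolding A_def B_def M_def
  proof (rule prod_roots_power[OF F'(2)])
    show "coeff (F q) d \<noteq> 0" using that by (auto simp: \<theta>_def)
    show "r ^ N = a ^ N" if "poly (F q) r = 0" for r
      using same[of "fst q" "snd q" a r] that \<open>q \<in> X \<times> X\<close> \<open>\<theta> q \<noteq> 0\<close> \<open>poly (F q) a = 0\<close> by auto
  qed
  have ex_root: "\<exists>a. poly (F q) a = 0" if "\<theta> q \<noteq> 0" for q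
    using poly_ex_root[OF F'(2) F'(3)] that by (auto simp: \<theta>_def)
  have cocycle: "A (x, w) * (B (x, y) * B (y, w)) = B (x, w) * (A (x, y) * A (y, w))"
    if xyw: "x \<in> X" "y \<in> X" "w \<in> X" "\<theta> (x, y) \<noteq> 0" "\<theta> (y, w) \<noteq> 0" "\<theta> (x, w) \<noteq> 0" for x y w
  proof -
    obtain a c where ac: "poly (F (x, y)) a = 0" "poly (F (y, w)) c = 0" using ex_root[OF xyw(4)] ex_root[OF xyw(5)] by blast
    have "arrow (x, w) (c * a) \<in> truncation X H 1"
      by (rule comp[of x y w]) (use xyw ac rel[of "(x, y)"] rel[of "(y, w)"] in \<open>auto simp: \<theta>_def\<close>)
    then have "poly (F (x, w)) (c * a) = 0" using rel[of "(x, w)"] xyw by auto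
    then have "A (x, w) * (c * a) ^ M = B (x, w)" using rootM[of "(x, w)"] xyw by auto
    moreover have "A (x, y) * a ^ M = B (x, y)" "A (y, w) * c ^ M = B (y, w)" using rootM[of "(x, y)" a] rootM[of "(y, w)" c] xyw ac by auto
    moreover have "A (x, w) * ((A (x, y) * a ^ M) * (A (y, w) * c ^ M))
        = (A (x, w) * (c * a) ^ M) * (A (x, y) * A (y, w))"
      by (simp add: power_mult_distrib)
    ultimately show ?thesis by simp
  qed

  \<comment> \<open>The cocycle splits over a base point \<open>y1\<close> that is joined to a general source and to a general
    target.\<close>
  obtain xs ys where xy: "xs \<in> X" "ys \<in> X" "\<theta> (xs, ys) \<noteq> 0" using \<theta>_nz by auto
  obtain y1 where y1: "y1 \<in> X" "\<theta> (xs, y1) * \<theta> (y1, ys) \<noteq> 0"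
    using polys_mult_nonzero[OF bipolys_slice(2)[OF \<theta>, of xs] bipolys_slice(1)[OF \<theta>, of ys]] xy by blast
  define P1 Q1 P2 Q2 where "P1 x = A (x, y1)" and "Q1 x = B (x, y1)" and "P2 w = A (y1, w)" and "Q2 w = B (y1, w)" for x w
  have PQ: "P1 \<in> polys" "Q1 \<in> polys" "P2 \<in> polys" "Q2 \<in> polys"
    unfolding P1_def[abs_def] Q1_def[abs_def] P2_def[abs_def] Q2_def[abs_def]
    by (rule bipolys_slice AB)+
  have "\<theta> (xs, y1) \<noteq> 0" "\<theta> (y1, ys) \<noteq> 0" using y1(2) by auto
  then have PQ_nz: "P1 xs \<noteq> 0" "Q1 xs \<noteq> 0" "P2 ys \<noteq> 0" "Q2 ys \<noteq> 0"
    using AB_nz by (auto simp: P1_def Q1_def P2_def Q2_def)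
  define \<theta>1 \<theta>2 where "\<theta>1 q = \<theta> (fst q, y1)" and "\<theta>2 q = \<theta> (y1, snd q)" for q
  have \<theta>12: "\<theta>1 \<in> bipolys" "\<theta>2 \<in> bipolys"
    unfolding \<theta>1_def[abs_def] \<theta>2_def[abs_def]
    using bipolys_fst[OF bipolys_slice(1)[OF \<theta>]] bipolys_snd[OF bipolys_slice(2)[OF \<theta>]] by blast+
  have \<theta>12_nz: "\<exists>q\<in>X \<times> X. \<theta>1 q \<noteq> 0" "\<exists>q\<in>X \<times> X. \<theta>2 q \<noteq> 0"
    using \<open>\<theta> (xs, y1) \<noteq> 0\<close> \<open>\<theta> (y1, ys) \<noteq> 0\<close> xy by (auto simp: \<theta>1_def \<theta>2_def intro!: bexI[of _ "(xs, ys)"])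
  define \<Theta> where "\<Theta> q = \<theta>1 q * \<theta>2 q * \<theta> q" for q
  have \<Theta>: "\<Theta> \<in> bipolys" unfolding \<Theta>_def[abs_def] by (intro bipolys_intros \<theta>12 \<theta>)
  have \<Theta>_nz: "\<exists>q\<in>X \<times> X. \<Theta> q \<noteq> 0"
    unfolding \<Theta>_def by (intro bipolys_mult_nonzero bipolys_intros \<theta>12 \<theta> \<theta>12_nz \<theta>_nz)
  define g where "g q = Polynomial.monom (P1 (fst q) * P2 (snd q)) M - [:Q1 (fst q) * Q2 (snd q):]" for q
  define h where "h q = Polynomial.smult (\<Theta> q) (g q)" for q
  have "(\<lambda>q. P1 (fst q) * P2 (snd q)) \<in> bipolys" "(\<lambda>q. Q1 (fst q) * Q2 (snd q)) \<in> bipolys"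
    by (intro bipolys_intros(3) bipolys_fst bipolys_snd PQ)+
  then have h: "h \<in> polyfam bipolys"
    unfolding h_def[abs_def] g_def
    by (intro bipolys.polyfam_smult polyfam.diff bipolys.polyfam_monom bipolys.polyfam_const \<Theta>)
  have h_root: "poly (h q) a = 0" if q: "q \<in> X \<times> X" "coeff (F q) d \<noteq> 0" and a: "poly (F q) a = 0" for q a
  proof (cases "\<Theta> q = 0")
    case False
    obtain x w where xw: "q = (x, w)" "x \<in> X" "w \<in> X" using q by auto
    have \<theta>s: "\<theta> (x, y1) \<noteq> 0" "\<theta> (y1, w) \<noteq> 0" "\<theta> (x, w) \<noteq> 0"
      using False by (auto simp: \<Theta>_def \<theta>1_def \<theta>2_def xw)
    have "A (x, w) * (Q1 x * Q2 w) = B (x, w) * (P1 x * P2 w)"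
      unfolding P1_def Q1_def P2_def Q2_def by (rule cocycle[OF xw(2) y1(1) xw(3) \<theta>s])
    moreover have "A (x, w) * a ^ M = B (x, w)" using rootM \<theta>s(3) a q(1) xw(1) by auto
    ultimately have "A (x, w) * (P1 x * P2 w * a ^ M - Q1 x * Q2 w) = 0" by (simp add: algebra_simps)
    then show ?thesis
      using AB_nz(1)[OF \<theta>s(3)] by (simp add: h_def g_def xw(1) poly_monom)
  qed (simp add: h_def)
  have "F q dvd h q ^ d" if q: "q \<in> X \<times> X" "coeff (F q) d \<noteq> 0" for q
  proof -
    have deg: "degree (F q) = d" using F'(2)[of q] le_degree[OF q(2)] by simp
    have "F q dvd h q ^ degree (F q) \<or> (F q = 0 \<and> h q = 0)"
      using h_root[OF q] nullstellensatz_univariate[of "F q" "h q"] by blast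
    then show ?thesis using deg q(2) by auto
  qed
  moreover have "(\<lambda>q. h q ^ d) \<in> polyfam bipolys"
  proof -
    have "(\<lambda>q. h q ^ n) \<in> polyfam bipolys" for n
      by (induction n) (use h polyfam.mult polyfam.one in \<open>simp_all\<close>)
    then show ?thesis .
  qed
  ultimately obtain k where k: "Van (\<lambda>p. coeff (F (endpoints p)) d ^ k * pval (\<lambda>q. h q ^ d) p)"
    using dvd_imp_Van[OF F, of "\<lambda>q. h q ^ d"] by blast
  have Rc: "Reg (\<lambda>p. coeff (F (endpoints p)) d ^ i)" for i
    by (rule Reg_jet_funs[OF jet_funs_power[OF bipolys_jet_funs[OF cF]]])
  have "Van (\<lambda>p. (coeff (F (endpoints p)) d ^ k * pval h p) ^ d)"
  proof (rule Van_cong[OF Van_mult[OF Rc[of "k * (d - 1)"] k]])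
    fix p
    have "k * (d - 1) + k = k * d" using F'(3) by (cases d) auto
    then show "coeff (F (endpoints p)) d ^ (k * (d - 1)) * (coeff (F (endpoints p)) d ^ k * pval (\<lambda>q. h q ^ d) p)
        = (coeff (F (endpoints p)) d ^ k * pval h p) ^ d"
      by (simp add: power_mult_distrib poly_power flip: power_mult power_add mult.assoc)
  qed
  then have V: "Van (\<lambda>p. coeff (F (endpoints p)) d ^ k * pval h p)"
    by (rule Van_radical[OF Reg_mult[OF Rc Reg_polyfam[OF h]]])
  define E where "E q = coeff (F q) d ^ k * \<Theta> q" for q
  have pow_nz: "\<exists>q\<in>X \<times> X. coeff (F q) d ^ k \<noteq> 0" using F'(4) by auto
  show ?thesis
  proof (rule that[of E \<theta> P1 P2 Q1 Q2 M])
    show "E \<in> bipolys" unfolding E_def[abs_def] by (intro bipolys_intros bipolys_power cF \<Theta>)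
    show "\<exists>q\<in>X \<times> X. E q \<noteq> 0"
      unfolding E_def by (intro bipolys_mult_nonzero bipolys_power cF \<Theta> \<Theta>_nz pow_nz)
    show "Van (\<lambda>p. E (endpoints p) * (P1 (src p) * P2 (tgt p) * p (Der 1) ^ M - Q1 (src p) * Q2 (tgt p)))"
      by (rule Van_cong[OF V]) (simp add: E_def h_def g_def poly_monom endpoints_def)
    show "\<exists>a. \<forall>h\<in>polyfam bipolys. Van (pval h) \<longrightarrow> poly (h q) a = 0" if "q \<in> X \<times> X" "\<theta> q \<noteq> 0" for q
      using ex_root[OF that(2)] vanish_at_roots[OF F _ _ that(1)] that(2) by (auto simp: \<theta>_def)
  qed (use PQ PQ_nz \<theta> \<theta>_nz \<open>M > 0\<close> xy in auto)
qed

end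

section \<open>Differential consequences of the multiplicative relation\<close>

context kummer_subideal
begin

text \<open>
  Membership of \<open>t\<close> in the ideal quotient of \<open>H\<close> by \<open>E\<close>, that is, vanishing on the groupoid outside
  the zeros of \<open>E\<close>.
\<close>
definition Van_off where "Van_off E t \<longleftrightarrow> Van (\<lambda>p. E (endpoints p) * t p)"

lemma Van_off_cong: "Van_off E f \<Longrightarrow> (\<And>p. p \<in> Aut_inf X \<Longrightarrow> f p = g p) \<Longrightarrow> Van_off E g"
  unfolding Van_off_def by (erule Van_cong) simp

lemma Van_off_diff: "Van_off E f \<Longrightarrow> Van_off E g \<Longrightarrow> Van_off E (\<lambda>p. f p - g p)"
  unfolding Van_off_def by (drule (1) Van_diff) (simp add: right_diff_distrib)

lemma Van_off_mult: "Reg f \<Longrightarrow> Van_off E g \<Longrightarrow> Van_off E (\<lambda>p. f p * g p)"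
  unfolding Van_off_def by (drule (1) Van_mult) (simp add: mult.left_commute)

lemma Van_off_Van: "E \<in> bipolys \<Longrightarrow> Van f \<Longrightarrow> Van_off E f"
  unfolding Van_off_def by (rule Van_mult[OF Reg_jet_funs[OF bipolys_jet_funs]])

text \<open>
  The ideal quotient of a radical differential ideal is differential again: multiplying the
  derivative of \<open>E t\<close> by \<open>E t'\<close> shows that the square of \<open>E t'\<close> lies in \<open>H\<close>.
\<close>
lemma Van_off_total_deriv:
  assumes E: "E \<in> bipolys" and t: "t \<in> jet_funs k" "Van_off E t" and t': "Reg t'"
    and td: "\<And>p. p \<in> Aut_inf X \<Longrightarrow> has_total_deriv X lam t p (t' p)"
  shows "Van_off E t'"
proof -
  let ?E = "\<lambda>p. E (endpoints p)"
  let ?E' = "\<lambda>p. dS E (endpoints p) + p (Der 1) * dT E (endpoints p)"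
  have RE: "Reg ?E" by (rule Reg_jet_funs[OF bipolys_jet_funs[OF E]])
  have RE': "Reg ?E'"
    by (intro Reg_add Reg_mult Reg_jet_funs[OF bipolys_jet_funs[OF dS(1)[OF E]]]
        Reg_jet_funs[OF bipolys_jet_funs[OF dT(1)[OF E]]] Reg_jet_funs[OF jet_funs_intros(4)[of 1 1]]) auto
  have "Van (\<lambda>p. ?E' p * t p + ?E p * t' p)"
    by (rule Van_total_deriv[OF jet_funs_intros(3)[OF bipolys_jet_funs[OF E] t(1)] t(2)[unfolded Van_off_def]])
      (intro has_total_deriv_mult has_total_deriv_bipolys E td)
  then have "Van (\<lambda>p. (?E p * t' p) * (?E' p * t p + ?E p * t' p) - (t' p * ?E' p) * (?E p * t p))"
    by (intro Van_diff Van_mult Reg_mult RE RE' t' t(2)[unfolded Van_off_def])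
  then have "Van (\<lambda>p. (?E p * t' p) ^ 2)"
    by (rule Van_cong) (simp add: algebra_simps power2_eq_square)
  then show ?thesis unfolding Van_off_def by (rule Van_radical[OF Reg_mult[OF RE t']])
qed

lemma Reg_Der: "i > 0 \<Longrightarrow> Reg (\<lambda>p. p (Der i))"
  using Reg_jet_funs[OF jet_funs_intros(4)[of i i]] by simp

lemma Reg_inverse: "Reg (\<lambda>p. inverse (p (Der 1)))"
  by (rule Reg_jet_funs[OF jet_funs_intros(5)[of 1]]) simp

lemma Reg_src: "f \<in> polys \<Longrightarrow> Reg (\<lambda>p. f (src p))"
  by (rule Reg_jet_funs[OF jet_funs_src])

lemma Reg_tgt: "f \<in> polys \<Longrightarrow> Reg (\<lambda>p. f (tgt p))"
  by (rule Reg_jet_funs[OF jet_funs_tgt])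

lemma Reg_power: "Reg f \<Longrightarrow> Reg (\<lambda>p. f p ^ n)"
  by (induction n) (auto intro: Reg_const Reg_mult)

text \<open>
  The logarithmic derivative of \<open>a^M = \<mu>(x) \<nu>(y)\<close> with \<open>\<mu> = Q1 / P1\<close> and \<open>\<nu> = Q2 / P2\<close>, cleared of
  denominators: \<open>b/a = s1/s2 + a r1/r2\<close>.
\<close>
lemma first_order_consequence:
  assumes E: "E \<in> bipolys" and P: "P1 \<in> polys" "P2 \<in> polys" "Q1 \<in> polys" "Q2 \<in> polys" and M: "M > (0::nat)"
    and V: "Van_off E (\<lambda>p. P1 (src p) * P2 (tgt p) * p (Der 1) ^ M - Q1 (src p) * Q2 (tgt p))"
  defines "s1 \<equiv> \<lambda>x. dX Q1 x * P1 x - dX P1 x * Q1 x" and "s2 \<equiv> \<lambda>x. of_nat M * (P1 x * Q1 x)"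
    and "r1 \<equiv> \<lambda>x. dX Q2 x * P2 x - dX P2 x * Q2 x" and "r2 \<equiv> \<lambda>x. of_nat M * (P2 x * Q2 x)"
  shows "Van_off E (\<lambda>p. s2 (src p) * r2 (tgt p) * (p (Der 2) * inverse (p (Der 1)))
      - r2 (tgt p) * s1 (src p) - p (Der 1) * (s2 (src p) * r1 (tgt p)))"
proof -
  let ?a = "\<lambda>p. p (Der 1)"
  let ?v = "\<lambda>p. p (Der 2) * inverse (p (Der 1))"
  let ?G = "\<lambda>p. P1 (src p) * P2 (tgt p) * ?a p ^ M - Q1 (src p) * Q2 (tgt p)"
  let ?G' = "\<lambda>p. (dX P1 (src p) * P2 (tgt p) + P1 (src p) * (?a p * dX P2 (tgt p))) * ?a p ^ M
    + P1 (src p) * P2 (tgt p) * (of_nat M * ?a p ^ (M - 1) * p (Der 2))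
    - (dX Q1 (src p) * Q2 (tgt p) + Q1 (src p) * (?a p * dX Q2 (tgt p)))"
  \<comment> \<open>\<open>?w\<close> is \<open>P1 P2\<close> times the logarithmic derivative of \<open>P1 P2 a^M\<close>; subtracting \<open>?w\<close> times the relation
    replaces \<open>P1 P2 a^M\<close> by \<open>Q1 Q2\<close> in \<open>P1 P2\<close> times its derivative.\<close>
  let ?w = "\<lambda>p. dX P1 (src p) * P2 (tgt p) + ?a p * (P1 (src p) * dX P2 (tgt p))
    + of_nat M * (P1 (src p) * P2 (tgt p)) * ?v p"
  note R = Reg_src[OF P(1)] Reg_tgt[OF P(2)] Reg_src[OF P(3)] Reg_tgt[OF P(4)]
    Reg_src[OF dX_in[OF P(1)]] Reg_tgt[OF dX_in[OF P(2)]] Reg_src[OF dX_in[OF P(3)]] Reg_tgt[OF dX_in[OF P(4)]]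
  have a: "Reg ?a" by (rule Reg_Der) simp
  have b: "Reg (\<lambda>p. p (Der 2))" by (rule Reg_Der) simp
  have D1: "has_total_deriv X lam (\<lambda>p. p (Der 1)) p (p (Der 2))" for p
    using has_total_deriv_Der[of 1 X lam p] by (simp add: numeral_2_eq_2)
  have VG': "Van_off E ?G'"
  proof (rule Van_off_total_deriv[OF E _ V])
    show "?G \<in> jet_funs 1"
      by (intro jet_funs_diff jet_funs_intros(3) jet_funs_power jet_funs_intros(4)
          jet_funs_src[OF P(1)] jet_funs_tgt[OF P(2)] jet_funs_src[OF P(3)] jet_funs_tgt[OF P(4)]) auto
    show "Reg ?G'" by (intro Reg_diff Reg_add Reg_mult Reg_power Reg_const a b R)
    show "has_total_deriv X lam ?G p (?G' p)" if "p \<in> Aut_inf X" for p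
      by (intro has_total_deriv_diff has_total_deriv_mult has_total_deriv_power D1
          has_total_deriv_src_dX[OF P(1) that] has_total_deriv_tgt_dX[OF P(2) that]
          has_total_deriv_src_dX[OF P(3) that] has_total_deriv_tgt_dX[OF P(4) that])
  qed
  have "Van_off E (\<lambda>p. (of_nat M * (P1 (src p) * P2 (tgt p))) * ?G' p - (of_nat M * ?w p) * ?G p)"
    by (rule Van_off_diff[OF Van_off_mult[OF _ VG'] Van_off_mult[OF _ V]])
      (intro Reg_mult Reg_add Reg_const R a b Reg_inverse)+
  then show ?thesis
  proof (rule Van_off_cong)
    fix p assume p: "p \<in> Aut_inf X"
    have "p (Der 1) ^ (M - 1) * p (Der 2) = p (Der 1) ^ M * ?v p"
      using Aut_inf_Der1[OF p] M by (cases M) (simp_all del: One_nat_def)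
    then have G': "?G' p = ?a p ^ M * ?w p - (dX Q1 (src p) * Q2 (tgt p) + ?a p * (Q1 (src p) * dX Q2 (tgt p)))"
      by (simp add: algebra_simps)
    show "(of_nat M * (P1 (src p) * P2 (tgt p))) * ?G' p - (of_nat M * ?w p) * ?G p
      = s2 (src p) * r2 (tgt p) * ?v p - r2 (tgt p) * s1 (src p) - ?a p * (s2 (src p) * r1 (tgt p))"
      unfolding G' s1_def s2_def r1_def r2_def by (simp add: algebra_simps)
  qed
qed

text \<open>
  The derivative of \<open>v = b/a\<close> is \<open>v\<^sup>2/2 + R(x) - R(y) a\<^sup>2\<close> by the Kummer equation. Inserting
  \<open>v = \<sigma> + a \<rho>\<close>, all terms that are linear in \<open>a\<close> cancel, and one is left with a function of \<open>x\<close> plus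
  \<open>a\<^sup>2\<close> times a function of \<open>y\<close>.
\<close>
lemma second_order_consequence:
  assumes E: "E \<in> bipolys" and s: "s1 \<in> polys" "s2 \<in> polys" "r1 \<in> polys" "r2 \<in> polys"
    and V: "Van_off E (\<lambda>p. s2 (src p) * r2 (tgt p) * (p (Der 2) * inverse (p (Der 1)))
      - r2 (tgt p) * s1 (src p) - p (Der 1) * (s2 (src p) * r1 (tgt p)))"
  defines "t \<equiv> \<lambda>x. dX s1 x * s2 x - s1 x * dX s2 x - s1 x ^ 2 / 2 - R x * s2 x ^ 2"
    and "n \<equiv> \<lambda>y. dX r1 y * r2 y - r1 y * dX r2 y + r1 y ^ 2 / 2 + R y * r2 y ^ 2"
  shows "Van_off E (\<lambda>p. r2 (tgt p) ^ 2 * t (src p) + p (Der 1) ^ 2 * (s2 (src p) ^ 2 * n (tgt p)))"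
proof -
  let ?a = "\<lambda>p. p (Der 1)"
  let ?i = "\<lambda>p. inverse (p (Der 1))"
  let ?v = "\<lambda>p. p (Der 2) * inverse (p (Der 1))"
  let ?V = "\<lambda>p. s2 (src p) * r2 (tgt p) * ?v p - r2 (tgt p) * s1 (src p) - ?a p * (s2 (src p) * r1 (tgt p))"
  let ?v' = "\<lambda>p. p (Der 3) * ?i p + p (Der 2) * (- p (Der 2) * ?i p ^ 2)"
  let ?V' = "\<lambda>p. (dX s2 (src p) * r2 (tgt p) + s2 (src p) * (?a p * dX r2 (tgt p))) * ?v p
      + s2 (src p) * r2 (tgt p) * ?v' p
      - (?a p * dX r2 (tgt p) * s1 (src p) + r2 (tgt p) * dX s1 (src p))
      - (p (Der 2) * (s2 (src p) * r1 (tgt p))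
          + ?a p * (dX s2 (src p) * r1 (tgt p) + s2 (src p) * (?a p * dX r1 (tgt p))))"
  note R' = Reg_src[OF s(1)] Reg_src[OF s(2)] Reg_tgt[OF s(3)] Reg_tgt[OF s(4)]
    Reg_src[OF dX_in[OF s(1)]] Reg_src[OF dX_in[OF s(2)]] Reg_tgt[OF dX_in[OF s(3)]] Reg_tgt[OF dX_in[OF s(4)]]
  have a: "Reg ?a" by (rule Reg_Der) simp
  have b: "Reg (\<lambda>p. p (Der 2))" by (rule Reg_Der) simp
  have c: "Reg (\<lambda>p. p (Der 3))" by (rule Reg_Der) simp
  have nb: "Reg (\<lambda>p. - p (Der 2))" using Reg_mult[OF Reg_const[of "-1"] b] by simp
  have D: "has_total_deriv X lam (\<lambda>p. p (Der 1)) p (p (Der 2))"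
    "has_total_deriv X lam (\<lambda>p. p (Der 2)) p (p (Der 3))" for p
    using has_total_deriv_Der[of 1 X lam p] has_total_deriv_Der[of 2 X lam p]
    by (simp_all add: numeral_2_eq_2 numeral_3_eq_3)
  have VV': "Van_off E ?V'"
  proof (rule Van_off_total_deriv[OF E _ V])
    show "?V \<in> jet_funs 2"
      by (intro jet_funs_diff jet_funs_intros(3) jet_funs_intros(4,5)
          jet_funs_src[OF s(1)] jet_funs_src[OF s(2)] jet_funs_tgt[OF s(3)] jet_funs_tgt[OF s(4)]) auto
    show "Reg ?V'" by (intro Reg_diff Reg_add Reg_mult Reg_power a b nb c Reg_inverse R')
    show "has_total_deriv X lam ?V p (?V' p)" if "p \<in> Aut_inf X" for p
      by (intro has_total_deriv_diff has_total_deriv_mult has_total_deriv_inverse D Aut_inf_Der1[OF that]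
          has_total_deriv_src_dX[OF s(1) that] has_total_deriv_src_dX[OF s(2) that]
          has_total_deriv_tgt_dX[OF s(3) that] has_total_deriv_tgt_dX[OF s(4) that])
  qed
  have V2: "Van_off E (\<lambda>p. ?V' p - (s2 (src p) * r2 (tgt p)) * kummer_fun R p)"
    by (rule Van_off_diff[OF VV' Van_off_mult[OF _ Van_off_Van[OF E Van_kummer]]]) (intro Reg_mult R')
  \<comment> \<open>\<open>s2 r2\<close> times the derivative of the relation is quadratic in \<open>s2 r2 v\<close>; \<open>?m\<close> is the quotient on
    division by the relation, which replaces \<open>s2 r2 v\<close> by \<open>?\<rho>\<close>.\<close>
  let ?\<rho> = "\<lambda>p. r2 (tgt p) * s1 (src p) + ?a p * (s2 (src p) * r1 (tgt p))"
  let ?x = "\<lambda>p. s2 (src p) * r2 (tgt p) * ?v p"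
  let ?m = "\<lambda>p. dX s2 (src p) * r2 (tgt p) + ?a p * (s2 (src p) * dX r2 (tgt p))
      + 1/2 * (?x p + ?\<rho> p) - ?a p * (s2 (src p) * r1 (tgt p))"
  have "Van_off E (\<lambda>p. ?m p * ?V p
      - (s2 (src p) * r2 (tgt p)) * (?V' p - (s2 (src p) * r2 (tgt p)) * kummer_fun R p))"
    by (rule Van_off_diff[OF Van_off_mult[OF _ V] Van_off_mult[OF _ V2]])
      (intro Reg_mult Reg_add Reg_diff Reg_const R' a b Reg_inverse)+
  then show ?thesis
  proof (rule Van_off_cong)
    fix p assume p: "p \<in> Aut_inf X"
    define A v S1 S2 R1 R2 S1' S2' R1' R2' Rx Ry where "A = ?a p" and "v = ?v p"
      and "S1 = s1 (src p)" and "S2 = s2 (src p)" and "R1 = r1 (tgt p)" and "R2 = r2 (tgt p)"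
      and "S1' = dX s1 (src p)" and "S2' = dX s2 (src p)" and "R1' = dX r1 (tgt p)" and "R2' = dX r2 (tgt p)"
      and "Rx = R (src p)" and "Ry = R (tgt p)"
    note defs = A_def[symmetric] S1_def[symmetric] S2_def[symmetric] R1_def[symmetric] R2_def[symmetric]
      S1'_def[symmetric] S2'_def[symmetric] R1'_def[symmetric] R2'_def[symmetric] Rx_def[symmetric] Ry_def[symmetric]
    have A0: "A \<noteq> 0" using Aut_inf_Der1[OF p] by (simp add: A_def)
    have b: "p (Der 2) = A * v" using A0 by (simp add: v_def A_def)
    have "kummer_fun R p = p (Der 3) * ?i p - 3/2 * v ^ 2 - Rx + Ry * A ^ 2"
      unfolding kummer_fun_alt v_def Rx_def Ry_def A_def ..
    then have c: "p (Der 3) * ?i p = kummer_fun R p + 3/2 * v ^ 2 + Rx - Ry * A ^ 2"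
      by simp
    have v': "?v' p = kummer_fun R p + v ^ 2 / 2 + Rx - Ry * A ^ 2"
    proof -
      have "p (Der 2) * (- p (Der 2) * ?i p ^ 2) = - (v ^ 2)"
        unfolding v_def by (simp add: power2_eq_square)
      then show ?thesis unfolding c by simp
    qed
    have V'p: "?V' p - (s2 (src p) * r2 (tgt p)) * kummer_fun R p
      = (S2' * R2 + S2 * (A * R2')) * v + S2 * R2 * (v ^ 2 / 2 + Rx - Ry * A ^ 2)
      - (A * R2' * S1 + R2 * S1') - (A * v * (S2 * R1) + A * (S2' * R1 + S2 * (A * R1')))"
      unfolding v' unfolding v_def[symmetric] unfolding b defs by (simp add: algebra_simps)
    show "?m p * ?V p - (s2 (src p) * r2 (tgt p)) * (?V' p - (s2 (src p) * r2 (tgt p)) * kummer_fun R p)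
      = r2 (tgt p) ^ 2 * t (src p) + ?a p ^ 2 * (s2 (src p) ^ 2 * n (tgt p))"
      unfolding V'p t_def n_def unfolding v_def[symmetric] unfolding defs
      by (simp add: field_simps power2_eq_square)
  qed
qed

text \<open>
  With \<open>\<sigma> = s1/s2\<close> and \<open>\<tau> = t/s2\<^sup>2\<close> the hypotheses say \<open>\<tau> = \<sigma>' - \<sigma>\<^sup>2/2 - R\<close> and \<open>\<tau>' = 2 \<sigma> \<tau>\<close>, and
  \<open>(2 s2 u + s1)\<^sup>2 - 2 t\<close> is the Darboux polynomial whose roots are \<open>- \<sigma>/2 \<plusminus> sqrt (\<tau>/2)\<close>.
\<close>
lemma riccati_of_exponent:
  assumes s: "s1 \<in> polys" "s2 \<in> polys" and nz: "\<exists>x\<in>X. s2 x \<noteq> 0"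
    and t: "\<And>x. x \<in> X \<Longrightarrow> t x = dX s1 x * s2 x - s1 x * dX s2 x - s1 x ^ 2 / 2 - R x * s2 x ^ 2" "t \<in> polys"
    and t': "\<And>x. x \<in> X \<Longrightarrow> s2 x * dX t x = 2 * (dX s2 x + s1 x) * t x"
  shows "\<exists>r\<in>carrier L. \<delta> r \<oplus>\<^bsub>L\<^esub> r \<otimes>\<^bsub>L\<^esub> r \<oplus>\<^bsub>L\<^esub> embed (\<lambda>x. 1 / 2 * R x) = \<zero>\<^bsub>L\<^esub>"
proof -
  define g where "g j = (if j = 0 then (\<lambda>x. s1 x ^ 2 - 2 * t x) else if j = 1 then (\<lambda>x. 4 * (s1 x * s2 x))
    else if j = 2 then (\<lambda>x. 4 * s2 x ^ 2) else (\<lambda>x. 0))" for j :: nat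
  have g: "g j \<in> polys" for j
    unfolding g_def using s t(2) by (auto intro!: diff_in cmult_in mult_in power_in const_in)
  obtain x0 where x0: "x0 \<in> X" "s2 x0 \<noteq> 0" using nz by blast
  show ?thesis
  proof (rule riccati_of_darboux[where g = g and n = 2 and c = s2 and ?l1.0 = "\<lambda>x. -2 * s2 x"
        and ?l0.0 = "\<lambda>x. 2 * dX s2 x + s1 x" and ?x0.0 = x0 and ?x1.0 = x0])
    show "(\<lambda>x. -2 * s2 x) \<in> polys" "(\<lambda>x. 2 * dX s2 x + s1 x) \<in> polys"
      by (rule cmult_in add_in dX_in s)+
    fix j :: nat and x assume x: "x \<in> X"
    have gv: "g 0 = (\<lambda>x. s1 x ^ 2 - 2 * t x)" "g (Suc 0) = (\<lambda>x. 4 * (s1 x * s2 x))"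
      "g (Suc (Suc 0)) = (\<lambda>x. 4 * s2 x ^ 2)" "g (Suc (Suc (Suc i))) = (\<lambda>x. 0)" for i
      by (simp_all add: g_def fun_eq_iff)
    have D: "dX (g 0) x = 2 * s1 x * dX s1 x - 2 * dX t x"
      "dX (g (Suc 0)) x = 4 * (dX s1 x * s2 x + s1 x * dX s2 x)"
      "dX (g (Suc (Suc 0))) x = 8 * s2 x * dX s2 x" "dX (g (Suc (Suc (Suc i)))) x = 0" for i
      unfolding gv using s t(2) x by (simp_all add: D_diff D_cmult D_power D_mult D_const power_in mult_in cmult_in)
    have e1: "dX s1 x * s2 x = t x + s1 x * dX s2 x + s1 x ^ 2 / 2 + R x * s2 x ^ 2"
      using t(1)[OF x] by simp
    have \<Delta>s: "\<Delta> (\<lambda>x. 1 / 2 * R x) g 0 x = 2 * s1 x * dX s1 x - 2 * dX t x - 2 * R x * s1 x * s2 x"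
      "\<Delta> (\<lambda>x. 1 / 2 * R x) g (Suc 0) x = 4 * (dX s1 x * s2 x + s1 x * dX s2 x) - 4 * R x * s2 x ^ 2"
      "\<Delta> (\<lambda>x. 1 / 2 * R x) g (Suc (Suc 0)) x = 8 * s2 x * dX s2 x - 4 * (s1 x * s2 x)"
      "\<Delta> (\<lambda>x. 1 / 2 * R x) g (Suc (Suc (Suc 0))) x = - (8 * s2 x ^ 2)"
      "\<Delta> (\<lambda>x. 1 / 2 * R x) g (Suc (Suc (Suc (Suc i)))) x = 0" for i
      unfolding \<Delta>_def formal_deriv_def shift_def D by (simp_all add: gv)
    have sh: "shift g 0 x = 0" "shift g (Suc i) x = g i x" for i by (simp_all add: shift_def)
    consider "j = 0" | "j = Suc 0" | "j = Suc (Suc 0)" | "j = Suc (Suc (Suc 0))" | i where "j = Suc (Suc (Suc (Suc i)))"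
      by (metis not0_implies_Suc)
    then show "s2 x * \<Delta> (\<lambda>x. 1 / 2 * R x) g j x = -2 * s2 x * shift g j x + (2 * dX s2 x + s1 x) * g j x"
    proof cases
      case 1
      have "s2 x * \<Delta> (\<lambda>x. 1 / 2 * R x) g 0 x
          = 2 * s1 x * (dX s1 x * s2 x) - 2 * (s2 x * dX t x) - 2 * R x * s1 x * s2 x ^ 2"
        unfolding \<Delta>s by (simp add: algebra_simps power2_eq_square)
      also have "\<dots> = (2 * dX s2 x + s1 x) * (s1 x ^ 2 - 2 * t x)"
        unfolding e1 t'[OF x] by (simp add: algebra_simps power2_eq_square)
      finally show ?thesis unfolding 1 sh gv by simp
    next
      case 2
      have "s2 x * \<Delta> (\<lambda>x. 1 / 2 * R x) g (Suc 0) x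
          = 4 * s2 x * (dX s1 x * s2 x) + 4 * s1 x * s2 x * dX s2 x - 4 * R x * s2 x ^ 3"
        unfolding \<Delta>s by (simp add: algebra_simps power2_eq_square power3_eq_cube)
      also have "\<dots> = -2 * s2 x * (s1 x ^ 2 - 2 * t x) + (2 * dX s2 x + s1 x) * (4 * (s1 x * s2 x))"
        unfolding e1 by (simp add: algebra_simps power2_eq_square power3_eq_cube)
      finally show ?thesis unfolding 2 sh gv .
    next
      case 3
      show ?thesis unfolding 3 \<Delta>s sh gv by (simp add: algebra_simps power2_eq_square)
    next
      case 4
      show ?thesis unfolding 4 \<Delta>s sh gv by (simp add: algebra_simps power2_eq_square)
    next
      case (5 i)
      show ?thesis unfolding 5 \<Delta>s sh gv by simp
    qed
  qed (use g s x0 in \<open>auto simp: g_def\<close>)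
qed

text \<open>
  At a general pair of points some \<open>a\<close> satisfies both \<open>P1 P2 a^M = Q1 Q2\<close> and
  \<open>r2\<^sup>2 t = - a\<^sup>2 s2\<^sup>2 n\<close>. The \<open>M\<close>-th power of the second relation contains \<open>a\<close> only through \<open>a^M\<close>, which
  the first relation eliminates; what is left separates \<open>x\<close> from \<open>y\<close>, and at a constant value of \<open>y\<close> it
  can be differentiated.
\<close>
lemma discrete_case:
  assumes F: "F \<in> polyfam bipolys" "Van (pval F)" "q0 \<in> X \<times> X" "F q0 \<noteq> 0"
    and grp: "rational_subgroupoid 1 X (truncation X H 1)"
  shows "\<exists>r\<in>carrier L. \<delta> r \<oplus>\<^bsub>L\<^esub> r \<otimes>\<^bsub>L\<^esub> r \<oplus>\<^bsub>L\<^esub> embed (\<lambda>x. 1 / 2 * R x) = \<zero>\<^bsub>L\<^esub>"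
proof -
  obtain F d where Fd: "minimal_order1 F d" using ex_minimal_order1[OF F] by blast
  obtain E \<Omega> P1 P2 Q1 Q2 M where
    E: "E \<in> bipolys" and \<Omega>: "\<Omega> \<in> bipolys"
    and P: "P1 \<in> polys" "P2 \<in> polys" "Q1 \<in> polys" "Q2 \<in> polys" and M: "M > (0::nat)"
    and nz: "\<exists>q\<in>X \<times> X. E q \<noteq> 0" "\<exists>q\<in>X \<times> X. \<Omega> q \<noteq> 0"
      "\<exists>x\<in>X. P1 x \<noteq> 0" "\<exists>x\<in>X. P2 x \<noteq> 0" "\<exists>x\<in>X. Q1 x \<noteq> 0" "\<exists>x\<in>X. Q2 x \<noteq> 0"
    and V: "Van (\<lambda>p. E (endpoints p) * (P1 (src p) * P2 (tgt p) * p (Der 1) ^ M - Q1 (src p) * Q2 (tgt p)))"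
    and root: "\<And>q. q \<in> X \<times> X \<Longrightarrow> \<Omega> q \<noteq> 0 \<Longrightarrow>
      \<exists>a. \<forall>h\<in>polyfam bipolys. Van (pval h) \<longrightarrow> poly (h q) a = 0"
    by (rule power_relation[OF Fd grp]) (rule that)
  define s1 s2 r1 r2 where "s1 = (\<lambda>x. dX Q1 x * P1 x - dX P1 x * Q1 x)" and "s2 = (\<lambda>x. of_nat M * (P1 x * Q1 x))"
    and "r1 = (\<lambda>x. dX Q2 x * P2 x - dX P2 x * Q2 x)" and "r2 = (\<lambda>x. of_nat M * (P2 x * Q2 x))"
  have s: "s1 \<in> polys" "s2 \<in> polys" "r1 \<in> polys" "r2 \<in> polys"
    unfolding s1_def s2_def r1_def r2_def by (intro diff_in cmult_in mult_in dX_in P)+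
  have V1: "Van_off E (\<lambda>p. s2 (src p) * r2 (tgt p) * (p (Der 2) * inverse (p (Der 1)))
      - r2 (tgt p) * s1 (src p) - p (Der 1) * (s2 (src p) * r1 (tgt p)))"
    unfolding s1_def s2_def r1_def r2_def
    by (rule first_order_consequence[OF E P M]) (use V in \<open>simp add: Van_off_def\<close>)
  define t n where "t = (\<lambda>x. dX s1 x * s2 x - s1 x * dX s2 x - s1 x ^ 2 / 2 - R x * s2 x ^ 2)"
    and "n = (\<lambda>y. dX r1 y * r2 y - r1 y * dX r2 y + r1 y ^ 2 / 2 + R y * r2 y ^ 2)"
  have tn: "t \<in> polys" "n \<in> polys"
  proof -
    have "(\<lambda>x. dX s1 x * s2 x - s1 x * dX s2 x - 1/2 * s1 x ^ 2 - R x * s2 x ^ 2) \<in> polys"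
      by (intro diff_in mult_in cmult_in power_in dX_in s R)
    then show "t \<in> polys" by (simp add: t_def)
    have "(\<lambda>y. dX r1 y * r2 y - r1 y * dX r2 y + 1/2 * r1 y ^ 2 + R y * r2 y ^ 2) \<in> polys"
      by (intro add_in diff_in mult_in cmult_in power_in dX_in s R)
    then show "n \<in> polys" by (simp add: n_def)
  qed
  have V2: "Van_off E (\<lambda>p. r2 (tgt p) ^ 2 * t (src p) + p (Der 1) ^ 2 * (s2 (src p) ^ 2 * n (tgt p)))"
    unfolding t_def n_def by (rule second_order_consequence[OF E s V1])

  \<comment> \<open>The two relations as polynomials in \<open>a\<close>, so that they hold at the points provided by \<open>root\<close>.\<close>
  define h1 where "h1 q = Polynomial.smult (E q) (Polynomial.monom (P1 (fst q) * P2 (snd q)) M - [:Q1 (fst q) * Q2 (snd q):])" for q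
  define h2 where "h2 q = Polynomial.smult (E q) ([:r2 (snd q) ^ 2 * t (fst q):] + Polynomial.monom (s2 (fst q) ^ 2 * n (snd q)) 2)" for q
  note bi = bipolys_fst[OF P(1)] bipolys_snd[OF P(2)] bipolys_fst[OF P(3)] bipolys_snd[OF P(4)]
    bipolys_fst[OF s(2)] bipolys_snd[OF s(4)] bipolys_fst[OF tn(1)] bipolys_snd[OF tn(2)]
  have h: "h1 \<in> polyfam bipolys" "h2 \<in> polyfam bipolys"
    unfolding h1_def[abs_def] h2_def[abs_def]
    by (intro bipolys.polyfam_smult polyfam.diff polyfam.add bipolys.polyfam_monom bipolys.polyfam_const
        bipolys_intros(3) bipolys_power bi E)+
  have Vh: "Van (pval h1)" "Van (pval h2)"
    using V V2 unfolding Van_off_def by (auto simp: h1_def h2_def poly_monom endpoints_def algebra_simps)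

  have rel: "t x ^ M * P1 x ^ 2 * ((r2 y ^ 2) ^ M * P2 y ^ 2) = (s2 x ^ 2) ^ M * Q1 x ^ 2 * ((- n y) ^ M * Q2 y ^ 2)"
    if xy: "x \<in> X" "y \<in> X" for x y
  proof -
    let ?d = "\<lambda>q. t (fst q) ^ M * P1 (fst q) ^ 2 * ((r2 (snd q) ^ 2) ^ M * P2 (snd q) ^ 2)
        - (s2 (fst q) ^ 2) ^ M * Q1 (fst q) ^ 2 * ((-1 * n (snd q)) ^ M * Q2 (snd q) ^ 2)"
    have "?d \<in> bipolys"
      by (intro bipolys.diff bipolys_intros(3) bipolys_power bi bipolys_intros(1))
    moreover have "(E q * \<Omega> q) * ?d q = 0" if q: "q \<in> X \<times> X" for q
    proof (cases "E q * \<Omega> q = 0")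
      case False
      then obtain a where a: "poly (h1 q) a = 0" "poly (h2 q) a = 0" using root[OF q] h Vh by force
      obtain x y where [simp]: "q = (x, y)" by (cases q)
      have 1: "P1 x * P2 y * a ^ M = Q1 x * Q2 y" using a(1) False by (simp add: h1_def poly_monom)
      have "r2 y ^ 2 * t x + s2 x ^ 2 * n y * a ^ 2 = 0"
        using a(2) False by (simp add: h2_def poly_monom)
      then have 2: "r2 y ^ 2 * t x = a ^ 2 * (s2 x ^ 2 * (- n y))"
        by (simp add: algebra_simps eq_neg_iff_add_eq_0)
      have "t x ^ M * P1 x ^ 2 * ((r2 y ^ 2) ^ M * P2 y ^ 2) = (r2 y ^ 2 * t x) ^ M * (P1 x * P2 y) ^ 2"
        by (simp only: power_mult_distrib mult_ac)
      also have "\<dots> = (s2 x ^ 2 * (- n y)) ^ M * (P1 x * P2 y * a ^ M) ^ 2"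
        unfolding 2 by (simp only: power_mult_distrib mult_ac power_mult[symmetric])
      also have "\<dots> = (s2 x ^ 2) ^ M * Q1 x ^ 2 * ((- n y) ^ M * Q2 y ^ 2)"
        unfolding 1 by (simp only: power_mult_distrib mult_ac)
      finally show ?thesis by simp
    qed simp
    ultimately have "\<forall>q\<in>X \<times> X. ?d q = 0"
      using bipolys_no_zero_divisors[OF bipolys_intros(3)[OF E \<Omega>], of ?d] bipolys_mult_nonzero[OF E \<Omega> nz(1,2)] by blast
    from bspec[OF this, of "(x, y)"] xy show ?thesis by simp
  qed

  have s2_nz: "\<exists>x\<in>X. s2 x \<noteq> 0" and r2_nz: "\<exists>x\<in>X. r2 x \<noteq> 0"
    using polys_mult_nonzero[OF P(1,3) nz(3,5)] polys_mult_nonzero[OF P(2,4) nz(4,6)] M by (auto simp: s2_def r2_def)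
  obtain y where y: "y \<in> X" "r2 y * P2 y \<noteq> 0" using polys_mult_nonzero[OF s(4) P(2) r2_nz nz(4)] by blast
  define k where "k = ((- n y) ^ M * Q2 y ^ 2) / ((r2 y ^ 2) ^ M * P2 y ^ 2)"
  have tk: "t x ^ M * P1 x ^ 2 = k * ((s2 x ^ 2) ^ M * Q1 x ^ 2)" if "x \<in> X" for x
    using rel[OF that y(1)] y(2) by (simp add: k_def field_simps)

  \<comment> \<open>The derivative of \<open>tk\<close>, multiplied by \<open>s2 P1 Q1\<close> and simplified by \<open>tk\<close> itself, is the claim
    multiplied by \<open>?c\<close>.\<close>
  have t': "s2 x * dX t x = 2 * (dX s2 x + s1 x) * t x" if x: "x \<in> X" for x
  proof -
    let ?f = "\<lambda>x. s2 x * dX t x - 2 * (dX s2 x + s1 x) * t x"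
    let ?c = "\<lambda>x. P1 x ^ 2 * t x ^ (M - 1) * s2 x"
    obtain m where m: "M = Suc m" using M by (cases M) auto
    have fc: "?f \<in> polys" "?c \<in> polys"
      by (intro diff_in mult_in cmult_in add_in power_in dX_in s tn P)+
    have z: "?c x * ?f x = 0" if x: "x \<in> X" for x
    proof -
      have "dX (\<lambda>x. t x ^ M * P1 x ^ 2) x = dX (\<lambda>x. k * ((s2 x ^ 2) ^ M * Q1 x ^ 2)) x"
        by (rule D_cong) (use tk x in \<open>auto intro!: mult_in power_in cmult_in s tn P\<close>)
      moreover have "dX (\<lambda>x. t x ^ M * P1 x ^ 2) x
          = of_nat M * t x ^ (M - 1) * dX t x * P1 x ^ 2 + t x ^ M * (2 * P1 x * dX P1 x)"
        using x by (simp add: D_mult D_power power_in tn P)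
      moreover have "dX (\<lambda>x. k * ((s2 x ^ 2) ^ M * Q1 x ^ 2)) x
          = k * (of_nat M * (s2 x ^ 2) ^ (M - 1) * (2 * s2 x * dX s2 x) * Q1 x ^ 2 + (s2 x ^ 2) ^ M * (2 * Q1 x * dX Q1 x))"
        using x by (simp add: D_cmult D_mult D_power power_in mult_in s P)
      ultimately have eq: "of_nat M * t x ^ (M - 1) * dX t x * P1 x ^ 2 + t x ^ M * (2 * P1 x * dX P1 x)
          = k * (of_nat M * (s2 x ^ 2) ^ (M - 1) * (2 * s2 x * dX s2 x) * Q1 x ^ 2 + (s2 x ^ 2) ^ M * (2 * Q1 x * dX Q1 x))"
        by simp
      have "s2 x * P1 x * Q1 x * (of_nat M * t x ^ (M - 1) * dX t x * P1 x ^ 2 + t x ^ M * (2 * P1 x * dX P1 x))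
        = 2 * of_nat M * P1 x * Q1 x * dX s2 x * (k * ((s2 x ^ 2) ^ M * Q1 x ^ 2))
          + 2 * s2 x * P1 x * dX Q1 x * (k * ((s2 x ^ 2) ^ M * Q1 x ^ 2))"
        unfolding eq by (simp add: m algebra_simps power2_eq_square)
      also have "\<dots> = 2 * of_nat M * P1 x * Q1 x * dX s2 x * (t x ^ M * P1 x ^ 2)
          + 2 * s2 x * P1 x * dX Q1 x * (t x ^ M * P1 x ^ 2)"
        unfolding tk[OF x] ..
      finally have e: "s2 x * P1 x * Q1 x * (of_nat M * t x ^ (M - 1) * dX t x * P1 x ^ 2 + t x ^ M * (2 * P1 x * dX P1 x))
        = 2 * of_nat M * P1 x * Q1 x * dX s2 x * (t x ^ M * P1 x ^ 2)
          + 2 * s2 x * P1 x * dX Q1 x * (t x ^ M * P1 x ^ 2)" .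
      have "?c x * ?f x = P1 x ^ 2 * t x ^ (M - 1) * (s2 x * (of_nat M * (P1 x * Q1 x)) * dX t x
          - 2 * dX s2 x * (of_nat M * (P1 x * Q1 x)) * t x
          - 2 * s2 x * (dX Q1 x * P1 x - dX P1 x * Q1 x) * t x)"
        by (simp add: m s1_def s2_def algebra_simps)
      also have "\<dots> = s2 x * P1 x * Q1 x * (of_nat M * t x ^ (M - 1) * dX t x * P1 x ^ 2 + t x ^ M * (2 * P1 x * dX P1 x))
        - (2 * of_nat M * P1 x * Q1 x * dX s2 x * (t x ^ M * P1 x ^ 2)
          + 2 * s2 x * P1 x * dX Q1 x * (t x ^ M * P1 x ^ 2))"
        by (simp add: m algebra_simps power2_eq_square)
      finally show ?thesis unfolding e by simp
    qed
    from no_zero_divisors[OF fc(2,1) z] consider "\<forall>x\<in>X. ?c x = 0" | "\<forall>x\<in>X. ?f x = 0" by blast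
    then show ?thesis
    proof cases
      case 1
      have "\<forall>x\<in>X. t x = 0"
      proof (rule ccontr)
        assume t0: "\<not> ?thesis"
        have pw: "\<exists>x\<in>X. f x ^ i \<noteq> 0" if "\<exists>x\<in>X. f x \<noteq> 0" for f :: "('n \<Rightarrow> complex) \<Rightarrow> complex" and i
          using that by auto
        have "\<exists>x\<in>X. ?c x \<noteq> 0"
          by (intro polys_mult_nonzero mult_in power_in P tn s pw nz s2_nz) (use t0 in blast)
        with 1 show False by blast
      qed
      then have tx: "t x = 0" "dX t x = 0"
        using x D_cong[OF tn(1) const_in[of 0] _ x] D_const[OF x, of 0] by auto
      then show ?thesis by simp
    qed (use x in auto)
  qed
  show ?thesis
    by (rule riccati_of_exponent[OF s(1,2) s2_nz _ tn(1) t']) (simp_all add: t_def)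
qed

end

section \<open>The Kummer groupoid has no proper subgroupoid of positive order\<close>

text \<open>
  Positive order means that the truncation of order 0 is all of \<open>X \<times> X\<close>, so that no nonzero
  function of the endpoints vanishes on the groupoid. The inequality of the two ideals yields an
  element of order at most 2 that does not vanish identically. Whether there also is one of order 1
  decides between the two constructions of a solution of the Riccati equation.
\<close>
theorem theorem3p3:
  fixes X :: "('n::finite \<Rightarrow> complex) set"
    and lam R :: "('n \<Rightarrow> complex) \<Rightarrow> complex"
    and L :: "'l ring"
    and e :: "(('n \<Rightarrow> complex) \<Rightarrow> complex) \<Rightarrow> 'l"
    and \<delta> :: "'l \<Rightarrow> 'l"
  assumes "smooth_irreducible_affine_curve X"
    and "lam \<in> polys" and "nonvanishing_differential X lam"
    and "R \<in> polys"
    and "function_field_closure X lam L e \<delta>"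
    and riccati: "\<not> (\<exists>u\<in>carrier L.
      \<delta> u \<oplus>\<^bsub>L\<^esub> u [^]\<^bsub>L\<^esub> (2::nat) \<oplus>\<^bsub>L\<^esub> e (restrict (\<lambda>x. 1 / 2 * R x) X) = \<zero>\<^bsub>L\<^esub>)"
  shows "\<not> (\<exists>H. sub_D_groupoid X lam H (kummer X lam R) \<and> H \<noteq> kummer X lam R
    \<and> groupoid_order X H > 0)"
proof
  assume "\<exists>H. sub_D_groupoid X lam H (kummer X lam R) \<and> H \<noteq> kummer X lam R \<and> groupoid_order X H > 0"
  then obtain H where sub: "D_groupoid X lam H" "kummer X lam R \<subseteq> H" "H \<noteq> kummer X lam R"
    and ord: "groupoid_order X H > 0"
    unfolding sub_D_groupoid_def by blast
  have irred: "zariski_irreducible X"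
    using assms(1) unfolding smooth_irreducible_affine_curve_def by blast
  have rad: "radical_D_ideal X lam H" using sub(1) unfolding D_groupoid_def by blast
  interpret kummer_ideal X lam R H
  proof
    show "restrict (kummer_fun R) (Aut_inf X) \<in> H"
      using sub(2) unfolding kummer_def radical_D_ideal_gen_def kummer_fun_def[abs_def] by blast
  qed (fact irred assms(4) rad)+
  interpret kummer_subideal X lam R H L e \<delta>
  proof
    fix F q assume F: "F \<in> bipolys" "Van (\<lambda>p. F (endpoints p))" and q: "q \<in> X \<times> X"
    have "\<not> truncation X H 0 \<subset> Aut_jets 0 X"
    proof
      assume "truncation X H 0 \<subset> Aut_jets 0 X"
      then have "groupoid_order X H \<le> enat 0" unfolding groupoid_order_def by (intro INF_lower) simp
      then show False using ord by (simp add: zero_enat_def)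
    qed
    moreover have "truncation X H 0 \<subseteq> Aut_jets 0 X" unfolding truncation_def by blast
    ultimately have "truncation X H 0 = Aut_jets 0 X" by blast
    moreover have "arrow q 0 \<in> Aut_jets 0 X"
      using q unfolding Aut_jets_def by (auto simp: arrow_simps, auto simp: arrow_def)
    ultimately have "F (endpoints (arrow q 0)) = 0"
      using F(2) bipolys_jet_funs[OF F(1), of 0] unfolding truncation_def Van_def by blast
    then show "F q = 0" by (simp add: arrow_simps)
  qed (fact assms(5))
  have "\<exists>r\<in>carrier L. \<delta> r \<oplus>\<^bsub>L\<^esub> r \<otimes>\<^bsub>L\<^esub> r \<oplus>\<^bsub>L\<^esub> embed (\<lambda>x. 1 / 2 * R x) = \<zero>\<^bsub>L\<^esub>"
  proof (cases "\<exists>F\<in>polyfam bipolys. Van (pval F) \<and> (\<exists>q\<in>X \<times> X. F q \<noteq> 0)")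
    case True
    then obtain F q where F: "F \<in> polyfam bipolys" "Van (pval F)" "q \<in> X \<times> X" "F q \<noteq> 0" by blast
    have "rational_subgroupoid 1 X (truncation X H 1)" using sub(1) unfolding D_groupoid_def by blast
    then show ?thesis by (rule discrete_case[OF F])
  next
    case False
    obtain f p where f: "f \<in> jet_funs 2" "Van f" "p \<in> Aut_inf X" "f p \<noteq> 0"
      using ex_order2_element[OF irred assms(4) rad sub(2,3)] unfolding Van_def by blast
    obtain K F where F: "F \<in> polyfam (polyfam bipolys)" "\<And>p. p (Der 1) \<noteq> 0 \<Longrightarrow>
        p (Der 1) ^ K * f p = poly (poly (F (endpoints p)) [:ucoord p:]) (p (Der 1))"
      using order2_normal_form[OF f(1)] by blast
    have "Van (\<lambda>p. p (Der 1) ^ K * f p)"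
      by (rule Van_mult[OF Reg_power[OF Reg_Der] f(2)]) simp
    then have V: "Van (\<lambda>p. poly (poly (F (endpoints p)) [:ucoord p:]) (p (Der 1)))"
      by (rule Van_cong) (rule F(2)[OF Aut_inf_Der1])
    have "F (endpoints p) \<noteq> 0"
      using F(2)[of p, OF Aut_inf_Der1[OF f(3)]] f(4) Aut_inf_Der1[OF f(3)] by auto
    then show ?thesis
      by (rule generic_case[OF _ F(1) endpoints_in[OF f(3)] _ V, rotated]) (use False in blast)
  qed
  then obtain r where r: "r \<in> carrier L"
    "\<delta> r \<oplus>\<^bsub>L\<^esub> r \<otimes>\<^bsub>L\<^esub> r \<oplus>\<^bsub>L\<^esub> embed (\<lambda>x. 1 / 2 * R x) = \<zero>\<^bsub>L\<^esub>" by blast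
  interpret LF: algebraically_closed L by (rule L_closed)
  have "r [^]\<^bsub>L\<^esub> (2::nat) = r \<otimes>\<^bsub>L\<^esub> r"
    using r(1) by (simp add: numeral_2_eq_2)
  then show False using riccati r by auto
qed

end
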